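(* Assume that the cardinality of any set is an Ulam number (this assumption is not needed if the Banach space below is separable). Let $Z$ be a Banach space, let $T\in\mathbf M_1(Z)$ be a $1$-dimensional metric current, and suppose that the $L^\infty(\|T\|)$-module $\mathscr X(\|T\|)$ of derivations is finitely generated. Then there is a sequence of normal currents $\{N_n\}\subset\mathbf N_1(Z)$ such that $$\lim_{n\to\infty}\|T-N_n\|_{\mathbf M_1(Z)}=0.$$
   Context: The Ulam number assumption guarantees that masses of metric currents are concentrated on countable unions of compact sets; a cardinal is an Ulam number if every finite measure defined on all subsets of a set of that cardinality and vanishing on singletons is zero. METRIC CURRENTS. For a metric space $X$: $\mathrm{Lip}(X)$ is the set of real-valued Lipschitz functions, $\mathbf L(f)$ is the global Lipschitz constant of $f$, and $\mathrm{Lip}_b(X)$ is the set of bounded Lipschitz functions. $\mathscr D^k(X)=\mathrm{Lip}_b(X)\times \mathrm{Lip}(X)^k$. For $f_n,f\in\mathrm{Lip}(X)$ write $f_n\xrightarrow{w*}f$ if $f_n\to f$ pointwise and $\sup_n\mathbf L(f_n)<\infty$. A $k$-dimensional metric functional is a map $T:\mathscr D^k(X)\to\mathbb R$ which in each argument is subadditive ($|T(v_1+v_2)|\le|T(v_1)|+|T(v_2)|$) and positively $1$-homogeneous ($|T(\lambda v)|=\lambda|T(v)|$ for $\lambda\ge0$). It has finite mass if there is a finite Radon measure $\mu$ with $|T(f,\pi_1,\dots,\pi_k)|\le\prod_{i}\mathbf L(\pi_i)\int_X|f|\,d\mu$ for all $(f,\pi_1,\dots,\pi_k)$; the minimal such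 $\mu$ is the mass $\|T\|$. A $k$-dimensional metric current is a metric functional of finite mass which is (1) multilinear; (2) alternating in $\pi_1,\dots,\pi_k$; (3) local: $T(f,\pi_1,\dots,\pi_k)=0$ if some $\pi_i$ is constant on $\{f\ne0\}$; (4) continuous: $T(f_n,\pi_{1,n},\dots,\pi_{k,n})\to T(f,\pi_1,\dots,\pi_k)$ whenever $f_n\xrightarrow{w*}f$ with $\sup_n\|f_n\|_\infty<\infty$, $\|f\|_\infty<\infty$, and $\pi_{i,n}\xrightarrow{w*}\pi_i$ for each $i$. $\mathbf M_k(X)$ is the Banach space of $k$-dimensional metric currents with norm $\|T\|_{\mathbf M_k(X)}=\|T\|(X)$. For $k\ge1$ the boundary is $\partial T(f,\pi_1,\dots,\pi_{k-1})=T(1,f,\pi_1,\dots,\pi_{k-1})$; $T\in\mathbf M_k(X)$ is normal, $T\in\mathbf N_k(X)$, if $\partial T$ is a metric current. DERIVATIONS. $\mathrm{Lip}_b(X)$ with norm $\max(\|f\|_\infty,\mathbf L(f))$ is a dual Banach space (with predual the closed linear span of the point evaluations); on bounded sets its weak* topology is that of pointwise convergence. For a Radon measure $\mu$ on $X$, a derivation is a bounded linear map $D:\mathrm{Lip}_b(X)\to L^\infty(\mu)$ that is weak*-weak* continuous and satisfies $D(fg)=fDg+gDf$. The derivations form an $L^\infty(\mu)$-module $\mathscr X(\mu)$. *)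

theory Defs
  imports "HOL-Analysis.Analysis"
begin

section \<open>Lipschitz functions\<close>

definition Lip :: "('a::metric_space \<Rightarrow> real) set" where
  "Lip = {f. \<exists>C. C-lipschitz_on UNIV f}"

definition Lipb :: "('a::metric_space \<Rightarrow> real) set" where
  "Lipb = {f \<in> Lip. bounded (range f)}"

definition lip_const :: "('a::metric_space \<Rightarrow> real) \<Rightarrow> real" where
  "lip_const f = Inf {C. C-lipschitz_on UNIV f}"

definition sup_norm :: "('a \<Rightarrow> real) \<Rightarrow> real" where
  "sup_norm f = (SUP x. \<bar>f x\<bar>)"

definition Lipb_norm :: "('a::metric_space \<Rightarrow> real) \<Rightarrow> real" where
  "Lipb_norm f = max (sup_norm f) (lip_const f)"

definition wstar_conv :: "(nat \<Rightarrow> 'a::metric_space \<Rightarrow> real) \<Rightarrow> ('a \<Rightarrow> real) \<Rightarrow> bool" where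
  "wstar_conv fs f \<longleftrightarrow>
     (\<forall>n. fs n \<in> Lip) \<and> f \<in> Lip \<and>
     (\<forall>x. (\<lambda>n. fs n x) \<longlonglongrightarrow> f x) \<and>
     bdd_above (range (\<lambda>n. lip_const (fs n)))"


section \<open>Radon measures and Ulam numbers\<close>

definition finite_radon_measure :: "'a::topological_space measure \<Rightarrow> bool" where
  "finite_radon_measure \<mu> \<longleftrightarrow>
     sets \<mu> = sets borel \<and> finite_measure \<mu> \<and>
     (\<forall>A \<in> sets borel. emeasure \<mu> A = (SUP K \<in> {K. compact K \<and> K \<subseteq> A}. emeasure \<mu> K))"

text \<open>The cardinality of \<open>A\<close> is an Ulam number. The condition is invariant under bijections,
  so it may be tested on \<open>A\<close> itself.\<close>

definition ulam_cardinality :: "'a set \<Rightarrow> bool" where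
  "ulam_cardinality A \<longleftrightarrow>
     (\<forall>M. space M = A \<and> sets M = Pow A \<and> finite_measure M \<and> (\<forall>x\<in>A. emeasure M {x} = 0)
        \<longrightarrow> emeasure M A = 0)"


section \<open>Metric currents\<close>

text \<open>A functional on \<open>\<D>\<^sup>k\<close> takes \<open>f\<close> and the list \<open>[\<pi>\<^sub>1, \<dots>, \<pi>\<^sub>k]\<close>. It is a total function in HOL, but
  all notions below depend only on its values on \<open>dforms k\<close>.\<close>

type_synonym 'a functional = "('a \<Rightarrow> real) \<Rightarrow> ('a \<Rightarrow> real) list \<Rightarrow> real"

definition dforms :: "nat \<Rightarrow> (('a::metric_space \<Rightarrow> real) \<times> ('a \<Rightarrow> real) list) set" where
  "dforms k = {(f, ps). f \<in> Lipb \<and> length ps = k \<and> set ps \<subseteq> Lip}"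

definition metric_functional :: "nat \<Rightarrow> 'a::metric_space functional \<Rightarrow> bool" where
  "metric_functional k T \<longleftrightarrow>
     (\<forall>(f, ps) \<in> dforms k.
        (\<forall>g \<in> Lipb. \<bar>T (\<lambda>x. f x + g x) ps\<bar> \<le> \<bar>T f ps\<bar> + \<bar>T g ps\<bar>) \<and>
        (\<forall>c \<ge> 0. \<bar>T (\<lambda>x. c * f x) ps\<bar> = c * \<bar>T f ps\<bar>) \<and>
        (\<forall>i < k.
           (\<forall>p \<in> Lip. \<forall>q \<in> Lip.
              \<bar>T f (ps[i := (\<lambda>x. p x + q x)])\<bar> \<le> \<bar>T f (ps[i := p])\<bar> + \<bar>T f (ps[i := q])\<bar>) \<and>
           (\<forall>p \<in> Lip. \<forall>c \<ge> 0. \<bar>T f (ps[i := (\<lambda>x. c * p x)])\<bar> = c * \<bar>T f (ps[i := p])\<bar>)))"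

definition mass_bound :: "nat \<Rightarrow> 'a::metric_space functional \<Rightarrow> 'a measure \<Rightarrow> bool" where
  "mass_bound k T \<mu> \<longleftrightarrow>
     finite_radon_measure \<mu> \<and>
     (\<forall>(f, ps) \<in> dforms k. \<bar>T f ps\<bar> \<le> prod_list (map lip_const ps) * (\<integral>x. \<bar>f x\<bar> \<partial>\<mu>))"

definition finite_mass :: "nat \<Rightarrow> 'a::metric_space functional \<Rightarrow> bool" where
  "finite_mass k T \<longleftrightarrow> (\<exists>\<mu>. mass_bound k T \<mu>)"

text \<open>On measures with the same \<open>\<sigma>\<close>-algebra, the library order is \<open>\<mu> A \<le> \<nu> A\<close> for all measurable \<open>A\<close>.\<close>

definition mass :: "nat \<Rightarrow> 'a::metric_space functional \<Rightarrow> 'a measure" where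
  "mass k T = (LEAST \<mu>. mass_bound k T \<mu>)"

definition multilinear :: "nat \<Rightarrow> 'a::metric_space functional \<Rightarrow> bool" where
  "multilinear k T \<longleftrightarrow>
     (\<forall>(f, ps) \<in> dforms k.
        (\<forall>g \<in> Lipb. \<forall>a b. T (\<lambda>x. a * f x + b * g x) ps = a * T f ps + b * T g ps) \<and>
        (\<forall>i < k. \<forall>p \<in> Lip. \<forall>q \<in> Lip. \<forall>a b.
           T f (ps[i := (\<lambda>x. a * p x + b * q x)]) = a * T f (ps[i := p]) + b * T f (ps[i := q])))"

definition alternating :: "nat \<Rightarrow> 'a::metric_space functional \<Rightarrow> bool" where
  "alternating k T \<longleftrightarrow>
     (\<forall>(f, ps) \<in> dforms k. \<forall>i < k. \<forall>j < k. i \<noteq> j \<and> ps ! i = ps ! j \<longrightarrow> T f ps = 0)"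

definition local_functional :: "nat \<Rightarrow> 'a::metric_space functional \<Rightarrow> bool" where
  "local_functional k T \<longleftrightarrow>
     (\<forall>(f, ps) \<in> dforms k. (\<exists>i < k. \<exists>c. \<forall>x. f x \<noteq> 0 \<longrightarrow> (ps ! i) x = c) \<longrightarrow> T f ps = 0)"

definition continuous_functional :: "nat \<Rightarrow> 'a::metric_space functional \<Rightarrow> bool" where
  "continuous_functional k T \<longleftrightarrow>
     (\<forall>fs pss f ps.
        (\<forall>n. (fs n, pss n) \<in> dforms k) \<and> (f, ps) \<in> dforms k \<and>
        wstar_conv fs f \<and> bdd_above (range (\<lambda>n. sup_norm (fs n))) \<and>
        (\<forall>i < k. wstar_conv (\<lambda>n. pss n ! i) (ps ! i))
        \<longrightarrow> (\<lambda>n. T (fs n) (pss n)) \<longlonglongrightarrow> T f ps)"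

definition currents :: "nat \<Rightarrow> 'a::metric_space functional set" where
  "currents k = {T. metric_functional k T \<and> finite_mass k T \<and> multilinear k T \<and>
     alternating k T \<and> local_functional k T \<and> continuous_functional k T}"

definition current_norm :: "nat \<Rightarrow> 'a::metric_space functional \<Rightarrow> real" where
  "current_norm k T = measure (mass k T) UNIV"

definition boundary :: "'a functional \<Rightarrow> 'a functional" where
  "boundary T = (\<lambda>f ps. T (\<lambda>_. 1) (f # ps))"

definition normal_currents :: "nat \<Rightarrow> 'a::metric_space functional set" where
  "normal_currents k = {T \<in> currents k. k \<ge> 1 \<and> boundary T \<in> currents (k - 1)}"


section \<open>Derivations\<close>

text \<open>The predual of \<open>Lipb\<close>: functionals that are limits, in the operator norm dual to
  \<open>Lipb_norm\<close>, of finite linear combinations of point evaluations.\<close>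

definition Lipb_predual :: "(('a::metric_space \<Rightarrow> real) \<Rightarrow> real) set" where
  "Lipb_predual = {\<phi>. \<forall>e > 0. \<exists>F c. finite F \<and>
     (\<forall>f \<in> Lipb. \<bar>\<phi> f - (\<Sum>x\<in>F. c x * f x)\<bar> \<le> e * Lipb_norm f)}"

definition wstar_Lipb :: "('a::metric_space \<Rightarrow> real) topology" where
  "wstar_Lipb = topology_generated_by
     {{f \<in> Lipb. \<phi> f \<in> U} | \<phi> U. \<phi> \<in> Lipb_predual \<and> open U}"

text \<open>Elements of \<open>L\<^sup>\<infinity>(\<mu>)\<close> are represented by functions; identities between them are read
  \<open>\<mu>\<close>-almost everywhere. The weak* topology, as the dual of \<open>L\<^sup>1(\<mu>)\<close>, is the pullback
  to representatives.\<close>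

definition Linf :: "'a measure \<Rightarrow> ('a \<Rightarrow> real) set" where
  "Linf \<mu> = {g \<in> borel_measurable \<mu>. \<exists>C. AE x in \<mu>. \<bar>g x\<bar> \<le> C}"

definition wstar_Linf :: "'a measure \<Rightarrow> ('a \<Rightarrow> real) topology" where
  "wstar_Linf \<mu> = topology_generated_by
     {{g \<in> Linf \<mu>. (\<integral>x. g x * h x \<partial>\<mu>) \<in> U} | h U. integrable \<mu> h \<and> open (U :: real set)}"

definition derivations :: "'a::metric_space measure \<Rightarrow> (('a \<Rightarrow> real) \<Rightarrow> ('a \<Rightarrow> real)) set" where
  "derivations \<mu> = {D.
     (\<forall>f \<in> Lipb. D f \<in> Linf \<mu>) \<and>
     (\<forall>f \<in> Lipb. \<forall>g \<in> Lipb. \<forall>a b.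
        AE x in \<mu>. D (\<lambda>y. a * f y + b * g y) x = a * D f x + b * D g x) \<and>
     (\<exists>C. \<forall>f \<in> Lipb. AE x in \<mu>. \<bar>D f x\<bar> \<le> C * Lipb_norm f) \<and>
     continuous_map wstar_Lipb (wstar_Linf \<mu>) D \<and>
     (\<forall>f \<in> Lipb. \<forall>g \<in> Lipb. AE x in \<mu>. D (\<lambda>y. f y * g y) x = f x * D g x + g x * D f x)}"

definition derivations_finitely_generated :: "'a::metric_space measure \<Rightarrow> bool" where
  "derivations_finitely_generated \<mu> \<longleftrightarrow>
     (\<exists>n E. (\<forall>i < (n::nat). E i \<in> derivations \<mu>) \<and>
        (\<forall>D \<in> derivations \<mu>. \<exists>g. (\<forall>i < n. g i \<in> Linf \<mu>) \<and>
           (\<forall>f \<in> Lipb. AE x in \<mu>. D f x = (\<Sum>i<n. g i x * E i f x))))"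

end

theory Submission
  imports Defs
begin

text \<open>The boundary \<open>u p = T 1 [p]\<close> of a metric \<open>1\<close>-current is not just a bounded functional on Lipschitz functions:
  by continuity, locality and inner regularity of the mass it is small on functions vanishing on a suitable
  finite set. A Hahn--Banach argument (peeling off one difference quotient at a time) combined with
  McShane extension then writes \<open>u\<close> as a series of finite combinations of difference quotients
  \<open>(p x - p y) / dist x y\<close>, the \<open>n\<close>-th of total weight at most \<open>c / 2\<^sup>n\<close>. In a Banach space each difference
  quotient is the boundary of a segment of unit mass, so the series lifts to a series of polyhedral currents
  \<open>R\<^sub>k\<close> converging in mass. The current \<open>T - (\<Sum>k\<ge>n. R\<^sub>k)\<close> has the same boundary as \<open>\<Sum>k<n. R\<^sub>k\<close>, which is a
  finite combination of point masses; hence it is normal, and it differs from \<open>T\<close> by a tail of the series.\<close>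

section \<open>Lipschitz functions\<close>

text \<open>The norm is read off \<open>mass\<close>, a LEAST over all mass bounds, so it can only
  be estimated once a least mass bound is known to exist. Multilinearity lets a test function be
  split by a cutoff, so two mass bounds can be glued along a Borel set; gluing along a Hahn set
  gives a lower bound of the pair, and a decreasing minimising sequence gives the least element. The
  geometric weights come from a budget: peeling off a difference quotient with coefficient
  \<open>a\<close> lowers the remaining bound by |a|, so a functional of bound \<open>c\<close>
  costs total weight at most \<open>c\<close>, for any prescribed error. The error
  \<open>c / 2\<close> is chosen, and the residual is tight again, since the subtracted quotients
  vanish on functions that vanish at their endpoints. The step therefore repeats with half the
  bound. Sums, differences and series of currents are one construction, an integral over a counting
  measure. Lipschitz functions on a segment need not be differentiable everywhere, so segment
  currents are Riemann-Stieltjes limits along dyadic partitions.\<close>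

lemma LipI: "C-lipschitz_on UNIV f \<Longrightarrow> f \<in> Lip"
  by (auto simp: Lip_def)

lemma lip_const_le: "C-lipschitz_on UNIV f \<Longrightarrow> lip_const f \<le> C"
  unfolding lip_const_def
  by (rule cInf_lower) (auto intro!: bdd_belowI[of _ 0] dest: lipschitz_on_nonneg)

text \<open>Each difference quotient is a lower bound of the set of Lipschitz constants, hence at
  most its infimum: the infimum defining \<open>lip_const\<close> is attained.\<close>

lemma lipschitz_lip_const:
  assumes "f \<in> Lip"
  shows "(lip_const f)-lipschitz_on UNIV f"
proof -
  let ?S = "{C. C-lipschitz_on UNIV f}"
  have ne: "?S \<noteq> {}" using assms by (auto simp: Lip_def)
  show ?thesis
  proof (rule lipschitz_onI)
    show "0 \<le> lip_const f" unfolding lip_const_def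
      by (rule cInf_greatest[OF ne]) (auto dest: lipschitz_on_nonneg)
    fix x y
    show "dist (f x) (f y) \<le> lip_const f * dist x y"
    proof (cases "x = y")
      case False
      have "dist (f x) (f y) / dist x y \<le> lip_const f" unfolding lip_const_def
        by (rule cInf_greatest[OF ne])
           (use False in \<open>auto simp: field_simps dest!: lipschitz_onD[of _ UNIV f x y]\<close>)
      then show ?thesis using False by (simp add: field_simps)
    qed simp
  qed
qed

lemma lip_const_nonneg: "f \<in> Lip \<Longrightarrow> 0 \<le> lip_const f"
  using lipschitz_on_nonneg[OF lipschitz_lip_const] .

lemma lip_const_abs_diff:
  "f \<in> Lip \<Longrightarrow> \<bar>f x - f y\<bar> \<le> lip_const f * dist x y"
  using lipschitz_onD[OF lipschitz_lip_const, of f x y] by (simp add: dist_real_def)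

lemma Lip_lincomb:
  assumes "f \<in> Lip" "g \<in> Lip"
  shows "(\<lambda>x. a * f x + b * g x) \<in> Lip"
    and "lip_const (\<lambda>x. a * f x + b * g x) \<le> \<bar>a\<bar> * lip_const f + \<bar>b\<bar> * lip_const g"
proof -
  have "(\<bar>a\<bar> * lip_const f + \<bar>b\<bar> * lip_const g)-lipschitz_on UNIV (\<lambda>x. a * f x + b * g x)"
    by (intro lipschitz_intros lipschitz_lip_const assms)
  then show "(\<lambda>x. a * f x + b * g x) \<in> Lip"
    "lip_const (\<lambda>x. a * f x + b * g x) \<le> \<bar>a\<bar> * lip_const f + \<bar>b\<bar> * lip_const g"
    by (auto intro: LipI lip_const_le)
qed

lemma Lip_const [simp]: "(\<lambda>_. c) \<in> Lip"
  using lipschitz_on_constant[of UNIV c] by (rule LipI)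

lemma Lip_continuous: "f \<in> Lip \<Longrightarrow> continuous_on UNIV f"
  using lipschitz_on_continuous_on[OF lipschitz_lip_const] .

lemma Lip_borel_measurable: "f \<in> Lip \<Longrightarrow> f \<in> borel_measurable borel"
  by (intro borel_measurable_continuous_onI Lip_continuous)

lemma Lipb_Lip: "f \<in> Lipb \<Longrightarrow> f \<in> Lip"
  by (simp add: Lipb_def)

lemma abs_le_sup_norm:
  assumes "f \<in> Lipb"
  shows "\<bar>f x\<bar> \<le> sup_norm f"
proof -
  have "bdd_above (range (\<lambda>x. \<bar>f x\<bar>))"
    using assms unfolding Lipb_def bounded_iff bdd_above_def by fastforce
  then show ?thesis unfolding sup_norm_def by (intro cSUP_upper) auto
qed

lemma sup_norm_nonneg: "f \<in> Lipb \<Longrightarrow> 0 \<le> sup_norm f"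
  using abs_le_sup_norm[of f undefined] abs_ge_zero[of "f undefined"] by linarith

lemma LipbI: "f \<in> Lip \<Longrightarrow> (\<And>x. \<bar>f x\<bar> \<le> B) \<Longrightarrow> f \<in> Lipb"
  by (auto simp: Lipb_def bounded_iff)

lemma Lipb_const [simp]: "(\<lambda>_. c) \<in> Lipb"
  by (rule LipbI[of _ "\<bar>c\<bar>"]) auto

lemma Lipb_lincomb:
  assumes "f \<in> Lipb" "g \<in> Lipb"
  shows "(\<lambda>x. a * f x + b * g x) \<in> Lipb"
proof (rule LipbI)
  show "(\<lambda>x. a * f x + b * g x) \<in> Lip"
    using assms by (intro Lip_lincomb) (auto intro: Lipb_Lip)
  show "\<bar>a * f x + b * g x\<bar> \<le> \<bar>a\<bar> * sup_norm f + \<bar>b\<bar> * sup_norm g" for x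
    using abs_triangle_ineq[of "a * f x" "b * g x"]
      mult_left_mono[OF abs_le_sup_norm[OF assms(1), of x], of "\<bar>a\<bar>"]
      mult_left_mono[OF abs_le_sup_norm[OF assms(2), of x], of "\<bar>b\<bar>"]
    by (auto simp: abs_mult)
qed

lemma Lipb_mult:
  assumes "f \<in> Lipb" "g \<in> Lipb"
  shows "(\<lambda>x. f x * g x) \<in> Lipb"
proof (rule LipbI)
  have Lip: "f \<in> Lip" "g \<in> Lip" using assms by (auto intro: Lipb_Lip)
  show "\<bar>f x * g x\<bar> \<le> sup_norm f * sup_norm g" for x
    unfolding abs_mult using assms
    by (intro mult_mono abs_le_sup_norm sup_norm_nonneg) auto
  show "(\<lambda>x. f x * g x) \<in> Lip"
  proof (rule LipI, rule lipschitz_onI)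
    fix x y
    have "f x * g x - f y * g y = f x * (g x - g y) + (f x - f y) * g y"
      by (simp add: algebra_simps)
    also have "\<bar>\<dots>\<bar> \<le> \<bar>f x\<bar> * \<bar>g x - g y\<bar> + \<bar>f x - f y\<bar> * \<bar>g y\<bar>"
      by (metis abs_mult abs_triangle_ineq)
    also have "\<dots> \<le> sup_norm f * (lip_const g * dist x y) + (lip_const f * dist x y) * sup_norm g"
      using assms Lip
      by (intro add_mono mult_mono abs_le_sup_norm lip_const_abs_diff sup_norm_nonneg
          mult_nonneg_nonneg lip_const_nonneg) auto
    finally show "dist (f x * g x) (f y * g y)
        \<le> (sup_norm f * lip_const g + lip_const f * sup_norm g) * dist x y"
      by (simp add: dist_real_def algebra_simps)
  next
    show "0 \<le> sup_norm f * lip_const g + lip_const f * sup_norm g"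
      using assms Lip by (auto intro!: add_nonneg_nonneg mult_nonneg_nonneg sup_norm_nonneg lip_const_nonneg)
  qed
qed

lemma Lip_infdist_cutoff:
  assumes "0 < d"
  shows "(\<lambda>x. max 0 (1 - infdist x K / d)) \<in> Lip"
proof (rule LipI, rule lipschitz_onI)
  fix x y
  have "\<bar>infdist x K - infdist y K\<bar> \<le> dist x y"
    by (rule infdist_triangle_abs)
  then have "\<bar>infdist x K / d - infdist y K / d\<bar> \<le> 1/d * dist x y"
    using assms by (simp add: field_simps abs_mult flip: diff_divide_distrib)
  then show "dist (max 0 (1 - infdist x K / d)) (max 0 (1 - infdist y K / d)) \<le> 1/d * dist x y"
    by (auto simp: dist_real_def)
qed (use assms in auto)

lemma Lipb_cutoff: "0 < d \<Longrightarrow> (\<lambda>x. max 0 (1 - infdist x K / d)) \<in> Lipb"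
  by (rule LipbI[of _ 1]) (auto intro: Lip_infdist_cutoff simp: infdist_nonneg)

text \<open>Disjoint nonempty compact sets have positive distance, and that distance is the width of
  the tent around \<open>K\<close>. The function will stand in for the indicator of a Borel set
  approximated from inside by \<open>K\<close>, with complement approximated by
  \<open>L\<close>.\<close>

lemma Lipb_separating:
  assumes "compact K" "compact L" "K \<inter> L = {}"
  obtains \<phi> where "\<phi> \<in> Lipb" "\<And>x. 0 \<le> \<phi> x" "\<And>x. \<phi> x \<le> 1"
    "\<And>x. x \<in> K \<Longrightarrow> \<phi> x = 1" "\<And>x. x \<in> L \<Longrightarrow> \<phi> x = (0::real)"
\<comment> \<open>\<open>infdist\<close> to the empty set is 0 and a minimum over an empty
  \<open>L\<close> does not exist, so constants serve in these cases.\<close>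
proof (cases "K = {} \<or> L = {}")
  case True
  then consider "K = {}" | "L = {}" by auto
  then show ?thesis
  proof cases
    case 1 then show ?thesis by (intro that[of "\<lambda>_. 0"]) auto
  next
    case 2 then show ?thesis by (intro that[of "\<lambda>_. 1"]) auto
  qed
next
  case False
  have "continuous_on L (\<lambda>x. infdist x K)" by (intro continuous_intros)
  then obtain z where z: "z \<in> L" "\<And>x. x \<in> L \<Longrightarrow> infdist z K \<le> infdist x K"
    using continuous_attains_inf[of L "\<lambda>x. infdist x K"] assms(2) False by auto
  have "infdist z K \<noteq> 0"
    using in_closed_iff_infdist_zero[of K z] compact_imp_closed[OF assms(1)] False z(1) assms(3) by auto
  then have d: "infdist z K > 0" using infdist_nonneg[of z K] by linarith
  show ?thesis
  proof (rule that[of "\<lambda>x. max 0 (1 - infdist x K / infdist z K)"])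
    show "(\<lambda>x. max 0 (1 - infdist x K / infdist z K)) \<in> Lipb" by (rule Lipb_cutoff[OF d])
    show "max 0 (1 - infdist x K / infdist z K) \<le> 1" for x
      using d by (simp add: infdist_nonneg)
    show "max 0 (1 - infdist x K / infdist z K) = 0" if "x \<in> L" for x
      using z(2)[OF that] d by (simp add: field_simps)
  qed auto
qed

section \<open>Radon measures\<close>

text \<open>Finiteness turns the supremum of \<open>emeasure\<close> over compact sets into a small
  real remainder \<open>measure \<mu> (A - K)\<close>. This form passes directly to smaller
  measures, images and superpositions.\<close>

lemma finite_radon_measure_iff:
  "finite_radon_measure \<mu> \<longleftrightarrow> sets \<mu> = sets borel \<and> finite_measure \<mu> \<and>
     (\<forall>A\<in>sets borel. \<forall>e>0. \<exists>K. compact K \<and> K \<subseteq> A \<and> measure \<mu> (A - K) \<le> e)"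
  for \<mu> :: "'a::t2_space measure"
proof (cases "sets \<mu> = sets borel \<and> finite_measure \<mu>")
  case True
  then interpret finite_measure \<mu> by simp
  have K: "K \<in> sets \<mu>" if "compact K" for K using that True by (auto intro: borel_compact)
  have "(emeasure \<mu> A = (SUP K \<in> {K. compact K \<and> K \<subseteq> A}. emeasure \<mu> K)) \<longleftrightarrow>
      (\<forall>e>0. \<exists>K. compact K \<and> K \<subseteq> A \<and> measure \<mu> (A - K) \<le> e)" if A: "A \<in> sets borel" for A
  proof
    have A': "A \<in> sets \<mu>" using A True by simp
    assume eq: "emeasure \<mu> A = (SUP K \<in> {K. compact K \<and> K \<subseteq> A}. emeasure \<mu> K)"
    show "\<forall>e>0. \<exists>K. compact K \<and> K \<subseteq> A \<and> measure \<mu> (A - K) \<le> e"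
    proof (intro allI impI)
      fix e :: real assume e: "e > 0"
      have "\<exists>K\<in>{K. compact K \<and> K \<subseteq> A}. emeasure \<mu> A < emeasure \<mu> K + ennreal e"
        unfolding eq by (rule SUP_approx_ennreal) (use e eq[symmetric] in auto)
      then obtain K where K': "compact K" "K \<subseteq> A" "emeasure \<mu> A < emeasure \<mu> K + ennreal e" by auto
      have "ennreal (measure \<mu> A) < ennreal (measure \<mu> K + e)"
        using K'(3) e by (simp add: emeasure_eq_measure)
      then have "measure \<mu> A < measure \<mu> K + e"
        by (subst (asm) ennreal_less_iff) auto
      then show "\<exists>K. compact K \<and> K \<subseteq> A \<and> measure \<mu> (A - K) \<le> e"
        using K' K[OF K'(1)] A' by (intro exI[of _ K]) (auto simp: finite_measure_Diff)
    qed
  next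
    have A': "A \<in> sets \<mu>" using A True by simp
    assume ap: "\<forall>e>0. \<exists>K. compact K \<and> K \<subseteq> A \<and> measure \<mu> (A - K) \<le> e"
    show "emeasure \<mu> A = (SUP K \<in> {K. compact K \<and> K \<subseteq> A}. emeasure \<mu> K)"
    proof (rule antisym)
      show "(SUP K \<in> {K. compact K \<and> K \<subseteq> A}. emeasure \<mu> K) \<le> emeasure \<mu> A"
        using A' by (auto intro!: SUP_least emeasure_mono)
      show "emeasure \<mu> A \<le> (SUP K \<in> {K. compact K \<and> K \<subseteq> A}. emeasure \<mu> K)"
      proof (rule ennreal_le_epsilon)
        fix e :: real assume "0 < e"
        with ap obtain K where K': "compact K" "K \<subseteq> A" "measure \<mu> (A - K) \<le> e" by blast
        have "measure \<mu> A \<le> measure \<mu> K + e"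
          using K' K[OF K'(1)] A' by (simp add: finite_measure_Diff)
        then have "emeasure \<mu> A \<le> emeasure \<mu> K + e"
          using \<open>0 < e\<close> by (simp add: emeasure_eq_measure flip: ennreal_plus)
        also have "\<dots> \<le> (SUP K \<in> {K. compact K \<and> K \<subseteq> A}. emeasure \<mu> K) + e"
          using K' by (intro add_right_mono SUP_upper) auto
        finally show "emeasure \<mu> A \<le> (SUP K \<in> {K. compact K \<and> K \<subseteq> A}. emeasure \<mu> K) + e" .
      qed
    qed
  qed
  then show ?thesis using True unfolding finite_radon_measure_def by auto
qed (auto simp: finite_radon_measure_def)

lemma finite_radon_measureD:
  assumes "finite_radon_measure \<mu>"
  shows "sets \<mu> = sets borel" "finite_measure \<mu>" "space \<mu> = UNIV"
  using assms sets_eq_imp_space_eq[of \<mu> borel] by (auto simp: finite_radon_measure_def)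

lemma radon_compact_approx:
  fixes \<mu> :: "'a::t2_space measure"
  assumes "finite_radon_measure \<mu>" "A \<in> sets borel" "e > 0"
  obtains K where "compact K" "K \<subseteq> A" "measure \<mu> (A - K) \<le> e"
  using assms unfolding finite_radon_measure_iff by blast

text \<open>The compact set chosen for \<mu> also serves \<nu>, whose remainder is no
  larger.\<close>

lemma finite_radon_measure_le:
  fixes \<mu> \<nu> :: "'a::t2_space measure"
  assumes \<mu>: "finite_radon_measure \<mu>" and \<nu>: "sets \<nu> = sets borel" "\<nu> \<le> \<mu>"
  shows "finite_radon_measure \<nu>"
proof -
  note D = finite_radon_measureD[OF \<mu>]
  interpret \<mu>: finite_measure \<mu> by (rule D)
  have le: "emeasure \<nu> A \<le> emeasure \<mu> A" for A
    using le_measureD3[OF \<nu>(2)] \<nu>(1) D by simp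
  have "emeasure \<nu> (space \<nu>) < \<infinity>"
    using le[of "space \<nu>"] \<mu>.emeasure_finite[of "space \<nu>"]
    by (metis infinity_ennreal_def less_top order_le_less_trans)
  then interpret \<nu>: finite_measure \<nu> by (intro finite_measureI) auto
  have "measure \<nu> A \<le> measure \<mu> A" for A
    using le[of A] by (simp add: \<mu>.emeasure_eq_measure \<nu>.emeasure_eq_measure)
  then show ?thesis
    using \<mu> \<nu>(1) \<nu>.finite_measure_axioms unfolding finite_radon_measure_iff by (meson order_trans)
qed

lemma Lipb_integrable:
  assumes "finite_measure \<mu>" "sets \<mu> = sets borel" "f \<in> Lipb"
  shows "integrable \<mu> f" "integrable \<mu> (\<lambda>x. \<bar>f x\<bar>)"
proof -
  interpret finite_measure \<mu> by fact
  have "f \<in> borel_measurable \<mu>"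
    using Lip_borel_measurable[OF Lipb_Lip[OF assms(3)]] measurable_cong_sets[OF assms(2) refl] by blast
  then show "integrable \<mu> f"
    using abs_le_sup_norm[OF assms(3)] by (intro integrable_const_bound[of _ "sup_norm f"]) auto
  then show "integrable \<mu> (\<lambda>x. \<bar>f x\<bar>)" by simp
qed

section \<open>Superpositions\<close>

text \<open>The sum of the measures \<open>M i\<close>, written as an integral over the counting
  measure of \<open>I\<close>. Finite sums and series are then instances of one notion, and
  interchanging limits is dominated or monotone convergence.\<close>

definition superpose_measure :: "'i set \<Rightarrow> ('i \<Rightarrow> 'a::topological_space measure) \<Rightarrow> 'a measure" where
  "superpose_measure I M =
     measure_of UNIV (sets borel) (\<lambda>A. \<integral>\<^sup>+ i. emeasure (M i) A \<partial>count_space I)"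

lemma sets_superpose [simp]: "sets (superpose_measure I M) = sets borel"
  unfolding superpose_measure_def using sets.sigma_sets_eq[of borel]
  by (subst sets_measure_of) (auto simp: borel_def)

lemma space_superpose [simp]: "space (superpose_measure I M) = UNIV"
  using sets_eq_imp_space_eq[OF sets_superpose] by simp

lemma emeasure_superpose:
  assumes "\<And>i. i \<in> I \<Longrightarrow> sets (M i) = sets borel" "A \<in> sets borel"
  shows "emeasure (superpose_measure I M) A = (\<integral>\<^sup>+ i. emeasure (M i) A \<partial>count_space I)"
proof (rule emeasure_measure_of[OF superpose_measure_def])
  show "sets borel \<subseteq> Pow UNIV" by simp
  show "A \<in> sets (superpose_measure I M)" using assms by simp
  show "positive (sets (superpose_measure I M)) (\<lambda>A. \<integral>\<^sup>+ i. emeasure (M i) A \<partial>count_space I)"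
    by (simp add: positive_def)
  show "countably_additive (sets (superpose_measure I M)) (\<lambda>A. \<integral>\<^sup>+ i. emeasure (M i) A \<partial>count_space I)"
  proof (rule countably_additiveI)
    fix A :: "nat \<Rightarrow> 'b set"
    assume A: "range A \<subseteq> sets (superpose_measure I M)" "disjoint_family A"
    have "(\<Sum>n. \<integral>\<^sup>+ i. emeasure (M i) (A n) \<partial>count_space I)
        = (\<integral>\<^sup>+ i. (\<Sum>n. emeasure (M i) (A n)) \<partial>count_space I)"
      by (rule nn_integral_suminf[symmetric]) simp
    also have "\<dots> = (\<integral>\<^sup>+ i. emeasure (M i) (\<Union>n. A n) \<partial>count_space I)"
      using A assms(1) by (intro nn_integral_cong suminf_emeasure) auto
    finally show "(\<Sum>n. \<integral>\<^sup>+ i. emeasure (M i) (A n) \<partial>count_space I)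
        = (\<integral>\<^sup>+ i. emeasure (M i) (\<Union>n. A n) \<partial>count_space I)" .
  qed
qed

lemma nn_integral_superpose:
  assumes M: "\<And>i. i \<in> I \<Longrightarrow> sets (M i) = sets borel" and f: "f \<in> borel_measurable borel"
  shows "(\<integral>\<^sup>+ x. f x \<partial>superpose_measure I M) = (\<integral>\<^sup>+ i. (\<integral>\<^sup>+ x. f x \<partial>M i) \<partial>count_space I)"
proof -
  let ?S = "superpose_measure I M"
  have mS: "g \<in> borel_measurable ?S" if "g \<in> borel_measurable borel" for g :: "'b \<Rightarrow> ennreal"
    using that measurable_cong_sets[OF sets_superpose refl] by blast
  have mM: "g \<in> borel_measurable (M i)" if "g \<in> borel_measurable borel" "i \<in> I" for i and g :: "'b \<Rightarrow> ennreal"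
    using that(1) measurable_cong_sets[OF M[OF that(2)] refl] by blast
  show ?thesis using f
  proof (induction rule: borel_measurable_induct)
    case (cong f g)
    then have "f = g" by (auto simp: fun_eq_iff)
    then show ?case using cong by simp
  next
    case (set A)
    have "(\<integral>\<^sup>+ i. (\<integral>\<^sup>+ x. indicator A x \<partial>M i) \<partial>count_space I) = (\<integral>\<^sup>+ i. emeasure (M i) A \<partial>count_space I)"
      using M set by (intro nn_integral_cong nn_integral_indicator) auto
    then show ?case using set by (simp add: emeasure_superpose[OF M])
  next
    case (mult u c)
    have "(\<integral>\<^sup>+ i. (\<integral>\<^sup>+ x. c * u x \<partial>M i) \<partial>count_space I) = (\<integral>\<^sup>+ i. c * (\<integral>\<^sup>+ x. u x \<partial>M i) \<partial>count_space I)"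
      by (intro nn_integral_cong nn_integral_cmult mM mult.hyps) simp
    then show ?case by (simp add: nn_integral_cmult mS mult.hyps mult.IH)
  next
    case (add u v)
    have "(\<integral>\<^sup>+ i. (\<integral>\<^sup>+ x. v x + u x \<partial>M i) \<partial>count_space I)
        = (\<integral>\<^sup>+ i. (\<integral>\<^sup>+ x. v x \<partial>M i) + (\<integral>\<^sup>+ x. u x \<partial>M i) \<partial>count_space I)"
      by (intro nn_integral_cong nn_integral_add mM add.hyps) simp_all
    then show ?case by (simp add: nn_integral_add mS add.hyps add.IH)
  next
    case (seq U)
    have "(\<integral>\<^sup>+ i. (\<integral>\<^sup>+ x. (SUP n. U n x) \<partial>M i) \<partial>count_space I)
        = (\<integral>\<^sup>+ i. (SUP n. \<integral>\<^sup>+ x. U n x \<partial>M i) \<partial>count_space I)"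
      by (intro nn_integral_cong nn_integral_monotone_convergence_SUP mM seq.hyps) simp_all
    also have "\<dots> = (SUP n. \<integral>\<^sup>+ i. (\<integral>\<^sup>+ x. U n x \<partial>M i) \<partial>count_space I)"
      using seq by (intro nn_integral_monotone_convergence_SUP)
        (auto simp: incseq_def le_fun_def intro!: nn_integral_mono)
    also have "\<dots> = (SUP n. \<integral>\<^sup>+ x. U n x \<partial>?S)" using seq by simp
    also have "\<dots> = (\<integral>\<^sup>+ x. (SUP n. U n x) \<partial>?S)"
      by (intro nn_integral_monotone_convergence_SUP[symmetric] mS seq.hyps)
    finally show ?case by (simp add: SUP_apply image_image)
  qed
qed

text \<open>Everything is dominated by the total masses: \<open>measure (M i) A\<close> by
  \<open>measure (M i) UNIV\<close>, and the integral of |f| by \<open>sup_norm f\<close> times it.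
  Summability of the total masses thus turns the \<open>nn_integral\<close> identities into real
  ones.\<close>

lemma integral_superpose:
  fixes f :: "'a::metric_space \<Rightarrow> real"
  assumes M: "\<And>i. i \<in> I \<Longrightarrow> sets (M i) = sets borel" "\<And>i. i \<in> I \<Longrightarrow> finite_measure (M i)"
    and int: "integrable (count_space I) (\<lambda>i. measure (M i) UNIV)" and f: "f \<in> Lipb"
  shows "finite_measure (superpose_measure I M)"
    and "A \<in> sets borel \<Longrightarrow> measure (superpose_measure I M) A = (\<integral>i. measure (M i) A \<partial>count_space I)"
    and "(\<integral>x. \<bar>f x\<bar> \<partial>superpose_measure I M) = (\<integral>i. (\<integral>x. \<bar>f x\<bar> \<partial>M i) \<partial>count_space I)"
    and "integrable (count_space I) (\<lambda>i. \<integral>x. \<bar>f x\<bar> \<partial>M i)"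
proof -
  let ?S = "superpose_measure I M"
  have em: "emeasure ?S A = ennreal (\<integral>i. measure (M i) A \<partial>count_space I)"
    "integrable (count_space I) (\<lambda>i. measure (M i) A)" if A: "A \<in> sets borel" for A
  proof -
    have le: "measure (M i) A \<le> measure (M i) UNIV" if "i \<in> I" for i
      using finite_measure.finite_measure_mono[OF M(2)[OF that], of A UNIV] M(1)[OF that] by simp
    show 1: "integrable (count_space I) (\<lambda>i. measure (M i) A)"
      by (rule Bochner_Integration.integrable_bound[OF int]) (auto simp: le AE_count_space)
    have "emeasure ?S A = (\<integral>\<^sup>+ i. emeasure (M i) A \<partial>count_space I)"
      by (rule emeasure_superpose[OF M(1) A])
    also have "\<dots> = (\<integral>\<^sup>+ i. ennreal (measure (M i) A) \<partial>count_space I)"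
      by (intro nn_integral_cong) (auto simp: finite_measure.emeasure_eq_measure[OF M(2)])
    also have "\<dots> = ennreal (\<integral>i. measure (M i) A \<partial>count_space I)"
      by (rule nn_integral_eq_integral[OF 1]) auto
    finally show "emeasure ?S A = ennreal (\<integral>i. measure (M i) A \<partial>count_space I)" .
  qed
  show fin: "finite_measure ?S" using em(1)[of UNIV] by (intro finite_measureI) auto
  show "measure ?S A = (\<integral>i. measure (M i) A \<partial>count_space I)" if "A \<in> sets borel"
    using em(1)[OF that] unfolding measure_def by (simp add: integral_nonneg_AE)
  have fi: "integrable (M i) (\<lambda>x. \<bar>f x\<bar>)" if "i \<in> I" for i
    by (rule Lipb_integrable(2)[OF M(2)[OF that] M(1)[OF that] f])
  have fS: "integrable ?S (\<lambda>x. \<bar>f x\<bar>)" by (rule Lipb_integrable(2)[OF fin _ f]) simp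
  have bnd: "(\<integral>x. \<bar>f x\<bar> \<partial>M i) \<le> sup_norm f * measure (M i) UNIV" if "i \<in> I" for i
  proof -
    interpret finite_measure "M i" by (rule M(2)[OF that])
    have "(\<integral>x. \<bar>f x\<bar> \<partial>M i) \<le> (\<integral>x. sup_norm f \<partial>M i)"
      by (intro integral_mono fi that abs_le_sup_norm f) auto
    then show ?thesis using sets_eq_imp_space_eq[OF M(1)[OF that]] by (simp add: mult.commute)
  qed
  show int2: "integrable (count_space I) (\<lambda>i. \<integral>x. \<bar>f x\<bar> \<partial>M i)"
    by (rule Bochner_Integration.integrable_bound[OF integrable_mult_right[OF int, of "sup_norm f"]])
       (auto simp: AE_count_space intro!: order_trans[OF bnd])
  have "ennreal (\<integral>x. \<bar>f x\<bar> \<partial>?S) = (\<integral>\<^sup>+x. ennreal \<bar>f x\<bar> \<partial>?S)"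
    by (rule nn_integral_eq_integral[symmetric, OF fS]) auto
  also have "\<dots> = (\<integral>\<^sup>+ i. (\<integral>\<^sup>+ x. ennreal \<bar>f x\<bar> \<partial>M i) \<partial>count_space I)"
    using Lip_borel_measurable[OF Lipb_Lip[OF f]] by (intro nn_integral_superpose M) measurable
  also have "\<dots> = (\<integral>\<^sup>+ i. ennreal (\<integral>x. \<bar>f x\<bar> \<partial>M i) \<partial>count_space I)"
    by (intro nn_integral_cong nn_integral_eq_integral fi) auto
  also have "\<dots> = ennreal (\<integral>i. (\<integral>x. \<bar>f x\<bar> \<partial>M i) \<partial>count_space I)"
    by (intro nn_integral_eq_integral int2) auto
  finally show "(\<integral>x. \<bar>f x\<bar> \<partial>?S) = (\<integral>i. (\<integral>x. \<bar>f x\<bar> \<partial>M i) \<partial>count_space I)"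
    by (subst (asm) ennreal_inj) (auto intro!: integral_nonneg_AE)
qed

text \<open>The compact set \<open>L n\<close> unites approximations for the first \<open>n\<close>
  indices, each with error at most \<open>1 / Suc n\<close>. The remainder tends to 0 for every
  index and is dominated by the total masses, so dominated convergence applies.\<close>

lemma finite_radon_superpose:
  fixes M :: "'i \<Rightarrow> 'a::metric_space measure"
  assumes I: "countable I" and M: "\<And>i. i \<in> I \<Longrightarrow> finite_radon_measure (M i)"
    and int: "integrable (count_space I) (\<lambda>i. measure (M i) UNIV)"
  shows "finite_radon_measure (superpose_measure I M)"
proof -
  let ?S = "superpose_measure I M"
  note D = finite_radon_measureD[OF M]
  note S = integral_superpose[OF D(1) D(2) int Lipb_const[of 1]]
  have "\<exists>K. compact K \<and> K \<subseteq> A \<and> measure ?S (A - K) \<le> e" if A: "A \<in> sets borel" and e: "e > 0" for A e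
  proof -
    have "\<exists>K. compact K \<and> K \<subseteq> A \<and> measure (M i) (A - K) \<le> 1 / Suc n" if "i \<in> I" for i and n :: nat
      by (rule radon_compact_approx[OF M[OF that] A, of "1 / Suc n"]) auto
    then obtain K where K: "compact (K i n)" "K i n \<subseteq> A" "measure (M i) (A - K i n) \<le> 1 / Suc n"
      if "i \<in> I" for i and n :: nat by metis
    define J where "J n = {i \<in> I. to_nat_on I i < n}" for n :: nat
    define L where "L n = (\<Union>i\<in>J n. K i n)" for n
    have "finite (J n)" for n
    proof -
      have "inj_on (to_nat_on I) (J n)"
        using inj_on_to_nat_on[OF I] by (rule inj_on_subset) (auto simp: J_def)
      then show ?thesis by (rule inj_on_finite[of _ _ "{..<n}"]) (auto simp: J_def)
    qed
    then have L: "compact (L n)" "L n \<subseteq> A" for n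
      unfolding L_def using K(1,2) by (auto simp: J_def intro!: compact_UN) (meson subsetD)
    have LB: "L n \<in> sets borel" for n using L(1) by (rule borel_compact)
    have "(\<lambda>n. \<integral>i. measure (M i) (A - L n) \<partial>count_space I) \<longlonglongrightarrow> (\<integral>i. 0 \<partial>count_space I)"
    proof (rule integral_dominated_convergence[OF _ _ int])
      show "AE i in count_space I. (\<lambda>n. measure (M i) (A - L n)) \<longlonglongrightarrow> 0"
        unfolding AE_count_space
      proof
        fix i assume i: "i \<in> I"
        interpret finite_measure "M i" by (rule D(2)[OF i])
        have "\<forall>\<^sub>F n in sequentially. measure (M i) (A - L n) \<le> 1 / Suc n"
          using eventually_gt_at_top[of "to_nat_on I i"]
        proof eventually_elim
          case (elim n)
          then have "K i n \<subseteq> L n" using i by (auto simp: L_def J_def)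
          moreover have "K i n \<in> sets borel" using K(1)[OF i] by (rule borel_compact)
          ultimately have "measure (M i) (A - L n) \<le> measure (M i) (A - K i n)"
            using A D(1)[OF i] by (intro finite_measure_mono) auto
          then show ?case using K(3)[OF i, of n] by linarith
        qed
        then show "(\<lambda>n. measure (M i) (A - L n)) \<longlonglongrightarrow> 0"
          by (intro real_tendsto_sandwich[OF _ _ tendsto_const LIMSEQ_Suc[OF lim_1_over_n]]) auto
      qed
      show "AE i in count_space I. norm (measure (M i) (A - L n)) \<le> measure (M i) UNIV" for n
        unfolding AE_count_space
      proof
        fix i assume i: "i \<in> I"
        interpret finite_measure "M i" by (rule D(2)[OF i])
        show "norm (measure (M i) (A - L n)) \<le> measure (M i) UNIV"
          using D(1)[OF i] by (simp add: finite_measure_mono)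
      qed
    qed auto
    then have "(\<lambda>n. measure ?S (A - L n)) \<longlonglongrightarrow> 0"
      using A LB by (simp add: S(2))
    then have "\<forall>\<^sub>F n in sequentially. measure ?S (A - L n) < e"
      using e by (rule order_tendstoD(2))
    then obtain n where "measure ?S (A - L n) < e" by (auto dest: eventually_happens)
    then show ?thesis using L[of n] by (intro exI[of _ "L n"]) auto
  qed
  then show ?thesis using S(1) unfolding finite_radon_measure_iff by simp
qed

section \<open>Currents\<close>

lemma prod_list_lip_const_nonneg:
  "set ps \<subseteq> Lip \<Longrightarrow> 0 \<le> prod_list (map lip_const ps)"
  by (induction ps) (auto intro!: mult_nonneg_nonneg lip_const_nonneg)

lemma mass_boundD:
  assumes "mass_bound k T \<mu>" "(f, ps) \<in> dforms k"
  shows "\<bar>T f ps\<bar> \<le> prod_list (map lip_const ps) * (\<integral>x. \<bar>f x\<bar> \<partial>\<mu>)"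
    and "\<bar>T f ps\<bar> \<le> prod_list (map lip_const ps) * (sup_norm f * measure \<mu> UNIV)"
proof -
  have f: "f \<in> Lipb" and ps: "set ps \<subseteq> Lip" using assms(2) by (auto simp: dforms_def)
  show 1: "\<bar>T f ps\<bar> \<le> prod_list (map lip_const ps) * (\<integral>x. \<bar>f x\<bar> \<partial>\<mu>)"
    using assms by (auto simp: mass_bound_def)
  have R: "finite_radon_measure \<mu>" using assms(1) by (simp add: mass_bound_def)
  note D = finite_radon_measureD[OF R]
  interpret finite_measure \<mu> by (rule D)
  have "(\<integral>x. \<bar>f x\<bar> \<partial>\<mu>) \<le> (\<integral>x. sup_norm f \<partial>\<mu>)"
    by (intro integral_mono Lipb_integrable D f abs_le_sup_norm) auto
  then have "(\<integral>x. \<bar>f x\<bar> \<partial>\<mu>) \<le> sup_norm f * measure \<mu> UNIV"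
    using D(3) by (simp add: mult.commute)
  then show "\<bar>T f ps\<bar> \<le> prod_list (map lip_const ps) * (sup_norm f * measure \<mu> UNIV)"
    using 1 mult_left_mono[OF _ prod_list_lip_const_nonneg[OF ps]] by (meson order_trans)
qed

lemma mass_bound_radon: "mass_bound k T \<mu> \<Longrightarrow> finite_radon_measure \<mu>"
  by (simp add: mass_bound_def)

lemma dforms_lincomb1:
  assumes "(f, ps) \<in> dforms k" "g \<in> Lipb"
  shows "(g, ps) \<in> dforms k" "(\<lambda>x. a * f x + b * g x, ps) \<in> dforms k"
  using assms by (auto simp: dforms_def intro: Lipb_lincomb)

lemma dforms_update:
  assumes "(f, ps) \<in> dforms k" "p \<in> Lip"
  shows "(f, ps[i := p]) \<in> dforms k"
  using assms set_update_subset_insert[of ps i p] by (fastforce simp: dforms_def)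

lemma multilinearD:
  assumes "multilinear k T" "(f, ps) \<in> dforms k"
  shows "g \<in> Lipb \<Longrightarrow> T (\<lambda>x. a * f x + b * g x) ps = a * T f ps + b * T g ps"
    and "i < k \<Longrightarrow> p \<in> Lip \<Longrightarrow> q \<in> Lip \<Longrightarrow>
      T f (ps[i := \<lambda>x. a * p x + b * q x]) = a * T f (ps[i := p]) + b * T f (ps[i := q])"
  using assms unfolding multilinear_def by blast+

text \<open>Coefficients 1 and 1 give subadditivity, \<open>c\<close> and 0 give homogeneity; for
  the currents built below only multilinearity has to be shown.\<close>

lemma multilinear_metric_functional:
  fixes T :: "'a::metric_space functional"
  assumes T: "multilinear k T"
  shows "metric_functional k T"
  unfolding metric_functional_def
proof (clarify, intro conjI ballI allI impI)
  fix f :: "'a \<Rightarrow> real" and ps assume d: "(f, ps) \<in> dforms k"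
  note * = multilinearD[OF T d]
  have f: "f \<in> Lipb" using d by (simp add: dforms_def)
  show "\<bar>T (\<lambda>x. f x + g x) ps\<bar> \<le> \<bar>T f ps\<bar> + \<bar>T g ps\<bar>" if "g \<in> Lipb" for g
    using *(1)[OF that, of 1 1] by simp
  show "\<bar>T (\<lambda>x. c * f x) ps\<bar> = c * \<bar>T f ps\<bar>" if "0 \<le> c" for c
    using *(1)[OF f, of c 0] that by (simp add: abs_mult)
  fix i assume i: "i < k"
  show "\<bar>T f (ps[i := (\<lambda>x. p x + q x)])\<bar> \<le> \<bar>T f (ps[i := p])\<bar> + \<bar>T f (ps[i := q])\<bar>"
    if "p \<in> Lip" "q \<in> Lip" for p q
    using *(2)[OF i that, of 1 1] by simp
  show "\<bar>T f (ps[i := (\<lambda>x. c * p x)])\<bar> = c * \<bar>T f (ps[i := p])\<bar>" if "p \<in> Lip" "0 \<le> c" for p c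
    using *(2)[OF i that(1,1), of c 0] that(2) by (simp add: abs_mult)
qed

text \<open>The constant \<open>B\<close> is independent of \<open>n\<close>; it enters the
  dominating function in the continuity of a superposition.\<close>

lemma wstar_conv_lip_bounded:
  assumes "\<And>i. i < k \<Longrightarrow> wstar_conv (\<lambda>n. pss n ! i) (ps ! i)" "\<And>n. length (pss n) = k"
  obtains B where "0 \<le> B" "\<And>n. prod_list (map lip_const (pss n)) \<le> B"
proof -
  have "\<exists>b. \<forall>n. lip_const (pss n ! i) \<le> b" if "i < k" for i
    using assms(1)[OF that] by (fastforce simp: wstar_conv_def bdd_above_def)
  then obtain b where b: "lip_const (pss n ! i) \<le> b i" if "i < k" for i n by metis
  have nn: "0 \<le> lip_const (pss n ! i)" if "i < k" for i n
    using assms(1)[OF that] by (simp add: wstar_conv_def lip_const_nonneg)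
  show ?thesis
  proof (rule that)
    show "0 \<le> (\<Prod>i<k. b i)"
      by (rule prod_nonneg) (use nn b in \<open>meson lessThan_iff order_trans\<close>)
    show "prod_list (map lip_const (pss n)) \<le> (\<Prod>i<k. b i)" for n
      by (auto simp: prod.list_conv_set_nth assms(2) atLeast0LessThan intro!: prod_mono nn b)
  qed
qed

text \<open>Locality and alternation hold term by term, linearity passes through the integral, and
  continuity follows by dominated convergence: the weak* hypotheses bound all terms by a fixed
  multiple of the mass of \<open>M i\<close>. Differences, finite sums and series all come from this
  statement.\<close>

lemma currents_superpose:
  fixes R :: "'i \<Rightarrow> 'a::metric_space functional"
  assumes I: "countable I" and R: "\<And>i. i \<in> I \<Longrightarrow> R i \<in> currents k"
    and M: "\<And>i. i \<in> I \<Longrightarrow> mass_bound k (R i) (M i)"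
    and int: "integrable (count_space I) (\<lambda>i. measure (M i) UNIV)"
  defines "S \<equiv> \<lambda>f ps. \<integral>i. R i f ps \<partial>count_space I"
  shows "S \<in> currents k" "mass_bound k S (superpose_measure I M)"
    "measure (superpose_measure I M) UNIV = (\<integral>i. measure (M i) UNIV \<partial>count_space I)"
    "(f, ps) \<in> dforms k \<Longrightarrow> integrable (count_space I) (\<lambda>i. R i f ps)"
proof -
  note D = finite_radon_measureD[OF mass_bound_radon[OF M]]
  have SM: "A \<in> sets borel \<Longrightarrow> measure (superpose_measure I M) A = (\<integral>i. measure (M i) A \<partial>count_space I)"
    "g \<in> Lipb \<Longrightarrow> (\<integral>x. \<bar>g x\<bar> \<partial>superpose_measure I M) = (\<integral>i. (\<integral>x. \<bar>g x\<bar> \<partial>M i) \<partial>count_space I)"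
    "g \<in> Lipb \<Longrightarrow> integrable (count_space I) (\<lambda>i. \<integral>x. \<bar>g x\<bar> \<partial>M i)" for A and g :: "'a \<Rightarrow> real"
    using integral_superpose[OF D(1) D(2) int] Lipb_const[of 1] by blast+
  have intR: "integrable (count_space I) (\<lambda>i. R i f ps)" if d: "(f, ps) \<in> dforms k" for f ps
    by (rule Bochner_Integration.integrable_bound[OF integrable_mult_right[OF integrable_mult_right[OF int,
              of "sup_norm f"], of "prod_list (map lip_const ps)"]])
       (use d in \<open>auto simp: AE_count_space intro: order_trans[OF mass_boundD(2)[OF M d]]\<close>)
  then show "(f, ps) \<in> dforms k \<Longrightarrow> integrable (count_space I) (\<lambda>i. R i f ps)" .
  show "measure (superpose_measure I M) UNIV = (\<integral>i. measure (M i) UNIV \<partial>count_space I)"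
    by (rule SM(1)) simp
  have linR: "multilinear k (R i)" if "i \<in> I" for i using R[OF that] by (simp add: currents_def)
  have lin: "multilinear k S" unfolding multilinear_def
  proof (clarify, intro conjI ballI allI impI)
    fix f :: "'a \<Rightarrow> real" and ps assume d: "(f, ps) \<in> dforms k"
    show "S (\<lambda>x. a * f x + b * g x) ps = a * S f ps + b * S g ps" if g: "g \<in> Lipb" for g a b
    proof -
      have "S (\<lambda>x. a * f x + b * g x) ps = (\<integral>i. a * R i f ps + b * R i g ps \<partial>count_space I)"
        unfolding S_def
        by (intro Bochner_Integration.integral_cong refl) (simp add: multilinearD(1)[OF linR d g])
      also have "\<dots> = a * S f ps + b * S g ps"
        unfolding S_def using intR[OF d] intR[OF dforms_lincomb1(1)[OF d g]] by simp
      finally show ?thesis .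
    qed
    show "S f (ps[i := \<lambda>x. a * p x + b * q x]) = a * S f (ps[i := p]) + b * S f (ps[i := q])"
      if i: "i < k" and pq: "p \<in> Lip" "q \<in> Lip" for i p q a b
    proof -
      have "S f (ps[i := \<lambda>x. a * p x + b * q x]) =
          (\<integral>j. a * R j f (ps[i := p]) + b * R j f (ps[i := q]) \<partial>count_space I)"
        unfolding S_def
        by (intro Bochner_Integration.integral_cong refl) (simp add: multilinearD(2)[OF linR d i pq])
      also have "\<dots> = a * S f (ps[i := p]) + b * S f (ps[i := q])"
        unfolding S_def using intR[OF dforms_update[OF d pq(1)]] intR[OF dforms_update[OF d pq(2)]]
        by simp
      finally show ?thesis .
    qed
  qed
  show MB: "mass_bound k S (superpose_measure I M)"
    unfolding mass_bound_def
  proof (intro conjI ballI; (clarify)?)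
    show "finite_radon_measure (superpose_measure I M)"
      by (rule finite_radon_superpose[OF I mass_bound_radon[OF M] int])
    fix f :: "'a \<Rightarrow> real" and ps assume d: "(f, ps) \<in> dforms k"
    then have f: "f \<in> Lipb" by (simp add: dforms_def)
    have "\<bar>S f ps\<bar> \<le> (\<integral>i. \<bar>R i f ps\<bar> \<partial>count_space I)"
      unfolding S_def by (rule integral_abs_bound)
    also have "\<dots> \<le> (\<integral>i. prod_list (map lip_const ps) * (\<integral>x. \<bar>f x\<bar> \<partial>M i) \<partial>count_space I)"
      using intR[OF d] SM(3)[OF f] mass_boundD(1)[OF M d] by (intro integral_mono) auto
    also have "\<dots> = prod_list (map lip_const ps) * (\<integral>x. \<bar>f x\<bar> \<partial>superpose_measure I M)"
      by (simp add: SM(2)[OF f])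
    finally show "\<bar>S f ps\<bar> \<le> \<dots>" .
  qed
  have alt: "alternating k S"
    unfolding alternating_def S_def
  proof clarify
    fix f :: "'a \<Rightarrow> real" and ps i j
    assume *: "(f, ps) \<in> dforms k" "i < k" "j < k" "i \<noteq> j" "ps ! i = ps ! j"
    have "R l f ps = 0" if "l \<in> I" for l
      using R[OF that] * unfolding currents_def alternating_def by blast
    then show "(\<integral>i. R i f ps \<partial>count_space I) = 0"
      by (subst Bochner_Integration.integral_cong[where g="\<lambda>_. 0"]) auto
  qed
  have loc: "local_functional k S"
    unfolding local_functional_def S_def
  proof clarify
    fix f :: "'a \<Rightarrow> real" and ps i c
    assume *: "(f, ps) \<in> dforms k" "i < k" "\<forall>x. f x \<noteq> 0 \<longrightarrow> (ps ! i) x = c"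
    have "R l f ps = 0" if "l \<in> I" for l
      using R[OF that] * unfolding currents_def local_functional_def by blast
    then show "(\<integral>i. R i f ps \<partial>count_space I) = 0"
      by (subst Bochner_Integration.integral_cong[where g="\<lambda>_. 0"]) auto
  qed
  have "continuous_functional k S"
    unfolding continuous_functional_def
  proof (clarify)
    fix fs :: "nat \<Rightarrow> 'a \<Rightarrow> real" and pss f ps
    assume *: "\<forall>n. (fs n, pss n) \<in> dforms k" "(f, ps) \<in> dforms k" "wstar_conv fs f"
      "bdd_above (range (\<lambda>n. sup_norm (fs n)))" "\<forall>i<k. wstar_conv (\<lambda>n. pss n ! i) (ps ! i)"
    obtain B where B: "0 \<le> B" "\<And>n. prod_list (map lip_const (pss n)) \<le> B"
      using wstar_conv_lip_bounded[of k pss ps] *(1,5) by (auto simp: dforms_def)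
    obtain C where C: "sup_norm (fs n) \<le> C" for n
      using *(4) by (auto simp: bdd_above_def)
    show "(\<lambda>n. S (fs n) (pss n)) \<longlonglongrightarrow> S f ps"
      unfolding S_def
    proof (rule integral_dominated_convergence)
      show "integrable (count_space I) (\<lambda>i. B * (C * measure (M i) UNIV))"
        using int by simp
      show "AE i in count_space I. (\<lambda>n. R i (fs n) (pss n)) \<longlonglongrightarrow> R i f ps"
        unfolding AE_count_space
      proof
        fix i assume "i \<in> I"
        then have "continuous_functional k (R i)" using R by (simp add: currents_def)
        then show "(\<lambda>n. R i (fs n) (pss n)) \<longlonglongrightarrow> R i f ps"
          using * unfolding continuous_functional_def by blast
      qed
      show "AE i in count_space I. norm (R i (fs n) (pss n)) \<le> B * (C * measure (M i) UNIV)" for n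
        unfolding AE_count_space
      proof
        fix i assume i: "i \<in> I"
        have d: "(fs n, pss n) \<in> dforms k" using * by simp
        then have "fs n \<in> Lipb" by (simp add: dforms_def)
        moreover have "0 \<le> C" using sup_norm_nonneg[OF calculation] C[of n] by linarith
        ultimately have "prod_list (map lip_const (pss n)) * (sup_norm (fs n) * measure (M i) UNIV)
            \<le> B * (C * measure (M i) UNIV)"
          by (intro mult_mono B C) (auto intro!: B mult_nonneg_nonneg sup_norm_nonneg)
        then show "norm (R i (fs n) (pss n)) \<le> B * (C * measure (M i) UNIV)"
          using mass_boundD(2)[OF M[OF i] d] by simp
      qed
    qed auto
  qed
  then show "S \<in> currents k"
    using lin MB alt loc multilinear_metric_functional[OF lin]
    by (auto simp: currents_def finite_mass_def)
qed

section \<open>Tools for comparing mass bounds\<close>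

lemma le_of_le_add_mult:
  fixes a b c :: real
  assumes "\<And>e. e > 0 \<Longrightarrow> a \<le> b + e * c"
  shows "a \<le> b"
proof (rule field_le_epsilon)
  fix e :: real assume "e > 0"
  \<comment> \<open>The divisor is positive even for \<open>c = 0\<close>.\<close>
  then have "a \<le> b + e / (\<bar>c\<bar> + 1) * c" by (intro assms) auto
  also have "e / (\<bar>c\<bar> + 1) * c \<le> e"
  proof -
    have "c * e \<le> \<bar>c\<bar> * e" using \<open>e > 0\<close> by (intro mult_right_mono) auto
    then have "c * e \<le> e + e * \<bar>c\<bar>" using \<open>e > 0\<close> by (subst mult.commute[of e "\<bar>c\<bar>"]) linarith
    then show ?thesis by (simp add: field_simps)
  qed
  finally show "a \<le> b + e" by simp
qed

text \<open>Division by a finite nonzero \<open>c\<close> gives the nontrivial direction. For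
  infinite \<open>c\<close> the equation fails when the \<open>f i\<close> are nonzero with infimum
  0; over an empty \<open>I\<close> it fails for \<open>c = 0\<close>.\<close>

lemma INF_mult_right_ennreal:
  fixes c :: ennreal
  assumes "I \<noteq> {}" "c \<noteq> top"
  shows "(INF i\<in>I. f i * c) = (INF i\<in>I. f i) * c"
proof (rule antisym)
  show "(INF i\<in>I. f i) * c \<le> (INF i\<in>I. f i * c)"
    by (intro INF_greatest mult_right_mono INF_lower) auto
  show "(INF i\<in>I. f i * c) \<le> (INF i\<in>I. f i) * c"
  proof (cases "c = 0")
    case True
    then show ?thesis using assms(1) by simp
  next
    case False
    have "(INF i\<in>I. f i * c) / c \<le> f i" if "i \<in> I" for i
    proof -
      have "(INF i\<in>I. f i * c) / c \<le> f i * c / c"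
        by (intro divide_right_mono_ennreal INF_lower that)
      then show ?thesis using False assms(2) by (simp add: ennreal_mult_divide_eq)
    qed
    then have "(INF i\<in>I. f i * c) / c * c \<le> (INF i\<in>I. f i) * c"
      by (intro mult_right_mono INF_greatest) auto
    then show ?thesis using False assms(2)
      by (simp add: ennreal_divide_times top.not_eq_extremum)
  qed
qed

text \<open>Outside \<open>A\<close> the product survives only on \<open>- A - K\<close>, since
  \<phi> vanishes on \<open>K\<close>. The error is thus controlled by the part of the complement
  that the compact set misses.\<close>

lemma integral_cutoff_le:
  fixes \<mu> :: "'a::metric_space measure"
  assumes \<mu>: "finite_radon_measure \<mu>" and f: "f \<in> Lipb" and \<phi>: "\<phi> \<in> Lipb" "\<And>x. 0 \<le> \<phi> x" "\<And>x. \<phi> x \<le> 1"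
    and K: "compact K" "K \<subseteq> - A" "\<And>x. x \<in> K \<Longrightarrow> \<phi> x = 0" and A: "A \<in> sets borel"
  shows "(\<integral>x. \<bar>f x * \<phi> x\<bar> \<partial>\<mu>) \<le> (\<integral>x. indicator A x * \<bar>f x\<bar> \<partial>\<mu>) + sup_norm f * measure \<mu> (- A - K)"
proof -
  note D = finite_radon_measureD[OF \<mu>]
  interpret finite_measure \<mu> by (rule D)
  have B: "- A - K \<in> sets \<mu>" using A borel_compact[OF K(1)] D(1) by auto
  have AB: "A \<in> sets \<mu>" using A D by simp
  have i1: "integrable \<mu> (\<lambda>x. indicator A x * \<bar>f x\<bar>)"
    using integrable_mult_indicator[OF AB Lipb_integrable(2)[OF D(2,1) f]] by simp
  have i2: "integrable \<mu> (\<lambda>x. sup_norm f * indicator (- A - K) x)"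
    using B by (intro integrable_mult_right integrable_real_indicator) (auto simp: less_top[symmetric])
  have "(\<integral>x. \<bar>f x * \<phi> x\<bar> \<partial>\<mu>) \<le> (\<integral>x. indicator A x * \<bar>f x\<bar> + sup_norm f * indicator (- A - K) x \<partial>\<mu>)"
  proof (rule integral_mono)
    show "integrable \<mu> (\<lambda>x. \<bar>f x * \<phi> x\<bar>)" by (rule Lipb_integrable(2)[OF D(2,1) Lipb_mult[OF f \<phi>(1)]])
    fix x
    have "\<bar>f x * \<phi> x\<bar> \<le> \<bar>f x\<bar>" using \<phi>(2,3)[of x] by (simp add: abs_mult mult_left_le)
    then show "\<bar>f x * \<phi> x\<bar> \<le> indicator A x * \<bar>f x\<bar> + sup_norm f * indicator (- A - K) x"
      using K(3)[of x] abs_le_sup_norm[OF f, of x] by (auto simp: indicator_def)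
  qed (use i1 i2 in auto)
  also have "\<dots> = (\<integral>x. indicator A x * \<bar>f x\<bar> \<partial>\<mu>) + sup_norm f * measure \<mu> (- A - K)"
    using B D(3) by (subst Bochner_Integration.integral_add[OF i1 i2]) simp
  finally show ?thesis .
qed

section \<open>The mass\<close>

text \<open>The measure equal to \<mu> inside \<open>A\<close> and to \<nu> outside, as a
  superposition over \<open>bool\<close>. If \<open>A\<close> is a Hahn set on which \<mu> is the
  smaller one, this is the infimum of the pair.\<close>

definition glue_measure :: "'a::topological_space set \<Rightarrow> 'a measure \<Rightarrow> 'a measure \<Rightarrow> 'a measure" where
  "glue_measure A \<mu> \<nu> = superpose_measure UNIV
     (\<lambda>b. if b then density \<mu> (indicator A) else density \<nu> (indicator (- A)))"

lemma density_indicator_le: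
  assumes "A \<in> sets \<mu>"
  shows "density \<mu> (indicator A) \<le> \<mu>"
  unfolding le_measure_iff
proof (simp, rule le_funI)
  fix B
  show "emeasure (density \<mu> (indicator A)) B \<le> emeasure \<mu> B"
  proof (cases "B \<in> sets \<mu>")
    case True
    have "emeasure (density \<mu> (indicator A)) B = (\<integral>\<^sup>+x. indicator A x * indicator B x \<partial>\<mu>)"
      using assms True by (simp add: emeasure_density)
    also have "\<dots> \<le> (\<integral>\<^sup>+x. indicator B x \<partial>\<mu>)"
      by (intro nn_integral_mono) (auto simp: indicator_def)
    finally show ?thesis using True by simp
  next
    case False
    then show ?thesis by (simp add: emeasure_notin_sets)
  qed
qed

lemma glue_measure:
  fixes \<mu> \<nu> :: "'a::metric_space measure"
  assumes \<mu>: "finite_radon_measure \<mu>" and \<nu>: "finite_radon_measure \<nu>" and A: "A \<in> sets borel"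
  shows "finite_radon_measure (glue_measure A \<mu> \<nu>)"
    and "B \<in> sets borel \<Longrightarrow> emeasure (glue_measure A \<mu> \<nu>) B = emeasure \<mu> (A \<inter> B) + emeasure \<nu> (B - A)"
    and "f \<in> Lipb \<Longrightarrow> (\<integral>x. \<bar>f x\<bar> \<partial>glue_measure A \<mu> \<nu>) =
      (\<integral>x. indicator A x * \<bar>f x\<bar> \<partial>\<mu>) + (\<integral>x. indicator (- A) x * \<bar>f x\<bar> \<partial>\<nu>)"
proof -
  let ?M = "\<lambda>b. if b then density \<mu> (indicator A) else density \<nu> (indicator (- A))"
  note D = finite_radon_measureD[OF \<mu>] and E = finite_radon_measureD[OF \<nu>]
  have A': "A \<in> sets \<mu>" "- A \<in> sets \<nu>" using A D(1) E(1) by auto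
  have R: "finite_radon_measure (?M b)" for b
    using finite_radon_measure_le[OF \<mu> _ density_indicator_le[OF A'(1)]]
      finite_radon_measure_le[OF \<nu> _ density_indicator_le[OF A'(2)]] D(1) E(1) by auto
  note F = finite_radon_measureD[OF R]
  have int: "integrable (count_space UNIV) (\<lambda>b. measure (?M b) UNIV)" by (rule integrable_count_space) simp
  show "finite_radon_measure (glue_measure A \<mu> \<nu>)"
    unfolding glue_measure_def by (rule finite_radon_superpose[OF _ R int]) simp
  show "(\<integral>x. \<bar>f x\<bar> \<partial>glue_measure A \<mu> \<nu>) =
      (\<integral>x. indicator A x * \<bar>f x\<bar> \<partial>\<mu>) + (\<integral>x. indicator (- A) x * \<bar>f x\<bar> \<partial>\<nu>)" if f: "f \<in> Lipb"
  proof -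
    have m: "(\<lambda>x. \<bar>f x\<bar>) \<in> borel_measurable \<mu>" "(\<lambda>x. \<bar>f x\<bar>) \<in> borel_measurable \<nu>"
      using Lipb_integrable(2)[OF D(2,1) f] Lipb_integrable(2)[OF E(2,1) f] by auto
    have "(\<integral>x. \<bar>f x\<bar> \<partial>glue_measure A \<mu> \<nu>) = (\<integral>b. (\<integral>x. \<bar>f x\<bar> \<partial>?M b) \<partial>count_space UNIV)"
      unfolding glue_measure_def by (rule integral_superpose(3)[OF F(1,2) int f])
    also have "\<dots> = (\<integral>x. \<bar>f x\<bar> \<partial>density \<mu> (\<lambda>x. ennreal (indicator A x)))
        + (\<integral>x. \<bar>f x\<bar> \<partial>density \<nu> (\<lambda>x. ennreal (indicator (- A) x)))"
      by (simp add: lebesgue_integral_count_space_finite UNIV_bool ennreal_indicator)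
    also have "\<dots> = (\<integral>x. indicator A x * \<bar>f x\<bar> \<partial>\<mu>) + (\<integral>x. indicator (- A) x * \<bar>f x\<bar> \<partial>\<nu>)"
      using m A' by (simp add: integral_density)
    finally show ?thesis .
  qed
  show "emeasure (glue_measure A \<mu> \<nu>) B = emeasure \<mu> (A \<inter> B) + emeasure \<nu> (B - A)" if B: "B \<in> sets borel"
  proof -
    have "emeasure (glue_measure A \<mu> \<nu>) B = (\<integral>\<^sup>+b. emeasure (?M b) B \<partial>count_space UNIV)"
      unfolding glue_measure_def by (rule emeasure_superpose[OF F(1) B])
    also have "\<dots> = emeasure (density \<mu> (indicator A)) B + emeasure (density \<nu> (indicator (- A))) B"
      by (simp add: nn_integral_count_space_finite UNIV_bool)
    also have "emeasure (density \<mu> (indicator A)) B = emeasure \<mu> (A \<inter> B)"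
      using A' B D(1) by (simp add: emeasure_density flip: indicator_inter_arith)
    also have "emeasure (density \<nu> (indicator (- A))) B = emeasure \<nu> (B - A)"
      using A' B E(1) by (simp add: emeasure_density Diff_eq Int_commute flip: indicator_inter_arith)
    finally show ?thesis .
  qed
qed

text \<open>Split \<open>f\<close> into \<open>f * \<phi>\<close> and its complement with \<phi>
  close to the indicator of \<open>A\<close>; the first part is estimated by \<mu>, the second by
  \<nu>. Both errors are fixed multiples of an arbitrary \<open>e\<close>.\<close>

lemma mass_bound_glue:
  fixes T :: "'a::metric_space functional"
  assumes T: "multilinear k T" and \<mu>: "mass_bound k T \<mu>" and \<nu>: "mass_bound k T \<nu>" and A: "A \<in> sets borel"
  shows "mass_bound k T (glue_measure A \<mu> \<nu>)"
  unfolding mass_bound_def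
proof (intro conjI ballI; (clarify)?)
  note R = mass_bound_radon[OF \<mu>] mass_bound_radon[OF \<nu>]
  note D = finite_radon_measureD[OF R(1)] and E = finite_radon_measureD[OF R(2)]
  show "finite_radon_measure (glue_measure A \<mu> \<nu>)" by (rule glue_measure(1)[OF R A])
  fix f :: "'a \<Rightarrow> real" and ps assume d: "(f, ps) \<in> dforms k"
  then have f: "f \<in> Lipb" and ps: "set ps \<subseteq> Lip" by (auto simp: dforms_def)
  let ?P = "prod_list (map lip_const ps)"
  have P: "0 \<le> ?P" by (rule prod_list_lip_const_nonneg[OF ps])
  show "\<bar>T f ps\<bar> \<le> ?P * (\<integral>x. \<bar>f x\<bar> \<partial>glue_measure A \<mu> \<nu>)"
  proof (rule le_of_le_add_mult)
    fix e :: real assume e: "e > 0"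
    \<comment> \<open>Each compact set is chosen for the measure that is to be kept off it:
      \<open>K\<close> exhausts \<open>A\<close> for \<nu>, and \<open>L\<close> exhausts
      \<open>- A\<close> for \<mu>.\<close>
    obtain K where K: "compact K" "K \<subseteq> A" "measure \<nu> (A - K) \<le> e"
      using radon_compact_approx[OF R(2) A e] .
    obtain L where L: "compact L" "L \<subseteq> - A" "measure \<mu> (- A - L) \<le> e"
      using radon_compact_approx[OF R(1) _ e, of "- A"] A by auto
    obtain \<phi> where \<phi>: "\<phi> \<in> Lipb" "\<And>x. 0 \<le> \<phi> x" "\<And>x. \<phi> x \<le> 1"
      "\<And>x. x \<in> K \<Longrightarrow> \<phi> x = 1" "\<And>x. x \<in> L \<Longrightarrow> \<phi> x = (0::real)"
      using Lipb_separating[OF K(1) L(1)] K(2) L(2) by blast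
    have \<psi>: "(\<lambda>x. 1 - \<phi> x) \<in> Lipb" using Lipb_lincomb[OF Lipb_const \<phi>(1), of 1 1 "-1"] by simp
    note f1 = Lipb_mult[OF f \<phi>(1)] and f2 = Lipb_mult[OF f \<psi>]
    have d1: "(\<lambda>x. f x * \<phi> x, ps) \<in> dforms k" and d2: "(\<lambda>x. f x * (1 - \<phi> x), ps) \<in> dforms k"
      using dforms_lincomb1(1)[OF d] f1 f2 by auto
    have "f = (\<lambda>x. 1 * (f x * \<phi> x) + 1 * (f x * (1 - \<phi> x)))" by (auto simp: algebra_simps)
    then have "T f ps = T (\<lambda>x. f x * \<phi> x) ps + T (\<lambda>x. f x * (1 - \<phi> x)) ps"
      using multilinearD(1)[OF T d1 f2, of 1 1] by simp
    then have "\<bar>T f ps\<bar> \<le> \<bar>T (\<lambda>x. f x * \<phi> x) ps\<bar> + \<bar>T (\<lambda>x. f x * (1 - \<phi> x)) ps\<bar>" by simp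
    also have "\<dots> \<le> ?P * (\<integral>x. \<bar>f x * \<phi> x\<bar> \<partial>\<mu>) + ?P * (\<integral>x. \<bar>f x * (1 - \<phi> x)\<bar> \<partial>\<nu>)"
      by (intro add_mono mass_boundD(1)[OF \<mu> d1] mass_boundD(1)[OF \<nu> d2])
    also have "\<dots> \<le> ?P * ((\<integral>x. indicator A x * \<bar>f x\<bar> \<partial>\<mu>) + sup_norm f * e)
        + ?P * ((\<integral>x. indicator (- A) x * \<bar>f x\<bar> \<partial>\<nu>) + sup_norm f * e)"
    proof (intro add_mono mult_left_mono P)
      have "(\<integral>x. \<bar>f x * \<phi> x\<bar> \<partial>\<mu>) \<le> (\<integral>x. indicator A x * \<bar>f x\<bar> \<partial>\<mu>) + sup_norm f * measure \<mu> (- A - L)"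
        by (rule integral_cutoff_le[OF R(1) f \<phi>(1-3) L(1,2) \<phi>(5) A])
      then show "(\<integral>x. \<bar>f x * \<phi> x\<bar> \<partial>\<mu>) \<le> (\<integral>x. indicator A x * \<bar>f x\<bar> \<partial>\<mu>) + sup_norm f * e"
        using mult_left_mono[OF L(3) sup_norm_nonneg[OF f]] by linarith
      have "(\<integral>x. \<bar>f x * (1 - \<phi> x)\<bar> \<partial>\<nu>)
          \<le> (\<integral>x. indicator (- A) x * \<bar>f x\<bar> \<partial>\<nu>) + sup_norm f * measure \<nu> (- (- A) - K)"
        by (rule integral_cutoff_le[OF R(2) f \<psi> _ _ K(1)]) (use \<phi> K A in auto)
      then show "(\<integral>x. \<bar>f x * (1 - \<phi> x)\<bar> \<partial>\<nu>) \<le> (\<integral>x. indicator (- A) x * \<bar>f x\<bar> \<partial>\<nu>) + sup_norm f * e"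
        using mult_left_mono[OF K(3) sup_norm_nonneg[OF f]] by simp
    qed
    also have "\<dots> = ?P * (\<integral>x. \<bar>f x\<bar> \<partial>glue_measure A \<mu> \<nu>) + e * (2 * ?P * sup_norm f)"
      by (simp add: glue_measure(3)[OF R A f] algebra_simps)
    finally show "\<bar>T f ps\<bar> \<le> \<dots>" .
  qed
qed

text \<open>The Hahn set \<open>A\<close> has \<mu> below \<nu> inside and \<nu> below \<mu>
  outside, so gluing along it keeps the smaller measure on each side.\<close>

lemma mass_bound_inf:
  fixes T :: "'a::metric_space functional"
  assumes T: "multilinear k T" and \<mu>: "mass_bound k T \<mu>" and \<nu>: "mass_bound k T \<nu>"
  obtains \<kappa> where "mass_bound k T \<kappa>" "\<kappa> \<le> \<mu>" "\<kappa> \<le> \<nu>"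
proof -
  note R = mass_bound_radon[OF \<mu>] mass_bound_radon[OF \<nu>]
  note D = finite_radon_measureD[OF R(1)] and E = finite_radon_measureD[OF R(2)]
  interpret m: finite_measure \<mu> by (rule D)
  interpret n: finite_measure \<nu> by (rule E)
  obtain A where A: "A \<in> sets \<nu>" "\<And>X. X \<in> sets \<nu> \<Longrightarrow> X \<subseteq> A \<Longrightarrow> emeasure \<mu> X \<le> emeasure \<nu> X"
    "\<And>X. X \<in> sets \<nu> \<Longrightarrow> X \<inter> A = {} \<Longrightarrow> emeasure \<nu> X \<le> emeasure \<mu> X"
    using unsigned_Hahn_decomposition[of \<mu> \<nu> UNIV] D(1) E(1) by auto
  have AB: "A \<in> sets borel" using A(1) E by simp
  let ?\<kappa> = "glue_measure A \<mu> \<nu>"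
  have em: "emeasure ?\<kappa> B = emeasure \<mu> (A \<inter> B) + emeasure \<nu> (B - A)" if "B \<in> sets borel" for B
    by (rule glue_measure(2)[OF R AB that])
  have sets: "sets ?\<kappa> = sets borel" "space ?\<kappa> = UNIV"
    using finite_radon_measureD[OF glue_measure(1)[OF R AB]] by auto
  have "emeasure ?\<kappa> B \<le> emeasure \<mu> B \<and> emeasure ?\<kappa> B \<le> emeasure \<nu> B" for B
  proof (cases "B \<in> sets borel")
    case True
    then have B: "A \<inter> B \<in> sets borel" "B - A \<in> sets borel" using AB by auto
    have s: "emeasure \<mu> B = emeasure \<mu> (A \<inter> B) + emeasure \<mu> (B - A)"
      "emeasure \<nu> B = emeasure \<nu> (A \<inter> B) + emeasure \<nu> (B - A)"
      using B D(1) E(1) by (subst plus_emeasure; auto simp: Int_Diff_Un intro!: arg_cong[where f="emeasure _"])+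
    show ?thesis unfolding em[OF True] s
      using A(2)[of "A \<inter> B"] A(3)[of "B - A"] B E(1) by (auto intro!: add_mono)
  qed (simp add: emeasure_notin_sets sets)
  then have "?\<kappa> \<le> \<mu>" "?\<kappa> \<le> \<nu>"
    using D E sets by (auto simp: le_measure_iff le_fun_def)
  then show ?thesis using that mass_bound_glue[OF T \<mu> \<nu> AB] by blast
qed

text \<open>On the set where \<open>g x < f x\<close> the order of the densities forces the integral
  of \<open>f - g\<close> to be 0. Finiteness of the integral of \<open>g\<close> is what allows the
  subtraction in \<open>ennreal\<close>.\<close>

lemma density_le_imp_AE_le:
  assumes f: "f \<in> borel_measurable M" and g: "g \<in> borel_measurable M" and fin: "(\<integral>\<^sup>+x. g x \<partial>M) \<noteq> \<infinity>"
    and le: "density M f \<le> density M g"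
  shows "AE x in M. f x \<le> g x"
proof -
  let ?N = "{x \<in> space M. g x < f x}"
  have N: "?N \<in> sets M" using f g by measurable
  have emN: "emeasure (density M f) ?N \<le> emeasure (density M g) ?N"
    using le_measureD3[OF le] by simp
  have gN: "(\<integral>\<^sup>+x. g x * indicator ?N x \<partial>M) \<noteq> \<infinity>"
  proof -
    have "(\<integral>\<^sup>+x. g x * indicator ?N x \<partial>M) \<le> (\<integral>\<^sup>+x. g x \<partial>M)"
      by (intro nn_integral_mono) (auto simp: indicator_def)
    then show ?thesis using fin by (auto simp: top_unique)
  qed
  have "(\<integral>\<^sup>+x. f x * indicator ?N x - g x * indicator ?N x \<partial>M)
      = (\<integral>\<^sup>+x. f x * indicator ?N x \<partial>M) - (\<integral>\<^sup>+x. g x * indicator ?N x \<partial>M)"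
    using f g N gN by (intro nn_integral_diff) (auto simp: indicator_def)
  also have "\<dots> = 0"
    using emN f g N gN by (simp only: emeasure_density) (rule diff_eq_0_ennreal, auto simp: top.not_eq_extremum)
  finally have "AE x in M. f x * indicator ?N x - g x * indicator ?N x = 0"
    using f g N by (subst (asm) nn_integral_0_iff_AE) auto
  with AE_space show ?thesis
  proof eventually_elim
    case (elim x)
    show "f x \<le> g x"
    proof (rule ccontr)
      assume "\<not> f x \<le> g x"
      with elim show False by (auto simp: diff_eq_0_iff_ennreal)
    qed
  qed
qed

text \<open>The limit is built from densities with respect to \<open>\<mu> 0\<close>: they decrease
  almost everywhere, and their infimum is the density of \<nu>. Monotone convergence from above
  carries the inequalities for \<open>T\<close> to the limit.\<close>

lemma mass_bound_decseq:
  fixes T :: "'a::metric_space functional" and \<mu> :: "nat \<Rightarrow> 'a measure"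
  assumes \<mu>: "\<And>n. mass_bound k T (\<mu> n)" and dec: "\<And>n. \<mu> (Suc n) \<le> \<mu> n"
  obtains \<nu> where "mass_bound k T \<nu>" "\<And>n. measure \<nu> UNIV \<le> measure (\<mu> n) UNIV"
proof -
  note R = mass_bound_radon[OF \<mu>]
  note D = finite_radon_measureD[OF R]
  interpret finite_measure "\<mu> 0" by (rule D)
  have le0: "\<mu> n \<le> \<mu> 0" for n by (induction n) (auto intro: order_trans[OF dec])
  define h where "h n = RN_deriv (\<mu> 0) (\<mu> n)" for n
  have h [measurable]: "h n \<in> borel_measurable (\<mu> 0)" for n unfolding h_def by simp
  have dens: "density (\<mu> 0) (h n) = \<mu> n" for n unfolding h_def
  proof (rule density_RN_deriv)
    show "absolutely_continuous (\<mu> 0) (\<mu> n)" unfolding absolutely_continuous_def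
      using le_measureD3[OF le0] D(1) by (auto simp: null_sets_def) (metis le_zero_eq)
  qed (simp add: D)
  have hfin: "(\<integral>\<^sup>+x. h n x \<partial>\<mu> 0) < \<infinity>" for n
  proof -
    have "(\<integral>\<^sup>+x. h n x \<partial>\<mu> 0) = emeasure (density (\<mu> 0) (h n)) (space (\<mu> 0))"
      by (simp add: emeasure_density cong: nn_integral_cong)
    also have "\<dots> < \<infinity>"
      unfolding dens using finite_measure.emeasure_finite[OF D(2), of n] by (simp add: less_top)
    finally show ?thesis .
  qed
  have hdec: "AE x in \<mu> 0. h (Suc n) x \<le> h n x" for n
    by (rule density_le_imp_AE_le) (use hfin[of n] dec[of n] in \<open>auto simp: dens\<close>)
  define \<nu> where "\<nu> = density (\<mu> 0) (\<lambda>x. INF n. h n x)"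
  \<comment> \<open>The bound \<open>c\<close> keeps \<open>g x\<close> finite, so that the infimum
    commutes with multiplication, and makes the first integral finite, as convergence from above
    requires.\<close>
  have nn: "(\<integral>\<^sup>+x. g x \<partial>\<nu>) = (INF n. \<integral>\<^sup>+x. g x \<partial>\<mu> n)"
    if g [measurable]: "g \<in> borel_measurable (\<mu> 0)" and b: "\<And>x. g x \<le> ennreal c" for g c
  proof -
    have bt: "g x \<noteq> top" for x using b[of x] by (metis ennreal_neq_top top_unique)
    have "(\<integral>\<^sup>+x. g x \<partial>\<nu>) = (\<integral>\<^sup>+x. (INF n. h n x * g x) \<partial>\<mu> 0)"
      unfolding \<nu>_def by (subst nn_integral_density)
        (auto simp: bt intro!: nn_integral_cong INF_mult_right_ennreal[symmetric])
    also have "\<dots> = (INF n. \<integral>\<^sup>+x. h n x * g x \<partial>\<mu> 0)"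
    proof (rule nn_integral_monotone_convergence_INF_AE')
      show "AE x in \<mu> 0. h (Suc n) x * g x \<le> h n x * g x" for n
        using hdec[of n] by eventually_elim (auto intro: mult_right_mono)
      have "(\<integral>\<^sup>+x. h 0 x * g x \<partial>\<mu> 0) \<le> (\<integral>\<^sup>+x. h 0 x * ennreal c \<partial>\<mu> 0)"
        by (intro nn_integral_mono mult_left_mono b) auto
      also have "\<dots> < \<infinity>" using hfin[of 0] by (simp add: nn_integral_multc ennreal_mult_less_top)
      finally show "(\<integral>\<^sup>+x. h 0 x * g x \<partial>\<mu> 0) < \<infinity>" .
    qed auto
    also have "(\<lambda>n. \<integral>\<^sup>+x. h n x * g x \<partial>\<mu> 0) = (\<lambda>n. \<integral>\<^sup>+x. g x \<partial>\<mu> n)"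
      using nn_integral_density[OF h g] by (simp add: dens)
    finally show ?thesis .
  qed
  have sets: "sets \<nu> = sets borel" "space \<nu> = UNIV" using D(1,3)[of 0] by (auto simp: \<nu>_def)
  have le: "emeasure \<nu> B \<le> emeasure (\<mu> n) B" for n B
  proof (cases "B \<in> sets borel")
    case True
    have m: "indicator B \<in> borel_measurable (\<mu> 0)" using True D(1)[of 0] by simp
    have "emeasure \<nu> B = (INF n. \<integral>\<^sup>+x. indicator B x \<partial>\<mu> n)"
      using True sets nn[OF m, of 1] by (simp only: nn_integral_indicator) (simp add: indicator_def)
    also have "\<dots> \<le> (\<integral>\<^sup>+x. indicator B x \<partial>\<mu> n)" by (rule INF_lower) simp
    finally show ?thesis using True D(1) by simp
  qed (simp add: emeasure_notin_sets sets)
  have \<nu>le: "\<nu> \<le> \<mu> 0" using le[of _ 0] sets D(1,3)[of 0] by (auto simp: le_measure_iff le_fun_def)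
  have R\<nu>: "finite_radon_measure \<nu>" by (rule finite_radon_measure_le[OF R sets(1) \<nu>le])
  interpret n: finite_measure \<nu> by (rule finite_radon_measureD[OF R\<nu>])
  show ?thesis
  proof (rule that)
    show "measure \<nu> UNIV \<le> measure (\<mu> n) UNIV" for n
      using le[of UNIV n] by (simp add: n.emeasure_eq_measure finite_measure.emeasure_eq_measure[OF D(2)])
    show "mass_bound k T \<nu>" unfolding mass_bound_def
    proof (intro conjI ballI R\<nu>; clarify)
      fix f :: "'a \<Rightarrow> real" and ps assume d: "(f, ps) \<in> dforms k"
      then have f: "f \<in> Lipb" and ps: "set ps \<subseteq> Lip" by (auto simp: dforms_def)
      let ?P = "prod_list (map lip_const ps)"
      have P: "0 \<le> ?P" by (rule prod_list_lip_const_nonneg[OF ps])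
      have "ennreal \<bar>T f ps\<bar> \<le> ennreal ?P * (\<integral>\<^sup>+x. ennreal \<bar>f x\<bar> \<partial>\<mu> n)" for n
      proof -
        have "ennreal \<bar>T f ps\<bar> \<le> ennreal (?P * (\<integral>x. \<bar>f x\<bar> \<partial>\<mu> n))"
          using mass_boundD(1)[OF \<mu> d] by (rule ennreal_leI)
        also have "\<dots> = ennreal ?P * (\<integral>\<^sup>+x. ennreal \<bar>f x\<bar> \<partial>\<mu> n)"
          using P by (subst nn_integral_eq_integral[OF Lipb_integrable(2)[OF D(2,1) f]])
            (auto simp: ennreal_mult)
        finally show ?thesis .
      qed
      then have "ennreal \<bar>T f ps\<bar> \<le> (INF n. ennreal ?P * (\<integral>\<^sup>+x. ennreal \<bar>f x\<bar> \<partial>\<mu> n))"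
        by (rule INF_greatest)
      also have "\<dots> = ennreal ?P * (INF n. \<integral>\<^sup>+x. ennreal \<bar>f x\<bar> \<partial>\<mu> n)"
        by (subst (1 2) mult.commute) (rule INF_mult_right_ennreal, auto)
      also have "(INF n. \<integral>\<^sup>+x. ennreal \<bar>f x\<bar> \<partial>\<mu> n) = (\<integral>\<^sup>+x. ennreal \<bar>f x\<bar> \<partial>\<nu>)"
        by (rule nn[symmetric, where c="sup_norm f"])
           (use Lipb_integrable(2)[OF D(2,1) f] abs_le_sup_norm[OF f] in \<open>auto intro: ennreal_leI\<close>)
      also have "\<dots> = ennreal (\<integral>x. \<bar>f x\<bar> \<partial>\<nu>)"
        by (rule nn_integral_eq_integral[OF Lipb_integrable(2)[OF n.finite_measure_axioms sets(1) f]]) auto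
      also have "ennreal ?P * \<dots> = ennreal (?P * (\<integral>x. \<bar>f x\<bar> \<partial>\<nu>))"
        using P by (simp add: ennreal_mult)
      finally show "\<bar>T f ps\<bar> \<le> ?P * (\<integral>x. \<bar>f x\<bar> \<partial>\<nu>)"
        using P by (subst (asm) ennreal_le_iff) auto
    qed
  qed
qed

text \<open>Let \<alpha> be the infimum of the total masses. A decreasing minimising sequence has a
  limit of total mass \<alpha>; a common lower bound of this limit and a competitor cannot have
  less, so it coincides with the limit, which therefore lies below the competitor.\<close>

lemma least_mass_bound:
  fixes T :: "'a::metric_space functional"
  assumes T: "multilinear k T" and \<mu>0: "mass_bound k T \<mu>0"
  obtains \<nu> where "mass_bound k T \<nu>" "\<And>\<mu>. mass_bound k T \<mu> \<Longrightarrow> \<nu> \<le> \<mu>"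
proof -
  define \<alpha> where "\<alpha> = (INF \<mu>\<in>{\<mu>. mass_bound k T \<mu>}. measure \<mu> UNIV)"
  have \<alpha>: "\<alpha> \<le> measure \<mu> UNIV" if "mass_bound k T \<mu>" for \<mu>
    unfolding \<alpha>_def by (rule cINF_lower) (use that in \<open>auto intro!: bdd_belowI[of _ 0]\<close>)
  have mono: "measure \<mu> UNIV \<le> measure \<nu> UNIV"
    if "mass_bound k T \<mu>" "mass_bound k T \<nu>" "\<mu> \<le> \<nu>" for \<mu> \<nu>
  proof -
    note D = finite_radon_measureD[OF mass_bound_radon[OF that(1)]]
      and E = finite_radon_measureD[OF mass_bound_radon[OF that(2)]]
    show ?thesis
      using le_measureD3[OF that(3), of UNIV] D(1) E(1)
      by (simp add: finite_measure.emeasure_eq_measure[OF D(2)] finite_measure.emeasure_eq_measure[OF E(2)])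
  qed
  have ex: "\<exists>\<mu>. mass_bound k T \<mu> \<and> measure \<mu> UNIV < \<alpha> + 1 / Suc n" for n :: nat
  proof -
    have "\<exists>\<mu>\<in>{\<mu>. mass_bound k T \<mu>}. measure \<mu> UNIV < \<alpha> + 1 / Suc n"
      by (subst cINF_less_iff[symmetric])
         (use \<mu>0 in \<open>auto simp: \<alpha>_def[symmetric] intro!: bdd_belowI[of _ 0]\<close>)
    then show ?thesis by auto
  qed
  \<comment> \<open>A near-minimiser for the next index need not lie below the previous measure;
    their common lower bound does, and its total mass is no larger.\<close>
  have "\<exists>\<mu>. \<forall>n. (mass_bound k T (\<mu> n) \<and> measure (\<mu> n) UNIV < \<alpha> + 1 / Suc n) \<and> \<mu> (Suc n) \<le> \<mu> n"
  proof (rule dependent_nat_choice)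
    show "\<exists>x. mass_bound k T x \<and> measure x UNIV < \<alpha> + 1 / real (Suc 0)" by (rule ex)
    fix \<mu> n assume *: "mass_bound k T \<mu> \<and> measure \<mu> UNIV < \<alpha> + 1 / real (Suc n)"
    obtain \<nu> where \<nu>: "mass_bound k T \<nu>" "measure \<nu> UNIV < \<alpha> + 1 / real (Suc (Suc n))"
      using ex by blast
    obtain \<kappa> where \<kappa>: "mass_bound k T \<kappa>" "\<kappa> \<le> \<mu>" "\<kappa> \<le> \<nu>"
      using mass_bound_inf[OF T conjunct1[OF *] \<nu>(1)] .
    then show "\<exists>y. (mass_bound k T y \<and> measure y UNIV < \<alpha> + 1 / real (Suc (Suc n))) \<and> y \<le> \<mu>"
      using mono[OF \<kappa>(1) \<nu>(1) \<kappa>(3)] \<nu>(2) by (intro exI[of _ \<kappa>]) auto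
  qed
  then obtain \<mu> where \<mu>: "\<And>n. mass_bound k T (\<mu> n)" "\<And>n. measure (\<mu> n) UNIV < \<alpha> + 1 / Suc n"
    "\<And>n. \<mu> (Suc n) \<le> \<mu> n" by blast
  obtain \<nu> where \<nu>: "mass_bound k T \<nu>" "\<And>n. measure \<nu> UNIV \<le> measure (\<mu> n) UNIV"
    using mass_bound_decseq[of k T \<mu>, OF \<mu>(1,3)] by blast
  have \<nu>\<alpha>: "measure \<nu> UNIV \<le> \<alpha>"
  proof (rule LIMSEQ_le_const)
    show "(\<lambda>n. \<alpha> + 1 / Suc n) \<longlonglongrightarrow> \<alpha>"
      using tendsto_add[OF tendsto_const LIMSEQ_Suc[OF lim_1_over_n], of \<alpha>] by simp
    show "\<exists>N. \<forall>n\<ge>N. measure \<nu> UNIV \<le> \<alpha> + 1 / Suc n"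
      using \<nu>(2) \<mu>(2) by (meson less_imp_le order_trans)
  qed
  show ?thesis
  proof (rule that[OF \<nu>(1)])
    fix \<mu>' assume \<mu>': "mass_bound k T \<mu>'"
    obtain \<kappa> where \<kappa>: "mass_bound k T \<kappa>" "\<kappa> \<le> \<nu>" "\<kappa> \<le> \<mu>'"
      using mass_bound_inf[OF T \<nu>(1) \<mu>'] .
    note D = finite_radon_measureD[OF mass_bound_radon[OF \<nu>(1)]]
      and E = finite_radon_measureD[OF mass_bound_radon[OF \<kappa>(1)]]
    interpret D: finite_measure \<nu> by (rule D)
    interpret E: finite_measure \<kappa> by (rule E)
    have eq: "measure \<kappa> UNIV = measure \<nu> UNIV"
      using mono[OF \<kappa>(1) \<nu>(1) \<kappa>(2)] \<alpha>[OF \<kappa>(1)] \<nu>\<alpha> by linarith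
    have le: "measure \<kappa> A \<le> measure \<nu> A" for A
      using le_measureD3[OF \<kappa>(2), of A] D(1) E(1) by (simp add: D.emeasure_eq_measure E.emeasure_eq_measure)
    have "\<kappa> = \<nu>"
    proof (rule measure_eqI)
      fix A assume "A \<in> sets \<kappa>"
      then have A: "A \<in> sets borel" using E by simp
      \<comment> \<open>Comparison on the complement, together with equal total masses, gives the
        reverse inequality on \<open>A\<close>.\<close>
      have "measure \<kappa> (UNIV - A) \<le> measure \<nu> (UNIV - A)" by (rule le)
      then have "measure \<nu> A \<le> measure \<kappa> A"
        using A D(1,3) E(1,3) eq by (simp add: D.finite_measure_Diff E.finite_measure_Diff)
      then show "emeasure \<kappa> A = emeasure \<nu> A"
        using le[of A] by (simp add: D.emeasure_eq_measure E.emeasure_eq_measure)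
    qed (simp add: D E)
    then show "\<nu> \<le> \<mu>'" using \<kappa>(3) by simp
  qed
qed

text \<open>Existence of a least mass bound makes the LEAST in \<open>mass\<close> meaningful; from
  here on any explicit bounding measure estimates the norm.\<close>

lemma current_norm_le:
  fixes T :: "'a::metric_space functional"
  assumes T: "multilinear k T" and \<mu>: "mass_bound k T \<mu>"
  shows "current_norm k T \<le> measure \<mu> UNIV"
proof -
  obtain \<nu> where \<nu>: "mass_bound k T \<nu>" "\<And>\<mu>. mass_bound k T \<mu> \<Longrightarrow> \<nu> \<le> \<mu>"
    using least_mass_bound[OF T \<mu>] by blast
  have eq: "mass k T = \<nu>" unfolding mass_def using \<nu> by (intro Least_equality) auto
  note D = finite_radon_measureD[OF mass_bound_radon[OF \<nu>(1)]]
    and E = finite_radon_measureD[OF mass_bound_radon[OF \<mu>]]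
  show ?thesis unfolding current_norm_def eq
    using le_measureD3[OF \<nu>(2)[OF \<mu>], of UNIV] D(1) E(1)
    by (simp add: finite_measure.emeasure_eq_measure[OF D(2)] finite_measure.emeasure_eq_measure[OF E(2)])
qed

section \<open>Functionals on Lipschitz functions\<close>

definition lincomb_closed :: "('b \<Rightarrow> real) set \<Rightarrow> bool" where
  "lincomb_closed V \<longleftrightarrow> (\<lambda>_. 0) \<in> V \<and> (\<forall>p\<in>V. \<forall>q\<in>V. \<forall>a b. (\<lambda>x. a * p x + b * q x) \<in> V)"

definition linear_functional_on :: "('b \<Rightarrow> real) set \<Rightarrow> (('b \<Rightarrow> real) \<Rightarrow> real) \<Rightarrow> bool" where
  "linear_functional_on V u \<longleftrightarrow>
     (\<forall>p\<in>V. \<forall>q\<in>V. \<forall>a b. u (\<lambda>x. a * p x + b * q x) = a * u p + b * u q)"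

text \<open>One inequality encodes both subadditivity and homogeneity. Nonnegativity is a
  consequence: combine \<open>p\<close> with itself using the coefficients 1 and -1.\<close>

definition seminorm_on :: "('b \<Rightarrow> real) set \<Rightarrow> (('b \<Rightarrow> real) \<Rightarrow> real) \<Rightarrow> bool" where
  "seminorm_on V s \<longleftrightarrow>
     (\<forall>p\<in>V. \<forall>q\<in>V. \<forall>a b. s (\<lambda>x. a * p x + b * q x) \<le> \<bar>a\<bar> * s p + \<bar>b\<bar> * s q)"

lemma linear_functional_onD:
  "linear_functional_on V u \<Longrightarrow> p \<in> V \<Longrightarrow> q \<in> V \<Longrightarrow> u (\<lambda>x. a * p x + b * q x) = a * u p + b * u q"
  by (simp add: linear_functional_on_def)

lemma linear_functional_scale:
  "linear_functional_on V u \<Longrightarrow> p \<in> V \<Longrightarrow> u (\<lambda>x. a * p x) = a * u p"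
  using linear_functional_onD[of V u p p a 0] by simp

lemma seminorm_scale:
  "seminorm_on V s \<Longrightarrow> p \<in> V \<Longrightarrow> s (\<lambda>x. a * p x) \<le> \<bar>a\<bar> * s p"
  unfolding seminorm_on_def by (drule bspec[of _ _ p], simp, drule bspec[of _ _ p], simp) (drule spec[of _ a], drule spec[of _ 0], simp)

lemma lincomb_closed_scale:
  "lincomb_closed V \<Longrightarrow> p \<in> V \<Longrightarrow> (\<lambda>x. a * p x) \<in> V"
  unfolding lincomb_closed_def by (elim conjE, drule bspec[of _ _ p], simp, drule bspec[of _ _ p], simp) (drule spec[of _ a], drule spec[of _ 0], simp)

lemma lincomb_closed_zero: "lincomb_closed V \<Longrightarrow> (\<lambda>_. 0) \<in> V"
  by (simp add: lincomb_closed_def)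

lemma seminorm_zero:
  assumes "seminorm_on V s" "lincomb_closed V"
  shows "s (\<lambda>_. 0) = 0"
proof -
  have 0: "(\<lambda>_. 0) \<in> V" using assms(2) by (rule lincomb_closed_zero)
  have "s (\<lambda>_. 0) \<le> 0" using seminorm_scale[OF assms(1) 0, of 0] by simp
  moreover have "s (\<lambda>x. 1 * (\<lambda>_. 0) x + 1 * (\<lambda>_. 0) x) \<le> \<bar>1\<bar> * s (\<lambda>_. 0) + \<bar>1\<bar> * s (\<lambda>_. 0)"
    by (rule assms(1)[unfolded seminorm_on_def, rule_format, OF 0 0])
  ultimately show ?thesis by simp
qed

lemma seminorm_nonneg:
  assumes "seminorm_on V s" "lincomb_closed V" "p \<in> V"
  shows "0 \<le> s p"
proof -
  have "s (\<lambda>x. 1 * p x + (-1) * p x) \<le> \<bar>1\<bar> * s p + \<bar>-1\<bar> * s p"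
    using assms unfolding seminorm_on_def by blast
  then show ?thesis using seminorm_zero[OF assms(1,2)] by simp
qed

text \<open>One step of the Hahn--Banach extension, from \<open>V\<close> (embedded by \<open>p \<mapsto> (d p, p)\<close>) to \<open>\<real> \<times> V\<close>; the
  coefficient \<open>a\<close> is the value of the extension at \<open>(1, 0)\<close>.\<close>

lemma peel_functional:
  assumes V: "lincomb_closed V" and m: "linear_functional_on V m" and d: "linear_functional_on V d"
    and q: "seminorm_on V q" and \<rho>: "seminorm_on V \<rho>" and c: "0 \<le> c"
    and le: "\<And>p. p \<in> V \<Longrightarrow> \<bar>m p\<bar> \<le> c * max \<bar>d p\<bar> (q p) + \<rho> p"
  obtains a where "\<bar>a\<bar> \<le> c" "\<And>p. p \<in> V \<Longrightarrow> \<bar>m p - a * d p\<bar> \<le> (c - \<bar>a\<bar>) * q p + \<rho> p"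
proof -
  \<comment> \<open>\<open>P p t\<close> is the majorant at the point of
    \<open>\<real> \<times> V\<close> with coordinates \<open>d p + t\<close> and \<open>p\<close>;
    the sought extension has the value \<open>m p + a * t\<close> there.\<close>
  define P where "P p t = c * max \<bar>d p + t\<bar> (q p) + \<rho> p" for p t
  have sc: "(\<lambda>x. t * p x) \<in> V" "m (\<lambda>x. t * p x) = t * m p" "d (\<lambda>x. t * p x) = t * d p"
    "q (\<lambda>x. t * p x) \<le> \<bar>t\<bar> * q p" "\<rho> (\<lambda>x. t * p x) \<le> \<bar>t\<bar> * \<rho> p" if "p \<in> V" for t p
    using that by (auto intro: lincomb_closed_scale[OF V] linear_functional_scale[OF m]
        linear_functional_scale[OF d] seminorm_scale[OF q] seminorm_scale[OF \<rho>])
  \<comment> \<open>The shifts -1 and 1 cancel when \<open>p\<close> and \<open>p'\<close> are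
    added, so every lower candidate for \<open>a\<close> is at most every upper one.\<close>
  have XY: "m p - P p (-1) \<le> P p' 1 - m p'" if p: "p \<in> V" "p' \<in> V" for p p'
  proof -
    let ?s = "\<lambda>x. 1 * p x + 1 * p' x"
    have s: "?s \<in> V" using V p unfolding lincomb_closed_def by blast
    have ms: "m ?s = m p + m p'" "d ?s = d p + d p'"
      using linear_functional_onD[OF m p, of 1 1] linear_functional_onD[OF d p, of 1 1] by simp_all
    have "q ?s \<le> \<bar>1\<bar> * q p + \<bar>1\<bar> * q p'" "\<rho> ?s \<le> \<bar>1\<bar> * \<rho> p + \<bar>1\<bar> * \<rho> p'"
      using q \<rho> p unfolding seminorm_on_def by blast+
    then have qs: "q ?s \<le> q p + q p'" "\<rho> ?s \<le> \<rho> p + \<rho> p'" by simp_all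
    have "m p + m p' \<le> c * max \<bar>d ?s\<bar> (q ?s) + \<rho> ?s" using le[OF s] ms by simp
    also have "\<dots> \<le> c * (max \<bar>d p - 1\<bar> (q p) + max \<bar>d p' + 1\<bar> (q p')) + (\<rho> p + \<rho> p')"
      using qs ms(2) by (intro add_mono mult_left_mono c) auto
    finally show ?thesis by (simp add: P_def algebra_simps)
  qed
  define a where "a = (SUP p\<in>V. m p - P p (-1))"
  have ne: "V \<noteq> {}" using lincomb_closed_zero[OF V] by auto
  have a1: "m p - P p (-1) \<le> a" if "p \<in> V" for p
    unfolding a_def by (rule cSUP_upper[OF that]) (use XY lincomb_closed_zero[OF V] in \<open>auto intro!: bdd_aboveI\<close>)
  have a2: "a \<le> P p 1 - m p" if "p \<in> V" for p
    unfolding a_def by (rule cSUP_least[OF ne]) (use XY that in auto)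
  \<comment> \<open>Scaling by \<open>1/t\<close> reduces a positive shift to the shift 1; negative
    shifts are scaled by \<open>-1/t\<close> to the shift -1.\<close>
  have posP: "m p + a * t \<le> P p t" if p: "p \<in> V" and t: "t > 0" for p t
  proof -
    note s = sc[OF p, of "1/t"]
    have "a \<le> P (\<lambda>x. 1/t * p x) 1 - m (\<lambda>x. 1/t * p x)" by (rule a2[OF s(1)])
    also have "\<dots> \<le> c * max \<bar>1/t * d p + 1\<bar> (1/t * q p) + 1/t * \<rho> p - 1/t * m p"
      unfolding P_def s(2,3) using s(4,5) t
      by (intro diff_mono add_mono mult_left_mono c max.mono) auto
    finally have "t * a \<le> t * (c * max \<bar>1/t * d p + 1\<bar> (1/t * q p) + 1/t * \<rho> p - 1/t * m p)"
      using t by (intro mult_left_mono) auto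
    also have "\<dots> = c * (t * max \<bar>1/t * d p + 1\<bar> (1/t * q p)) + \<rho> p - m p"
      using t by (simp add: algebra_simps)
    also have "t * max \<bar>1/t * d p + 1\<bar> (1/t * q p) = max (t * \<bar>1/t * d p + 1\<bar>) (t * (1/t * q p))"
      using t by (simp add: max_mult_distrib_left)
    also have "t * \<bar>1/t * d p + 1\<bar> = \<bar>d p + t\<bar>"
      using t by (simp add: abs_mult_pos' field_simps)
    finally show ?thesis using t by (simp add: P_def algebra_simps)
  qed
  have negP: "m p + a * t \<le> P p t" if p: "p \<in> V" and t: "t < 0" for p t
  proof -
    note s = sc[OF p, of "-1/t"]
    have "a \<ge> m (\<lambda>x. -1/t * p x) - P (\<lambda>x. -1/t * p x) (-1)" by (rule a1[OF s(1)])
    moreover have "P (\<lambda>x. -1/t * p x) (-1) \<le> c * max \<bar>-1/t * d p - 1\<bar> (-1/t * q p) + -1/t * \<rho> p"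
      unfolding P_def s(3) using s(4,5) t
      by (intro add_mono mult_left_mono c max.mono) auto
    ultimately have "-1/t * m p \<le> a + (c * max \<bar>-1/t * d p - 1\<bar> (-1/t * q p) + -1/t * \<rho> p)"
      unfolding s(2) by linarith
    then have "(-t) * (-1/t * m p) \<le> (-t) * (a + (c * max \<bar>-1/t * d p - 1\<bar> (-1/t * q p) + -1/t * \<rho> p))"
      using t by (intro mult_left_mono) auto
    also have "\<dots> = - t * a + c * ((-t) * max \<bar>-1/t * d p - 1\<bar> (-1/t * q p)) + \<rho> p"
      using t by (simp add: algebra_simps)
    also have "(-t) * max \<bar>-1/t * d p - 1\<bar> (-1/t * q p) = max ((-t) * \<bar>-1/t * d p - 1\<bar>) ((-t) * (-1/t * q p))"
      using t by (subst max_mult_distrib_left) (simp only: neg_0_le_iff_le less_imp_le if_True)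
    also have "(-t) * \<bar>-1/t * d p - 1\<bar> = \<bar>d p + t\<bar>"
    proof -
      have "(-t) * \<bar>-1/t * d p - 1\<bar> = \<bar>(-t) * (-1/t * d p - 1)\<bar>" using t by (simp only: abs_mult)
      also have "(-t) * (-1/t * d p - 1) = d p + t" using t by (simp add: algebra_simps)
      finally show ?thesis .
    qed
    finally show ?thesis using t by (simp add: P_def algebra_simps)
  qed
  have ub: "m p + a * t \<le> P p t" if p: "p \<in> V" for p t
    using posP[OF p, of t] negP[OF p, of t] le[OF p] by (cases t "0::real" rule: linorder_cases) (auto simp: P_def)
  \<comment> \<open>The upper bound at the reflected pair gives the other sign, as \<open>P\<close>
    does not increase under negating both arguments.\<close>
  have lb: "\<bar>m p + a * t\<bar> \<le> P p t" if p: "p \<in> V" for p t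
  proof -
    have "m (\<lambda>x. -1 * p x) + a * (-t) \<le> P (\<lambda>x. -1 * p x) (-t)" by (rule ub) (rule sc[OF p])
    also have "\<dots> \<le> P p t"
      unfolding P_def sc(3)[OF p] using sc(4,5)[OF p, of "-1"]
      by (intro add_mono mult_left_mono c max.mono) auto
    finally have "- (m p + a * t) \<le> P p t" unfolding sc(2)[OF p] by simp
    then show ?thesis using ub[OF p, of t] by (simp add: abs_le_iff)
  qed
  show ?thesis
  proof (rule that)
    have z: "(\<lambda>_. 0) \<in> V" using V by (rule lincomb_closed_zero)
    show "\<bar>a\<bar> \<le> c"
      using lb[OF z, of 1] linear_functional_scale[OF m z, of 0] linear_functional_scale[OF d z, of 0]
        seminorm_zero[OF q V] seminorm_zero[OF \<rho> V] by (simp add: P_def)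
    fix p assume p: "p \<in> V"
    have qn: "0 \<le> q p" by (rule seminorm_nonneg[OF q V p])
    \<comment> \<open>These two shifts turn \<open>d p + t\<close> into \<open>q p\<close> and
      \<open>- q p\<close>, where the maximum collapses to \<open>q p\<close>. Taken together the
      two bounds leave room for an extra |a| times \<open>q p\<close> on the left, which is exactly
      the saving in the conclusion.\<close>
    have "\<bar>m p + a * (q p - d p)\<bar> \<le> c * q p + \<rho> p" "\<bar>m p + a * (- q p - d p)\<bar> \<le> c * q p + \<rho> p"
      using lb[OF p, of "q p - d p"] lb[OF p, of "- q p - d p"] qn by (simp_all add: P_def)
    then have "\<bar>m p - a * d p\<bar> + \<bar>a * q p\<bar> \<le> c * q p + \<rho> p"
      by (simp add: algebra_simps)
    then show "\<bar>m p - a * d p\<bar> \<le> (c - \<bar>a\<bar>) * q p + \<rho> p"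
      using qn by (simp add: abs_mult algebra_simps)
  qed
qed

text \<open>The inserted 0 gives the maximum a value for empty \<open>E\<close>; splitting off one
  entry produces the \<open>max\<close> from which a functional can be peeled.\<close>

lemma Max_insert_zero_insert:
  fixes g :: "'e \<Rightarrow> real"
  assumes "finite E" "0 \<le> g e"
  shows "Max (insert 0 (g ` insert e E)) = max (g e) (Max (insert 0 (g ` E)))"
proof -
  have "insert 0 (g ` insert e E) = insert (g e) (insert 0 (g ` E))" by auto
  then show ?thesis using assms by simp
qed

lemma seminorm_Max:
  assumes V: "lincomb_closed V" and E: "finite E" and d: "\<And>e. e \<in> E \<Longrightarrow> linear_functional_on V (d e)"
  shows "seminorm_on V (\<lambda>p. Max (insert 0 ((\<lambda>e. \<bar>d e p\<bar>) ` E)))"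
  unfolding seminorm_on_def
proof (intro ballI allI)
  fix p q a b assume pq: "p \<in> V" "q \<in> V"
  let ?M = "\<lambda>p. Max (insert 0 ((\<lambda>e. \<bar>d e p\<bar>) ` E))"
  have up: "\<bar>d e r\<bar> \<le> ?M r" if "e \<in> E" for e r using that E by (intro Max_ge) auto
  have nn: "0 \<le> ?M r" for r using E by (intro Max_ge) auto
  have "\<bar>d e (\<lambda>x. a * p x + b * q x)\<bar> \<le> \<bar>a\<bar> * ?M p + \<bar>b\<bar> * ?M q" if e: "e \<in> E" for e
  proof -
    have "\<bar>d e (\<lambda>x. a * p x + b * q x)\<bar> \<le> \<bar>a\<bar> * \<bar>d e p\<bar> + \<bar>b\<bar> * \<bar>d e q\<bar>"
      unfolding linear_functional_onD[OF d[OF e] pq] by (metis abs_mult abs_triangle_ineq)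
    also have "\<dots> \<le> \<bar>a\<bar> * ?M p + \<bar>b\<bar> * ?M q"
      by (intro add_mono mult_left_mono up e) auto
    finally show ?thesis .
  qed
  then show "?M (\<lambda>x. a * p x + b * q x) \<le> \<bar>a\<bar> * ?M p + \<bar>b\<bar> * ?M q"
    using E by (intro Max.boundedI) (auto intro!: add_nonneg_nonneg mult_nonneg_nonneg nn)
qed

text \<open>One functional is peeled off at a time. Its coefficient is paid out of the budget
  \<open>c\<close>, so the absolute values sum to at most \<open>c\<close>; when \<open>E\<close> is
  exhausted the maximum is 0 and only the error \<rho> remains.\<close>

lemma finite_functional_representation:
  fixes d :: "'e \<Rightarrow> ('b \<Rightarrow> real) \<Rightarrow> real"
  assumes V: "lincomb_closed V" and \<rho>: "seminorm_on V \<rho>"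
    and E: "finite E" and d: "\<And>e. e \<in> E \<Longrightarrow> linear_functional_on V (d e)"
    and m: "linear_functional_on V m" and c: "0 \<le> c"
    and le: "\<And>p. p \<in> V \<Longrightarrow> \<bar>m p\<bar> \<le> c * Max (insert 0 ((\<lambda>e. \<bar>d e p\<bar>) ` E)) + \<rho> p"
  shows "\<exists>a. (\<Sum>e\<in>E. \<bar>a e\<bar>) \<le> c \<and> (\<forall>p\<in>V. \<bar>m p - (\<Sum>e\<in>E. a e * d e p)\<bar> \<le> \<rho> p)"
  using E d m c le
proof (induction E arbitrary: m c rule: finite_induct)
  case empty
  then show ?case by auto
next
  case (insert e E)
  let ?q = "\<lambda>p. Max (insert 0 ((\<lambda>e. \<bar>d e p\<bar>) ` E))"
  have q: "seminorm_on V ?q" using insert by (intro seminorm_Max[OF V]) auto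
  obtain a where a: "\<bar>a\<bar> \<le> c" "\<And>p. p \<in> V \<Longrightarrow> \<bar>m p - a * d e p\<bar> \<le> (c - \<bar>a\<bar>) * ?q p + \<rho> p"
  proof (rule peel_functional[OF V insert.prems(2) _ q \<rho> insert.prems(3)])
    show "linear_functional_on V (d e)" using insert by simp
    show "\<bar>m p\<bar> \<le> c * max \<bar>d e p\<bar> (?q p) + \<rho> p" if "p \<in> V" for p
      using insert.prems(4)[OF that] insert.hyps(1)
      by (subst (asm) Max_insert_zero_insert) auto
  qed blast
  have lin: "linear_functional_on V (\<lambda>p. m p - a * d e p)"
    using insert.prems(1)[of e] insert.prems(2) unfolding linear_functional_on_def
    by (simp add: algebra_simps)
  have "\<exists>b. (\<Sum>e\<in>E. \<bar>b e\<bar>) \<le> c - \<bar>a\<bar> \<and> (\<forall>p\<in>V. \<bar>m p - a * d e p - (\<Sum>e\<in>E. b e * d e p)\<bar> \<le> \<rho> p)"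
    by (rule insert.IH[OF _ lin]) (use insert.prems a in auto)
  then obtain b where b: "(\<Sum>e\<in>E. \<bar>b e\<bar>) \<le> c - \<bar>a\<bar>"
    "\<And>p. p \<in> V \<Longrightarrow> \<bar>m p - a * d e p - (\<Sum>e\<in>E. b e * d e p)\<bar> \<le> \<rho> p" by blast
  let ?b = "\<lambda>i. if i = e then a else b i"
  have eq: "(\<Sum>i\<in>insert e E. \<bar>?b i\<bar>) = \<bar>a\<bar> + (\<Sum>i\<in>E. \<bar>b i\<bar>)"
    "(\<Sum>i\<in>insert e E. ?b i * d i p) = a * d e p + (\<Sum>i\<in>E. b i * d i p)" for p
    using insert.hyps by (auto intro!: sum.cong arg_cong2[where f="(+)"])
  show ?case
  proof (intro exI[of _ ?b] conjI ballI)
    show "(\<Sum>i\<in>insert e E. \<bar>?b i\<bar>) \<le> c" unfolding eq using b(1) by linarith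
    show "\<bar>m p - (\<Sum>i\<in>insert e E. ?b i * d i p)\<bar> \<le> \<rho> p" if "p \<in> V" for p
      unfolding eq using b(2)[OF that] by (simp add: algebra_simps)
  qed
qed

section \<open>Tight functionals and difference quotients\<close>

lemma lipschitz_extension_finite:
  fixes p :: "'a::metric_space \<Rightarrow> real"
  assumes F: "finite F" "F \<noteq> {}" and r: "0 \<le> r"
    and p: "\<And>x y. x \<in> F \<Longrightarrow> y \<in> F \<Longrightarrow> \<bar>p x - p y\<bar> \<le> r * dist x y"
  obtains g where "r-lipschitz_on UNIV g" "\<And>x. x \<in> F \<Longrightarrow> g x = p x"
proof -
  \<comment> \<open>McShane's formula; for finite \<open>F\<close> the infimum is an attained
    minimum, which both the Lipschitz estimate and the agreement on \<open>F\<close>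
    exploit.\<close>
  define g where "g x = Min ((\<lambda>y. p y + r * dist x y) ` F)" for x
  have le: "g x \<le> p y + r * dist x y" if "y \<in> F" for x y
    unfolding g_def using that F by (intro Min_le) auto
  have att: "\<exists>y\<in>F. g x = p y + r * dist x y" for x
    using Min_in[of "(\<lambda>y. p y + r * dist x y) ` F"] F unfolding g_def by blast
  have step: "g x \<le> g z + r * dist x z" for x z
  proof -
    obtain y where y: "y \<in> F" "g z = p y + r * dist z y" using att by blast
    have "r * dist x y \<le> r * (dist x z + dist z y)" by (intro mult_left_mono r dist_triangle)
    then show ?thesis using le[OF y(1), of x] y(2) by (simp add: algebra_simps)
  qed
  show ?thesis
  proof (rule that)
    show "r-lipschitz_on UNIV g"
    proof (rule lipschitz_onI[OF _ r])
      fix x y show "dist (g x) (g y) \<le> r * dist x y"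
        using step[of x y] step[of y x] by (simp add: dist_real_def dist_commute abs_le_iff)
    qed
    fix x assume x: "x \<in> F"
    obtain y where y: "y \<in> F" "g x = p y + r * dist x y" using att by blast
    then show "g x = p x" using le[OF x, of x] p[OF x y(1)] by (simp add: abs_le_iff)
  qed
qed

text \<open>Norm approximability by finitely supported functionals, read on the functions that
  vanish on the support. The set \<open>F\<close> may depend on \<open>e\<close> but not on
  \<open>p\<close>.\<close>

definition tight_functional :: "(('a::metric_space \<Rightarrow> real) \<Rightarrow> real) \<Rightarrow> bool" where
  "tight_functional u \<longleftrightarrow>
     (\<forall>e>0. \<exists>F. finite F \<and> (\<forall>p\<in>Lip. (\<forall>x\<in>F. p x = 0) \<longrightarrow> \<bar>u p\<bar> \<le> e * lip_const p))"

text \<open>For a degenerate pair the quotient is 0 by division by 0, so diagonal pairs may stay in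
  the index sets.\<close>

definition diff_quotient :: "'a::metric_space \<times> 'a \<Rightarrow> ('a \<Rightarrow> real) \<Rightarrow> real" where
  "diff_quotient e p = (p (fst e) - p (snd e)) / dist (fst e) (snd e)"

lemma lincomb_closed_Lip: "lincomb_closed Lip"
  by (simp add: lincomb_closed_def Lip_lincomb(1))

lemma seminorm_lip_const: "0 \<le> c \<Longrightarrow> seminorm_on Lip (\<lambda>p. c * lip_const p)"
  unfolding seminorm_on_def
proof (intro ballI allI)
  fix p q :: "'a \<Rightarrow> real" and a b assume "0 \<le> c" "p \<in> Lip" "q \<in> Lip"
  then have "c * lip_const (\<lambda>x. a * p x + b * q x) \<le> c * (\<bar>a\<bar> * lip_const p + \<bar>b\<bar> * lip_const q)"
    by (intro mult_left_mono Lip_lincomb)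
  then show "c * lip_const (\<lambda>x. a * p x + b * q x) \<le> \<bar>a\<bar> * (c * lip_const p) + \<bar>b\<bar> * (c * lip_const q)"
    by (simp add: algebra_simps)
qed

lemma linear_diff_quotient: "linear_functional_on V (diff_quotient e)"
  by (simp add: linear_functional_on_def diff_quotient_def algebra_simps add_divide_distrib diff_divide_distrib)

lemma abs_diff_quotient_le: "p \<in> Lip \<Longrightarrow> \<bar>diff_quotient e p\<bar> \<le> lip_const p"
  using lip_const_abs_diff[of p "fst e" "snd e"] lip_const_nonneg[of p]
  by (cases "fst e = snd e") (auto simp: diff_quotient_def divide_le_eq abs_divide)

text \<open>Let \<open>r\<close> be the largest difference quotient of \<open>p\<close> on
  \<open>F\<close>. The McShane extension \<open>g\<close> of \<open>p\<close> from \<open>F\<close>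
  has constant \<open>r\<close> and \<open>p - g\<close> vanishes on \<open>F\<close>, so |u p| is
  at most \<open>c * r\<close> up to the tightness error. This is the hypothesis of the finite
  representation.\<close>

lemma tight_functional_approx:
  fixes u :: "('a::metric_space \<Rightarrow> real) \<Rightarrow> real"
  assumes lin: "linear_functional_on Lip u" and c: "0 \<le> c" and u: "\<And>p. p \<in> Lip \<Longrightarrow> \<bar>u p\<bar> \<le> c * lip_const p"
    and t: "tight_functional u" and e: "0 < e"
  obtains E a where "finite E" "(\<Sum>i\<in>E. \<bar>a i\<bar>) \<le> c"
    "\<And>p. p \<in> Lip \<Longrightarrow> \<bar>u p - (\<Sum>i\<in>E. a i * diff_quotient i p)\<bar> \<le> e * lip_const p"
proof -
  \<comment> \<open>Half of \<open>e\<close>, because \<open>p - g\<close> may have twice the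
    Lipschitz constant of \<open>p\<close>.\<close>
  obtain F0 where F0: "finite F0" "\<And>p. p \<in> Lip \<Longrightarrow> (\<forall>x\<in>F0. p x = 0) \<Longrightarrow> \<bar>u p\<bar> \<le> e/2 * lip_const p"
    using t e unfolding tight_functional_def by (meson half_gt_zero)
  \<comment> \<open>The additional point makes the set nonempty, as McShane's formula
    requires.\<close>
  define F where "F = insert undefined F0"
  have F: "finite F" "F \<noteq> {}" "\<And>p. p \<in> Lip \<Longrightarrow> (\<forall>x\<in>F. p x = 0) \<Longrightarrow> \<bar>u p\<bar> \<le> e/2 * lip_const p"
    using F0 by (auto simp: F_def)
  define E where "E = F \<times> F"
  have E: "finite E" using F(1) by (simp add: E_def)
  have bnd: "\<bar>u p\<bar> \<le> c * Max (insert 0 ((\<lambda>i. \<bar>diff_quotient i p\<bar>) ` E)) + e * lip_const p" if p: "p \<in> Lip" for p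
  proof -
    define r where "r = Max (insert 0 ((\<lambda>i. \<bar>diff_quotient i p\<bar>) ` E))"
    have r: "0 \<le> r" "\<And>i. i \<in> E \<Longrightarrow> \<bar>diff_quotient i p\<bar> \<le> r"
      unfolding r_def using E by (auto intro!: Max_ge)
    have rL: "r \<le> lip_const p"
      unfolding r_def using E abs_diff_quotient_le[OF p] lip_const_nonneg[OF p] by (intro Max.boundedI) auto
    have "\<bar>p x - p y\<bar> \<le> r * dist x y" if "x \<in> F" "y \<in> F" for x y
    proof (cases "x = y")
      case False
      then have "\<bar>diff_quotient (x, y) p\<bar> \<le> r" using that by (intro r) (auto simp: E_def)
      then show ?thesis using False by (simp add: diff_quotient_def abs_divide divide_le_eq)
    qed simp
    then obtain g where g: "r-lipschitz_on UNIV g" "\<And>x. x \<in> F \<Longrightarrow> g x = p x"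
      using lipschitz_extension_finite[OF F(1,2) r(1)] by blast
    have gL: "g \<in> Lip" "lip_const g \<le> r" using g(1) by (auto intro: LipI lip_const_le)
    have hL: "(\<lambda>x. 1 * p x + (-1) * g x) \<in> Lip" by (rule Lip_lincomb[OF p gL(1)])
    have "lip_const (\<lambda>x. 1 * p x + (-1) * g x) \<le> \<bar>1\<bar> * lip_const p + \<bar>-1\<bar> * lip_const g"
      by (rule Lip_lincomb(2)[OF p gL(1)])
    also have "\<dots> \<le> 2 * lip_const p" using gL rL by simp
    finally have h2: "lip_const (\<lambda>x. 1 * p x + (-1) * g x) \<le> 2 * lip_const p" .
    have "\<bar>u (\<lambda>x. 1 * p x + (-1) * g x)\<bar> \<le> e/2 * lip_const (\<lambda>x. 1 * p x + (-1) * g x)"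
      by (rule F(3)[OF hL]) (use g in auto)
    also have "\<dots> \<le> e/2 * (2 * lip_const p)" using e h2 by (intro mult_left_mono) auto
    finally have "\<bar>u p - u g\<bar> \<le> e * lip_const p"
      using linear_functional_onD[OF lin p gL(1), of 1 "-1"] by simp
    moreover have "\<bar>u g\<bar> \<le> c * r" using u[OF gL(1)] mult_left_mono[OF gL(2) c] by linarith
    ultimately show ?thesis unfolding r_def[symmetric] by linarith
  qed
  have "\<exists>a. (\<Sum>i\<in>E. \<bar>a i\<bar>) \<le> c \<and>
      (\<forall>p\<in>Lip. \<bar>u p - (\<Sum>i\<in>E. a i * diff_quotient i p)\<bar> \<le> e * lip_const p)"
    by (rule finite_functional_representation[OF lincomb_closed_Lip _ E linear_diff_quotient lin c bnd])
       (use e in \<open>auto intro!: seminorm_lip_const\<close>)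
  then show ?thesis using that[OF E] by blast
qed

text \<open>Once the endpoints of the pairs in \<open>E\<close> are added to \<open>F\<close>, the
  subtracted quotients vanish on every admissible \<open>p\<close>.\<close>

lemma tight_functional_diff_finite:
  fixes u :: "('a::metric_space \<Rightarrow> real) \<Rightarrow> real"
  assumes t: "tight_functional u" and E: "finite E"
  shows "tight_functional (\<lambda>p. u p - (\<Sum>i\<in>E. a i * diff_quotient i p))"
  unfolding tight_functional_def
proof (intro allI impI)
  fix e :: real assume "0 < e"
  then have "\<exists>F. finite F \<and> (\<forall>p\<in>Lip. (\<forall>x\<in>F. p x = 0) \<longrightarrow> \<bar>u p\<bar> \<le> e * lip_const p)"
    by (rule t[unfolded tight_functional_def, rule_format])
  then obtain F where F: "finite F" "\<And>p. p \<in> Lip \<Longrightarrow> (\<forall>x\<in>F. p x = 0) \<Longrightarrow> \<bar>u p\<bar> \<le> e * lip_const p"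
    by blast
  let ?F = "F \<union> fst ` E \<union> snd ` E"
  have "(\<Sum>i\<in>E. a i * diff_quotient i p) = 0" if "\<forall>x\<in>?F. p x = 0" for p
    using that by (intro sum.neutral) (auto simp: diff_quotient_def)
  then have "\<forall>p\<in>Lip. (\<forall>x\<in>?F. p x = 0) \<longrightarrow> \<bar>u p - (\<Sum>i\<in>E. a i * diff_quotient i p)\<bar> \<le> e * lip_const p"
    using F(2) by simp
  then show "\<exists>F. finite F \<and> (\<forall>p\<in>Lip. (\<forall>x\<in>F. p x = 0) \<longrightarrow>
      \<bar>u p - (\<Sum>i\<in>E. a i * diff_quotient i p)\<bar> \<le> e * lip_const p)"
    using F(1) E by (intro exI[of _ ?F]) auto
qed

text \<open>A residual of bound \<open>c / 2 ^ n\<close> is approximated to precision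
  \<open>c / 2 ^ Suc n\<close> at weight at most \<open>c / 2 ^ n\<close>, and the new residual is
  again linear and tight. The residuals tend to 0, so the telescoping sum converges to
  \<open>u p\<close>.\<close>

lemma tight_functional_decomposition:
  fixes u :: "('a::metric_space \<Rightarrow> real) \<Rightarrow> real"
  assumes lin: "linear_functional_on Lip u" and c: "0 < c" and u: "\<And>p. p \<in> Lip \<Longrightarrow> \<bar>u p\<bar> \<le> c * lip_const p"
    and t: "tight_functional u"
  obtains E a where "\<And>n :: nat. finite (E n)" "\<And>n. (\<Sum>i\<in>E n. \<bar>a n i\<bar>) \<le> c / 2 ^ n"
    "\<And>p. p \<in> Lip \<Longrightarrow> (\<lambda>n. \<Sum>i\<in>E n. a n i * diff_quotient i p) sums u p"
proof -
  define good where "good n v \<longleftrightarrow> linear_functional_on Lip v \<and> tight_functional v \<and>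
    (\<forall>p\<in>Lip. \<bar>v p\<bar> \<le> c / 2 ^ n * lip_const p)" for n :: nat and v :: "('a \<Rightarrow> real) \<Rightarrow> real"
  define step where "step n v w \<longleftrightarrow> (\<exists>E a. finite E \<and> (\<Sum>i\<in>E. \<bar>a i\<bar>) \<le> c / 2 ^ n \<and>
    w = (\<lambda>p. v p - (\<Sum>i\<in>E. a i * diff_quotient i p)))" for n :: nat and v w :: "('a \<Rightarrow> real) \<Rightarrow> real"
  \<comment> \<open>The clause for \<open>n = 0\<close> makes the chosen sequence start at
    \<open>u\<close>, which \<open>good 0\<close> alone would not fix.\<close>
  have "\<exists>v. \<forall>n. (good n (v n) \<and> (n = 0 \<longrightarrow> v n = u)) \<and> step n (v n) (v (Suc n))"
  proof (rule dependent_nat_choice)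
    show "\<exists>x. good 0 x \<and> (0 = 0 \<longrightarrow> x = u)" using assms by (auto simp: good_def)
    fix v and n :: nat assume v: "good n v \<and> (n = 0 \<longrightarrow> v = u)"
    obtain E a where E: "finite E" "(\<Sum>i\<in>E. \<bar>a i\<bar>) \<le> c / 2 ^ n"
      "\<And>p. p \<in> Lip \<Longrightarrow> \<bar>v p - (\<Sum>i\<in>E. a i * diff_quotient i p)\<bar> \<le> c / 2 ^ Suc n * lip_const p"
    proof (rule tight_functional_approx[of v "c / 2 ^ n" "c / 2 ^ Suc n"])
      show "linear_functional_on Lip v" "tight_functional v" "\<And>p. p \<in> Lip \<Longrightarrow> \<bar>v p\<bar> \<le> c / 2 ^ n * lip_const p"
        using v unfolding good_def by blast+
    qed (use c in auto)
    let ?w = "\<lambda>p. v p - (\<Sum>i\<in>E. a i * diff_quotient i p)"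
    have "linear_functional_on Lip ?w"
      unfolding linear_functional_on_def
    proof (intro ballI allI)
      fix p q :: "'a \<Rightarrow> real" and \<alpha> \<beta> assume pq: "p \<in> Lip" "q \<in> Lip"
      have "linear_functional_on Lip v" using v by (simp add: good_def)
      note * = linear_functional_onD[OF this pq] linear_functional_onD[OF linear_diff_quotient pq]
      show "?w (\<lambda>x. \<alpha> * p x + \<beta> * q x) = \<alpha> * ?w p + \<beta> * ?w q"
        unfolding * by (simp add: algebra_simps sum.distrib sum_distrib_left)
    qed
    then have "good (Suc n) ?w"
      using tight_functional_diff_finite[OF _ E(1)] v E(3) by (simp add: good_def)
    moreover have "step n v ?w" unfolding step_def using E by blast
    ultimately show "\<exists>y. (good (Suc n) y \<and> (Suc n = 0 \<longrightarrow> y = u)) \<and> step n v y" by blast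
  qed
  then obtain v where v: "\<And>n. good n (v n)" "v 0 = u" "\<And>n. step n (v n) (v (Suc n))" by blast
  have "\<forall>n. \<exists>E a. finite E \<and> (\<Sum>i\<in>E. \<bar>a i\<bar>) \<le> c / 2 ^ n \<and>
    v (Suc n) = (\<lambda>p. v n p - (\<Sum>i\<in>E. a i * diff_quotient i p))"
    using v(3) unfolding step_def by blast
  from choice[OF this] obtain E where "\<forall>n. \<exists>a. finite (E n) \<and>
    (\<Sum>i\<in>E n. \<bar>a i\<bar>) \<le> c / 2 ^ n \<and> v (Suc n) = (\<lambda>p. v n p - (\<Sum>i\<in>E n. a i * diff_quotient i p))" ..
  from choice[OF this] obtain a where "\<And>n. finite (E n) \<and>
    (\<Sum>i\<in>E n. \<bar>a n i\<bar>) \<le> c / 2 ^ n \<and> v (Suc n) = (\<lambda>p. v n p - (\<Sum>i\<in>E n. a n i * diff_quotient i p))" by blast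
  then have E: "\<And>n. finite (E n)"
    "\<And>n. (\<Sum>i\<in>E n. \<bar>a n i\<bar>) \<le> c / 2 ^ n"
    "\<And>n. v (Suc n) = (\<lambda>p. v n p - (\<Sum>i\<in>E n. a n i * diff_quotient i p))"
    by blast+
  show ?thesis
  proof (rule that[OF E(1) E(2)])
    fix p :: "'a \<Rightarrow> real" assume p: "p \<in> Lip"
    have part: "(\<Sum>k<n. \<Sum>i\<in>E k. a k i * diff_quotient i p) = u p - v n p" for n
      by (induction n) (auto simp: v(2) E(3))
    have "(\<lambda>n. v n p) \<longlonglongrightarrow> 0"
    proof (rule Lim_null_comparison)
      show "\<forall>\<^sub>F n in sequentially. norm (v n p) \<le> c * lip_const p * (1/2) ^ n"
        using v(1) p by (auto simp: good_def power_divide)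
      show "(\<lambda>n. c * lip_const p * (1/2) ^ n) \<longlonglongrightarrow> 0"
        by (intro tendsto_mult_right_zero LIMSEQ_realpow_zero) auto
    qed
    then have "(\<lambda>n. u p - v n p) \<longlonglongrightarrow> u p - 0" by (intro tendsto_diff tendsto_const)
    then show "(\<lambda>n. \<Sum>i\<in>E n. a n i * diff_quotient i p) sums u p"
      by (simp add: sums_def part)
  qed
qed

section \<open>Segments as currents\<close>

definition dyadic_sum :: "nat \<Rightarrow> (real \<Rightarrow> real) \<Rightarrow> (real \<Rightarrow> real) \<Rightarrow> real" where
  "dyadic_sum n g p = (\<Sum>i<2 ^ n. g (real i / 2 ^ n) * (p (real (Suc i) / 2 ^ n) - p (real i / 2 ^ n)))"

text \<open>The Riemann-Stieltjes integral of \<open>g\<close> against \<open>p\<close> over the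
  unit interval. Passing to the next dyadic partition only bisects cells, and no derivative of
  \<open>p\<close> appears.\<close>

definition stieltjes :: "(real \<Rightarrow> real) \<Rightarrow> (real \<Rightarrow> real) \<Rightarrow> real" where
  "stieltjes g p = lim (\<lambda>n. dyadic_sum n g p)"

lemma sum_double: "(\<Sum>j<2 * m. h j) = (\<Sum>i<m. h (2 * i) + h (Suc (2 * i)))"
  for h :: "nat \<Rightarrow> real"
  by (induction m) (simp_all add: algebra_simps)

lemma abs_lipschitzD: "A-lipschitz_on UNIV g \<Longrightarrow> \<bar>g s - g t\<bar> \<le> A * \<bar>s - t\<bar>" for g :: "real \<Rightarrow> real"
  using lipschitz_onD[of A UNIV g s t] by (simp add: dist_real_def)

text \<open>Bisecting a cell changes its term by the increment of \<open>g\<close> on the left half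
  times the increment of \<open>p\<close> on the right half, at most
  \<open>A * B / 4 / 4 ^ n\<close>; there are \<open>2 ^ n\<close> cells.\<close>

lemma dyadic_sum_Suc_diff:
  assumes g: "A-lipschitz_on UNIV g" and p: "B-lipschitz_on UNIV p"
  shows "\<bar>dyadic_sum (Suc n) g p - dyadic_sum n g p\<bar> \<le> (A * B / 4) * (1/2) ^ n"
proof -
  let ?N = "2 ^ n :: real"
  have eq: "g (real (2 * i) / 2 ^ Suc n) * (p (real (Suc (2 * i)) / 2 ^ Suc n) - p (real (2 * i) / 2 ^ Suc n))
      + g (real (Suc (2 * i)) / 2 ^ Suc n) * (p (real (Suc (Suc (2 * i))) / 2 ^ Suc n) - p (real (Suc (2 * i)) / 2 ^ Suc n))
      - g (real i / ?N) * (p (real (Suc i) / ?N) - p (real i / ?N))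
      = (g ((real i + 1/2) / ?N) - g (real i / ?N)) * (p ((real i + 1) / ?N) - p ((real i + 1/2) / ?N))" for i
  proof -
    have s: "real (2 * i) / 2 ^ Suc n = real i / ?N" "real (Suc (2 * i)) / 2 ^ Suc n = (real i + 1/2) / ?N"
      "real (Suc (Suc (2 * i))) / 2 ^ Suc n = (real i + 1) / ?N" "real (Suc i) / ?N = (real i + 1) / ?N"
      by (simp_all add: field_simps)
    show ?thesis unfolding s by (simp add: algebra_simps)
  qed
  have diff: "dyadic_sum (Suc n) g p - dyadic_sum n g p
      = (\<Sum>i<2 ^ n. (g ((real i + 1/2) / ?N) - g (real i / ?N)) * (p ((real i + 1) / ?N) - p ((real i + 1/2) / ?N)))"
    unfolding dyadic_sum_def power_Suc[of "2::nat"] sum_double sum_subtractf[symmetric] eq ..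
  have "\<bar>dyadic_sum (Suc n) g p - dyadic_sum n g p\<bar> \<le> (\<Sum>i<(2::nat) ^ n. (A * (1/2 / ?N)) * (B * (1/2 / ?N)))"
    unfolding diff
  proof (rule order_trans[OF sum_abs], rule sum_mono)
    fix i :: nat
    have 1: "(real i + 1/2) / ?N - real i / ?N = 1/2 / ?N" "(real i + 1) / ?N - (real i + 1/2) / ?N = 1/2 / ?N"
      by (simp_all add: field_simps)
    have "\<bar>g ((real i + 1/2) / ?N) - g (real i / ?N)\<bar> \<le> A * (1/2 / ?N)"
      using abs_lipschitzD[OF g, of "(real i + 1/2) / ?N" "real i / ?N"] unfolding 1 by simp
    moreover have "\<bar>p ((real i + 1) / ?N) - p ((real i + 1/2) / ?N)\<bar> \<le> B * (1/2 / ?N)"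
      using abs_lipschitzD[OF p, of "(real i + 1) / ?N" "(real i + 1/2) / ?N"] unfolding 1 by simp
    ultimately show "\<bar>(g ((real i + 1/2) / ?N) - g (real i / ?N)) * (p ((real i + 1) / ?N) - p ((real i + 1/2) / ?N))\<bar>
        \<le> (A * (1/2 / ?N)) * (B * (1/2 / ?N))"
      unfolding abs_mult using lipschitz_on_nonneg[OF g] by (intro mult_mono) auto
  qed
  also have "\<dots> = (A * B / 4) * (1/2) ^ n"
    by (simp add: field_simps power_one_over)
  finally show ?thesis .
qed

text \<open>The increments are dominated by a geometric series of ratio 1/2, whose tail from
  \<open>n\<close> is twice its first term.\<close>

lemma geometric_increments:
  fixes x :: "nat \<Rightarrow> real"
  assumes "\<And>n. \<bar>x (Suc n) - x n\<bar> \<le> K * (1/2) ^ n"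
  shows "x \<longlonglongrightarrow> lim x" "\<bar>x n - lim x\<bar> \<le> 2 * K * (1/2) ^ n"
proof -
  have K: "0 \<le> K" using assms[of 0] by simp
  have tail: "\<bar>x (n + m) - x n\<bar> \<le> 2 * K * ((1/2) ^ n - (1/2) ^ (n + m))" for n m
  proof (induction m)
    case (Suc m)
    have "\<bar>x (n + Suc m) - x n\<bar> \<le> \<bar>x (Suc (n + m)) - x (n + m)\<bar> + \<bar>x (n + m) - x n\<bar>" by simp
    also have "\<dots> \<le> K * (1/2) ^ (n + m) + 2 * K * ((1/2) ^ n - (1/2) ^ (n + m))"
      by (intro add_mono assms Suc)
    also have "\<dots> = 2 * K * ((1/2) ^ n - (1/2) ^ (n + Suc m))" by (simp add: algebra_simps)
    finally show ?case .
  qed simp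
  have "summable (\<lambda>n. x (Suc n) - x n)"
    by (rule summable_comparison_test'[of "\<lambda>n. K * (1/2) ^ n" 0])
       (use assms in \<open>auto intro!: summable_mult summable_geometric\<close>)
  then have "convergent (\<lambda>n. \<Sum>k<n. x (Suc k) - x k)" by (simp add: summable_iff_convergent)
  then have "convergent (\<lambda>n. (\<Sum>k<n. x (Suc k) - x k) + x 0)"
    by (intro convergent_add convergent_const)
  then have "convergent x" by (simp add: sum_lessThan_telescope)
  then show lim: "x \<longlonglongrightarrow> lim x" by (simp add: convergent_LIMSEQ_iff)
  have "(\<lambda>m. \<bar>x (n + m) - x n\<bar>) \<longlonglongrightarrow> \<bar>lim x - x n\<bar>"
    using LIMSEQ_ignore_initial_segment[OF lim, of n] by (intro tendsto_intros) (simp add: add.commute)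
  then have "\<bar>lim x - x n\<bar> \<le> 2 * K * (1/2) ^ n"
  proof (rule LIMSEQ_le_const2)
    have "\<bar>x (n + m) - x n\<bar> \<le> 2 * K * (1/2) ^ n" for m
      using tail[of n m] K by (auto intro: order_trans simp: right_diff_distrib)
    then show "\<exists>N. \<forall>m\<ge>N. \<bar>x (n + m) - x n\<bar> \<le> 2 * K * (1/2) ^ n" by blast
  qed
  then show "\<bar>x n - lim x\<bar> \<le> 2 * K * (1/2) ^ n" by (simp add: abs_minus_commute)
qed

lemma dyadic_sum_stieltjes:
  assumes g: "A-lipschitz_on UNIV g" and p: "B-lipschitz_on UNIV p"
  shows "(\<lambda>n. dyadic_sum n g p) \<longlonglongrightarrow> stieltjes g p"
    and "\<bar>dyadic_sum n g p - stieltjes g p\<bar> \<le> A * B * (1/2) ^ n"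
proof -
  note * = geometric_increments[of "\<lambda>n. dyadic_sum n g p", OF dyadic_sum_Suc_diff[OF g p]]
  show "(\<lambda>n. dyadic_sum n g p) \<longlonglongrightarrow> stieltjes g p" using *(1) by (simp add: stieltjes_def)
  \<comment> \<open>The tail bound has the constant \<open>A * B / 2\<close>; nonnegativity lets the
    simpler \<open>A * B\<close> replace it.\<close>
  have "0 \<le> A * B * (1/2) ^ n"
    using lipschitz_on_nonneg[OF g] lipschitz_on_nonneg[OF p] by (intro mult_nonneg_nonneg) auto
  then show "\<bar>dyadic_sum n g p - stieltjes g p\<bar> \<le> A * B * (1/2) ^ n"
    using *(2)[of n] by (simp add: stieltjes_def)
qed

lemma stieltjes_lincomb:
  assumes g: "A-lipschitz_on UNIV g" and h: "A'-lipschitz_on UNIV h"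
    and p: "B-lipschitz_on UNIV p" and q: "B'-lipschitz_on UNIV q"
  shows "stieltjes (\<lambda>x. a * g x + b * h x) p = a * stieltjes g p + b * stieltjes h p"
    and "stieltjes g (\<lambda>x. a * p x + b * q x) = a * stieltjes g p + b * stieltjes g q"
proof -
  have "(\<lambda>n. a * dyadic_sum n g p + b * dyadic_sum n h p) \<longlonglongrightarrow> a * stieltjes g p + b * stieltjes h p"
    by (intro tendsto_intros dyadic_sum_stieltjes[OF g p] dyadic_sum_stieltjes[OF h p])
  then show "stieltjes (\<lambda>x. a * g x + b * h x) p = a * stieltjes g p + b * stieltjes h p"
    unfolding stieltjes_def[of "\<lambda>x. a * g x + b * h x"] dyadic_sum_def sum_distrib_left sum.distrib[symmetric]
    by (intro limI) (simp add: algebra_simps)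
  have "(\<lambda>n. a * dyadic_sum n g p + b * dyadic_sum n g q) \<longlonglongrightarrow> a * stieltjes g p + b * stieltjes g q"
    by (intro tendsto_intros dyadic_sum_stieltjes[OF g p] dyadic_sum_stieltjes[OF g q])
  then show "stieltjes g (\<lambda>x. a * p x + b * q x) = a * stieltjes g p + b * stieltjes g q"
    unfolding stieltjes_def[of g "\<lambda>x. a * p x + b * q x"] dyadic_sum_def sum_distrib_left sum.distrib[symmetric]
    by (intro limI) (simp add: algebra_simps)
qed

lemma stieltjes_one: "stieltjes (\<lambda>_. 1) p = p 1 - p 0"
proof -
  have "dyadic_sum n (\<lambda>_. 1) p = p 1 - p 0" for n
    using sum_lessThan_telescope[of "\<lambda>i. p (real i / 2 ^ n)" "2 ^ n"] by (simp add: dyadic_sum_def)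
  then show ?thesis by (simp add: stieltjes_def)
qed

text \<open>A cell with \<open>g\<close> zero at its right endpoint contributes a product of two
  increments, quadratic in its length; any other cell contributes 0. With \<open>2 ^ n\<close> cells
  the sums are of order \<open>1 / 2 ^ n\<close>.\<close>

lemma stieltjes_local:
  assumes g: "A-lipschitz_on UNIV g" and p: "B-lipschitz_on UNIV p"
    and c: "\<And>t. g t \<noteq> 0 \<Longrightarrow> p t = c"
  shows "stieltjes g p = 0"
proof (rule LIMSEQ_unique[OF dyadic_sum_stieltjes(1)[OF g p]])
  have AB: "0 \<le> A" "0 \<le> B" using g p by (auto dest: lipschitz_on_nonneg)
  have bnd: "\<bar>g s * (p t - p s)\<bar> \<le> (A * (t - s)) * (B * (t - s))" if "s \<le> t" for s t
  proof (cases "g t = 0")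
    case True
    then have "\<bar>g s\<bar> \<le> A * (t - s)" "\<bar>p t - p s\<bar> \<le> B * (t - s)"
      using abs_lipschitzD[OF g, of s t] abs_lipschitzD[OF p, of t s] that by auto
    then show ?thesis unfolding abs_mult by (intro mult_mono) auto
  next
    case False
    then have "g s * (p t - p s) = 0" using c[of s] c[of t] by (cases "g s = 0") auto
    then show ?thesis using AB that by (simp only: abs_zero) (intro mult_nonneg_nonneg, auto)
  qed
  have "\<bar>dyadic_sum n g p\<bar> \<le> A * B * (1/2) ^ n" for n
  proof -
    have "\<bar>dyadic_sum n g p\<bar> \<le> (\<Sum>i<(2::nat) ^ n. (A * (1 / 2 ^ n)) * (B * (1 / 2 ^ n)))"
      unfolding dyadic_sum_def
    proof (rule order_trans[OF sum_abs], rule sum_mono)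
      fix i :: nat
      have "real (Suc i) / 2 ^ n - real i / 2 ^ n = 1 / 2 ^ n" by (simp add: field_simps)
      then show "\<bar>g (real i / 2 ^ n) * (p (real (Suc i) / 2 ^ n) - p (real i / 2 ^ n))\<bar>
          \<le> (A * (1 / 2 ^ n)) * (B * (1 / 2 ^ n))"
        using bnd[of "real i / 2 ^ n" "real (Suc i) / 2 ^ n"] by (simp add: divide_right_mono)
    qed
    also have "\<dots> = A * B * (1/2) ^ n" by (simp add: field_simps power_one_over)
    finally show ?thesis .
  qed
  then have "\<forall>\<^sub>F n in sequentially. norm (dyadic_sum n g p) \<le> A * B * (1/2) ^ n" by simp
  moreover have "(\<lambda>n. A * B * (1/2) ^ n :: real) \<longlonglongrightarrow> 0"
    by (intro tendsto_mult_right_zero LIMSEQ_realpow_zero) auto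
  ultimately show "(\<lambda>n. dyadic_sum n g p) \<longlonglongrightarrow> 0" by (rule Lim_null_comparison)
qed

text \<open>The distance between a dyadic sum and its limit is bounded in terms of \<open>A\<close>
  and \<open>B\<close>, hence uniformly in \<open>k\<close>; for a fixed partition the finite sums
  converge.\<close>

lemma stieltjes_tendsto:
  assumes g: "\<And>k. A-lipschitz_on UNIV (gs k)" "A-lipschitz_on UNIV g" "\<And>t. (\<lambda>k. gs k t) \<longlonglongrightarrow> g t"
    and p: "\<And>k. B-lipschitz_on UNIV (ps k)" "B-lipschitz_on UNIV p" "\<And>t. (\<lambda>k. ps k t) \<longlonglongrightarrow> p t"
  shows "(\<lambda>k. stieltjes (gs k) (ps k)) \<longlonglongrightarrow> stieltjes g p"
proof (rule LIMSEQ_I)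
  fix r :: real assume r: "0 < r"
  have "(\<lambda>n. A * B * (1/2) ^ n :: real) \<longlonglongrightarrow> 0"
    by (intro tendsto_mult_right_zero LIMSEQ_realpow_zero) auto
  then have "\<forall>\<^sub>F n in sequentially. A * B * (1/2) ^ n < r / 3" using r by (intro order_tendstoD) auto
  then obtain n where n: "A * B * (1/2) ^ n < r / 3" by (auto dest: eventually_happens)
  have "(\<lambda>k. dyadic_sum n (gs k) (ps k)) \<longlonglongrightarrow> dyadic_sum n g p"
    unfolding dyadic_sum_def by (intro tendsto_intros g p)
  then obtain k0 where k0: "\<And>k. k \<ge> k0 \<Longrightarrow> \<bar>dyadic_sum n (gs k) (ps k) - dyadic_sum n g p\<bar> < r / 3"
    using LIMSEQ_D[of _ _ "r / 3"] r by fastforce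
  show "\<exists>no. \<forall>k\<ge>no. norm (stieltjes (gs k) (ps k) - stieltjes g p) < r"
  proof (intro exI[of _ k0] allI impI)
    fix k assume "k \<ge> k0"
    then show "norm (stieltjes (gs k) (ps k) - stieltjes g p) < r"
      using k0[of k] dyadic_sum_stieltjes(2)[OF g(1) p(1), of n k k] dyadic_sum_stieltjes(2)[OF g(2) p(2), of n] n
      unfolding real_norm_def by linarith
  qed
qed

text \<open>On a cell of length \<open>1 / N\<close> the function drops below its left value by at
  most \<open>A / N\<close>, which costs \<open>A / N\<^sup>2\<close> per cell.\<close>

lemma riemann_sum_le:
  fixes h :: "real \<Rightarrow> real"
  assumes h: "A-lipschitz_on UNIV h" and N: "0 < N"
  shows "(\<Sum>i<m. h (real i / N) / N) \<le> integral {0..real m / N} h + m * (A / N\<^sup>2)"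
proof (induction m)
  case (Suc m)
  have cont: "continuous_on S h" for S
    using lipschitz_on_continuous_on[OF h] continuous_on_subset by blast
  let ?s = "real m / N" and ?t = "real (Suc m) / N"
  have st: "0 \<le> ?s" "?s \<le> ?t" "?t - ?s = 1 / N" using N by (auto simp: field_simps)
  have "(h ?s - A / N) * (?t - ?s) = integral {?s..?t} (\<lambda>_. h ?s - A / N)"
    using st by simp
  also have "\<dots> \<le> integral {?s..?t} h"
  proof (rule integral_le)
    fix t assume t: "t \<in> {?s..?t}"
    have "\<bar>h ?s - h t\<bar> \<le> A * \<bar>?s - t\<bar>" by (rule abs_lipschitzD[OF h])
    also have "\<dots> \<le> A * (1 / N)" using t st lipschitz_on_nonneg[OF h] by (intro mult_left_mono) auto
    finally show "h ?s - A / N \<le> h t" by simp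
  qed (auto intro: integrable_continuous_real cont)
  finally have "h ?s / N \<le> integral {?s..?t} h + A / N\<^sup>2"
    unfolding st(3) by (simp add: diff_divide_distrib power2_eq_square)
  moreover have "integral {0..?s} h + integral {?s..?t} h = integral {0..?t} h"
    by (intro Henstock_Kurzweil_Integration.integral_combine st integrable_continuous_real cont)
  ultimately show ?case using Suc by (simp add: algebra_simps add_divide_distrib)
qed simp

text \<open>Bounding the increments of \<open>p\<close> by \<open>B / 2 ^ n\<close> leaves a Riemann
  sum of |g|; its excess over the integral is at most \<open>A / 2 ^ n\<close> and vanishes in the
  limit.\<close>

lemma abs_stieltjes_le:
  assumes g: "A-lipschitz_on UNIV g" and p: "B-lipschitz_on UNIV p"
  shows "\<bar>stieltjes g p\<bar> \<le> B * integral {0..1} (\<lambda>t. \<bar>g t\<bar>)"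
proof (rule LIMSEQ_le)
  have B: "0 \<le> B" using p by (rule lipschitz_on_nonneg)
  have ag: "A-lipschitz_on UNIV (\<lambda>t. \<bar>g t\<bar>)"
  proof (rule lipschitz_onI)
    fix x y show "dist \<bar>g x\<bar> \<bar>g y\<bar> \<le> A * dist x y"
      using abs_lipschitzD[OF g, of x y] abs_triangle_ineq3[of "g x" "g y"] by (simp add: dist_real_def)
  qed (rule lipschitz_on_nonneg[OF g])
  show "(\<lambda>n. \<bar>dyadic_sum n g p\<bar>) \<longlonglongrightarrow> \<bar>stieltjes g p\<bar>"
    by (intro tendsto_intros dyadic_sum_stieltjes[OF g p])
  have "(\<lambda>n. B * (integral {0..1} (\<lambda>t. \<bar>g t\<bar>) + A * (1/2) ^ n)) \<longlonglongrightarrow> B * (integral {0..1} (\<lambda>t. \<bar>g t\<bar>) + A * 0)"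
    by (intro tendsto_intros LIMSEQ_realpow_zero) auto
  then show "(\<lambda>n. B * (integral {0..1} (\<lambda>t. \<bar>g t\<bar>) + A * (1/2) ^ n)) \<longlonglongrightarrow> B * integral {0..1} (\<lambda>t. \<bar>g t\<bar>)"
    by simp
  have "\<bar>dyadic_sum n g p\<bar> \<le> B * (integral {0..1} (\<lambda>t. \<bar>g t\<bar>) + A * (1/2) ^ n)" for n
  proof -
    have "\<bar>dyadic_sum n g p\<bar> \<le> (\<Sum>i<2 ^ n. B * (\<bar>g (real i / 2 ^ n)\<bar> / 2 ^ n))"
      unfolding dyadic_sum_def
    proof (rule order_trans[OF sum_abs], rule sum_mono)
      fix i :: nat
      have "real (Suc i) / 2 ^ n - real i / 2 ^ n = 1 / 2 ^ n" by (simp add: field_simps)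
      then have "\<bar>p (real (Suc i) / 2 ^ n) - p (real i / 2 ^ n)\<bar> \<le> B * (1 / 2 ^ n)"
        using abs_lipschitzD[OF p, of "real (Suc i) / 2 ^ n" "real i / 2 ^ n"] by simp
      then have "\<bar>g (real i / 2 ^ n)\<bar> * \<bar>p (real (Suc i) / 2 ^ n) - p (real i / 2 ^ n)\<bar>
          \<le> \<bar>g (real i / 2 ^ n)\<bar> * (B * (1 / 2 ^ n))" by (intro mult_left_mono) auto
      then show "\<bar>g (real i / 2 ^ n) * (p (real (Suc i) / 2 ^ n) - p (real i / 2 ^ n))\<bar>
          \<le> B * (\<bar>g (real i / 2 ^ n)\<bar> / 2 ^ n)" by (simp add: abs_mult mult_ac)
    qed
    also have "\<dots> = B * (\<Sum>i<2 ^ n. \<bar>g (real i / 2 ^ n)\<bar> / 2 ^ n)" by (simp add: sum_distrib_left)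
    also have "\<dots> \<le> B * (integral {0..real (2 ^ n) / 2 ^ n} (\<lambda>t. \<bar>g t\<bar>) + real (2 ^ n) * (A / (2 ^ n)\<^sup>2))"
      by (intro mult_left_mono B riemann_sum_le[OF ag]) auto
    also have "\<dots> = B * (integral {0..1} (\<lambda>t. \<bar>g t\<bar>) + A * (1/2) ^ n)"
      by (simp add: power2_eq_square power_one_over field_simps)
    finally show ?thesis .
  qed
  then show "\<exists>N. \<forall>n\<ge>N. \<bar>dyadic_sum n g p\<bar> \<le> B * (integral {0..1} (\<lambda>t. \<bar>g t\<bar>) + A * (1/2) ^ n)"
    by blast
qed

text \<open>The image under \<gamma> of |a| times Lebesgue measure on the unit interval. Normalising
  by the parameter instead of by length gives total mass |a| for every continuous path, including
  constant ones, which yield point masses.\<close>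

definition path_measure :: "real \<Rightarrow> (real \<Rightarrow> 'a::topological_space) \<Rightarrow> 'a measure" where
  "path_measure a \<gamma> = distr (density lborel (\<lambda>t. ennreal (\<bar>a\<bar> * indicator {0..1} t))) borel \<gamma>"

text \<open>Inner regularity is inherited from the line: a compact set of parameters approximating
  the preimage of \<open>A\<close> is pushed forward by the continuous path.\<close>

lemma path_measure:
  fixes \<gamma> :: "real \<Rightarrow> 'a::metric_space"
  assumes \<gamma>: "continuous_on UNIV \<gamma>"
  shows "finite_radon_measure (path_measure a \<gamma>)" "measure (path_measure a \<gamma>) UNIV = \<bar>a\<bar>"
    and "f \<in> Lipb \<Longrightarrow> (\<integral>x. \<bar>f x\<bar> \<partial>path_measure a \<gamma>) = \<bar>a\<bar> * integral {0..1} (\<lambda>t. \<bar>f (\<gamma> t)\<bar>)"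
proof -
  let ?M = "density lborel (\<lambda>t::real. ennreal (\<bar>a\<bar> * indicator {0..1} t))"
  have meas [measurable]: "\<gamma> \<in> borel_measurable ?M"
    using borel_measurable_continuous_onI[OF \<gamma>] by simp
  have "emeasure ?M UNIV = (\<integral>\<^sup>+t. ennreal \<bar>a\<bar> * indicator {0..1::real} t \<partial>lborel)"
    by (simp add: emeasure_density) (intro nn_integral_cong, auto simp: indicator_def)
  also have "\<dots> = ennreal \<bar>a\<bar>" by (subst nn_integral_cmult_indicator) auto
  finally have em: "emeasure ?M UNIV = ennreal \<bar>a\<bar>" .
  interpret M: finite_measure ?M by (rule finite_measureI) (simp add: em)
  have "emeasure ?M A = (SUP K \<in> {K. compact K \<and> K \<subseteq> A}. emeasure ?M K)" if "A \<in> sets borel" for A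
    using inner_regular[of ?M A] that em by (simp add: conj_commute)
  then have R: "finite_radon_measure ?M"
    using M.finite_measure_axioms by (simp add: finite_radon_measure_def)
  have "finite_measure (path_measure a \<gamma>)" unfolding path_measure_def
    by (rule M.finite_measure_distr[OF meas])
  moreover have "\<exists>K. compact K \<and> K \<subseteq> A \<and> measure (path_measure a \<gamma>) (A - K) \<le> e"
    if A: "A \<in> sets borel" and e: "e > 0" for A e
  proof -
    have A': "\<gamma> -` A \<in> sets borel" using measurable_sets[OF meas A] by simp
    obtain K where K: "compact K" "K \<subseteq> \<gamma> -` A" "measure ?M (\<gamma> -` A - K) \<le> e"
      using radon_compact_approx[OF R A' e] .
    have cK: "compact (\<gamma> ` K)"
      using compact_continuous_image[OF continuous_on_subset[OF \<gamma>] K(1)] by simp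
    have AK: "A - \<gamma> ` K \<in> sets borel" using A borel_compact[OF cK] by auto
    have "measure (path_measure a \<gamma>) (A - \<gamma> ` K) = measure ?M (\<gamma> -` (A - \<gamma> ` K))"
      unfolding path_measure_def using measure_distr[OF meas AK] by simp
    also have "\<dots> \<le> measure ?M (\<gamma> -` A - K)"
      using A' borel_compact[OF K(1)] by (intro M.finite_measure_mono) auto
    finally show ?thesis using K cK by (intro exI[of _ "\<gamma> ` K"]) auto
  qed
  ultimately show "finite_radon_measure (path_measure a \<gamma>)"
    unfolding finite_radon_measure_iff by (simp add: path_measure_def)
  show "measure (path_measure a \<gamma>) UNIV = \<bar>a\<bar>"
    unfolding path_measure_def using measure_distr[OF meas, of UNIV] em by (simp add: measure_def)
  show "(\<integral>x. \<bar>f x\<bar> \<partial>path_measure a \<gamma>) = \<bar>a\<bar> * integral {0..1} (\<lambda>t. \<bar>f (\<gamma> t)\<bar>)" if f: "f \<in> Lipb"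
  proof -
    have cf: "continuous_on UNIV f" using Lip_continuous[OF Lipb_Lip[OF f]] .
    have c: "continuous_on S (\<lambda>t. \<bar>f (\<gamma> t)\<bar>)" for S
    proof -
      have "continuous_on UNIV (\<lambda>t. f (\<gamma> t))"
        using continuous_on_compose2[OF cf \<gamma>] by simp
      then show ?thesis by (intro continuous_on_rabs) (rule continuous_on_subset, auto)
    qed
    have fm: "(\<lambda>x. \<bar>f x\<bar>) \<in> borel_measurable borel"
      using borel_measurable_continuous_onI[OF cf] by measurable
    have "(\<integral>x. \<bar>f x\<bar> \<partial>path_measure a \<gamma>) = (\<integral>t. \<bar>f (\<gamma> t)\<bar> \<partial>?M)"
      unfolding path_measure_def by (rule integral_distr[OF meas fm])
    also have "\<dots> = (\<integral>t. (\<bar>a\<bar> * indicator {0..1} t) *\<^sub>R \<bar>f (\<gamma> t)\<bar> \<partial>lborel)"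
      using borel_measurable_continuous_onI[OF c[of UNIV]] by (intro integral_density) auto
    also have "\<dots> = \<bar>a\<bar> * (LBINT t:{0..1}. \<bar>f (\<gamma> t)\<bar>)"
      by (simp add: set_lebesgue_integral_def mult.assoc)
    also have "(LBINT t:{0..1}. \<bar>f (\<gamma> t)\<bar>) = integral {0..1} (\<lambda>t. \<bar>f (\<gamma> t)\<bar>)"
      by (intro set_borel_integral_eq_integral borel_integrable_atLeastAtMost')
         (auto intro: c)
    finally show ?thesis .
  qed
qed

section \<open>Point masses and segments as currents\<close>

lemma dforms_0: "(f, ps) \<in> dforms 0 \<longleftrightarrow> f \<in> Lipb \<and> ps = []"
  by (auto simp: dforms_def)

lemma dforms_1: "(f, ps) \<in> dforms (Suc 0) \<longleftrightarrow> f \<in> Lipb \<and> (\<exists>p\<in>Lip. ps = [p])"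
  by (auto simp: dforms_def length_Suc_conv)

lemma point_current:
  "(\<lambda>f ps. a * f z) \<in> currents 0" "mass_bound 0 (\<lambda>f ps. a * f z) (path_measure a (\<lambda>_. z))"
proof -
  have c: "continuous_on UNIV (\<lambda>_::real. z)" by (rule continuous_on_const)
  have lin: "multilinear 0 (\<lambda>f ps. a * f z)" by (auto simp: multilinear_def algebra_simps)
  show mb: "mass_bound 0 (\<lambda>f ps. a * f z) (path_measure a (\<lambda>_. z))"
    unfolding mass_bound_def using path_measure(1,3)[OF c] by (auto simp: dforms_0 abs_mult)
  have "continuous_functional 0 (\<lambda>f ps. a * f z)"
    by (auto simp: continuous_functional_def wstar_conv_def intro!: tendsto_intros)
  then show "(\<lambda>f ps. a * f z) \<in> currents 0"
    using lin mb multilinear_metric_functional[OF lin]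
    by (auto simp: currents_def finite_mass_def alternating_def local_functional_def)
qed

text \<open>Defined for all real \<open>t\<close>, so that compositions are Lipschitz on the whole
  line, as the Stieltjes estimates require; the dyadic sums only see the unit interval.\<close>

definition segment_path :: "'a \<times> 'a \<Rightarrow> real \<Rightarrow> 'a::real_normed_vector" where
  "segment_path e t = snd e + t *\<^sub>R (fst e - snd e)"

text \<open>The segment is oriented from \<open>snd e\<close> to \<open>fst e\<close>, with the multiplicity that gives it mass \<open>\<bar>a\<bar>\<close>.
  For a degenerate segment the current is zero, since \<open>a / 0 = 0\<close>.\<close>

definition segment_current :: "real \<Rightarrow> 'a \<times> 'a \<Rightarrow> 'a::real_normed_vector functional" where
  "segment_current a e f ps = a / dist (fst e) (snd e) *
     stieltjes (\<lambda>t. f (segment_path e t)) (\<lambda>t. (ps ! 0) (segment_path e t))"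

lemma segment_path_lipschitz: "(dist (fst e) (snd e))-lipschitz_on UNIV (segment_path e)"
proof (rule lipschitz_onI)
  fix s t :: real
  have "segment_path e s - segment_path e t = (s - t) *\<^sub>R (fst e - snd e)"
    by (simp add: segment_path_def algebra_simps)
  then show "dist (segment_path e s) (segment_path e t) \<le> dist (fst e) (snd e) * dist s t"
    by (simp add: dist_norm)
qed simp

lemma lipschitz_segment_path:
  assumes "C-lipschitz_on UNIV f"
  shows "(C * dist (fst e) (snd e))-lipschitz_on UNIV (\<lambda>t. f (segment_path e t))"
  by (rule lipschitz_on_compose2[OF segment_path_lipschitz]) (rule lipschitz_on_subset[OF assms], simp)

text \<open>The Stieltjes integral of 1 is the increment of \<open>p\<close> from
  \<open>snd e\<close> to \<open>fst e\<close>. This identity lifts a combination of difference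
  quotients to a combination of segments.\<close>

lemma segment_current_one:
  "segment_current a e (\<lambda>_. 1) [p] = a * diff_quotient e p"
  by (simp add: segment_current_def stieltjes_one segment_path_def diff_quotient_def)

text \<open>Along the path the Lipschitz constant of \<open>p\<close> gains the factor
  \<open>dist (fst e) (snd e)\<close>, which cancels the normalisation in
  \<open>segment_current\<close> and leaves |a| times the integral over the parameter.\<close>

lemma segment_current:
  fixes e :: "'a::real_normed_vector \<times> 'a"
  shows "segment_current a e \<in> currents 1"
    "mass_bound 1 (segment_current a e) (path_measure a (segment_path e))"
proof -
  let ?T = "segment_current a e" and ?d = "dist (fst e) (snd e)"
  note c = lipschitz_on_continuous_on[OF segment_path_lipschitz]
  note L = lipschitz_segment_path[OF lipschitz_lip_const]
  have lin: "multilinear 1 ?T"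
    unfolding multilinear_def
  proof (clarify, intro conjI ballI allI impI)
    fix f :: "'a \<Rightarrow> real" and ps assume "(f, ps) \<in> dforms 1"
    then obtain p where p: "f \<in> Lip" "p \<in> Lip" "ps = [p]" by (auto simp: dforms_1 Lipb_Lip)
    show "?T (\<lambda>x. \<alpha> * f x + \<beta> * g x) ps = \<alpha> * ?T f ps + \<beta> * ?T g ps" if "g \<in> Lipb" for g \<alpha> \<beta>
      using stieltjes_lincomb(1)[OF L[OF p(1)] L[OF Lipb_Lip[OF that]] L[OF p(2)] L[OF p(2)]]
      by (simp add: segment_current_def p(3) algebra_simps add_divide_distrib)
    show "?T f (ps[i := \<lambda>x. \<alpha> * q x + \<beta> * r x]) = \<alpha> * ?T f (ps[i := q]) + \<beta> * ?T f (ps[i := r])"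
      if "i < 1" "q \<in> Lip" "r \<in> Lip" for i q r \<alpha> \<beta>
      using stieltjes_lincomb(2)[OF L[OF p(1)] L[OF p(1)] L[OF that(2)] L[OF that(3)]] that(1)
      by (simp add: segment_current_def p(3) algebra_simps add_divide_distrib)
  qed
  show mb: "mass_bound 1 ?T (path_measure a (segment_path e))"
    unfolding mass_bound_def
  proof (intro conjI ballI path_measure(1)[OF c]; clarify)
    fix f :: "'a \<Rightarrow> real" and ps assume "(f, ps) \<in> dforms 1"
    then obtain p where p: "f \<in> Lipb" "p \<in> Lip" "ps = [p]" by (auto simp: dforms_1)
    let ?I = "integral {0..1} (\<lambda>t. \<bar>f (segment_path e t)\<bar>)"
    have "\<bar>?T f ps\<bar> = \<bar>a\<bar> / ?d * \<bar>stieltjes (\<lambda>t. f (segment_path e t)) (\<lambda>t. p (segment_path e t))\<bar>"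
      by (simp add: segment_current_def p(3) abs_mult)
    also have "\<dots> \<le> \<bar>a\<bar> / ?d * (lip_const p * ?d * ?I)"
      by (intro mult_left_mono abs_stieltjes_le[OF L[OF Lipb_Lip[OF p(1)]] L[OF p(2)]]) auto
    also have "\<dots> \<le> \<bar>a\<bar> * (lip_const p * ?I)"
    \<comment> \<open>For a degenerate segment the left side is 0 and the right side is nonnegative;
      the cancellation needs nonzero length.\<close>
    proof (cases "?d = 0")
      case True
      have "0 \<le> ?I" by (rule Henstock_Kurzweil_Integration.integral_nonneg)
        (auto intro!: integrable_continuous_real continuous_on_rabs
          lipschitz_on_continuous_on[OF lipschitz_on_subset[OF L[OF Lipb_Lip[OF p(1)]]]])
      then show ?thesis using True lip_const_nonneg[OF p(2)] by simp
    qed simp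
    also have "\<dots> = prod_list (map lip_const ps) * (\<integral>x. \<bar>f x\<bar> \<partial>path_measure a (segment_path e))"
      using path_measure(3)[OF c p(1), of a] by (simp add: p(3))
    finally show "\<bar>?T f ps\<bar> \<le> \<dots>" .
  qed
  have loc: "?T f ps = 0" if "(f, ps) \<in> dforms 1" and *: "i < 1" "\<forall>x. f x \<noteq> 0 \<longrightarrow> (ps ! i) x = k" for f ps i k
  proof -
    from that(1) obtain p where p: "f \<in> Lip" "p \<in> Lip" "ps = [p]" by (auto simp: dforms_1 Lipb_Lip)
    have "stieltjes (\<lambda>t. f (segment_path e t)) (\<lambda>t. p (segment_path e t)) = 0"
    proof (rule stieltjes_local)
      show "(lip_const f * ?d)-lipschitz_on UNIV (\<lambda>t. f (segment_path e t))"
        "(lip_const p * ?d)-lipschitz_on UNIV (\<lambda>t. p (segment_path e t))"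
        using p by (auto intro: L)
      show "p (segment_path e t) = k" if that2: "f (segment_path e t) \<noteq> 0" for t
        using * p that2 by simp
    qed
    then show ?thesis by (simp add: segment_current_def p(3))
  qed
  then have loc: "local_functional 1 ?T" unfolding local_functional_def by blast
  have "continuous_functional 1 ?T"
    unfolding continuous_functional_def
  proof clarify
    fix fs :: "nat \<Rightarrow> 'a \<Rightarrow> real" and pss :: "nat \<Rightarrow> ('a \<Rightarrow> real) list" and f ps
    assume *: "wstar_conv fs f" "\<forall>i<(1::nat). wstar_conv (\<lambda>n. pss n ! i) (ps ! i)"
    have unif: "\<exists>A. (\<forall>n. A-lipschitz_on UNIV (hs n)) \<and> A-lipschitz_on UNIV h"
      if w: "wstar_conv hs h" for hs and h :: "'a \<Rightarrow> real"
    proof -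
      obtain B where "\<And>n. lip_const (hs n) \<le> B"
        using w by (fastforce simp: wstar_conv_def bdd_above_def)
      then have "(max B (lip_const h))-lipschitz_on UNIV (hs n)" for n
        using w lipschitz_on_le[OF lipschitz_lip_const[of "hs n"]]
        by (auto simp: wstar_conv_def max.coboundedI1)
      moreover have "(max B (lip_const h))-lipschitz_on UNIV h"
        using w lipschitz_on_le[OF lipschitz_lip_const[of h]] by (auto simp: wstar_conv_def)
      ultimately show ?thesis by blast
    qed
    have w: "wstar_conv (\<lambda>n. pss n ! 0) (ps ! 0)" using *(2) by simp
    obtain A where A: "\<And>n. A-lipschitz_on UNIV (fs n)" "A-lipschitz_on UNIV f" using unif[OF *(1)] by blast
    obtain B where B: "\<And>n. B-lipschitz_on UNIV (pss n ! 0)" "B-lipschitz_on UNIV (ps ! 0)" using unif[OF w] by blast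
    have "(\<lambda>n. stieltjes (\<lambda>t. fs n (segment_path e t)) (\<lambda>t. (pss n ! 0) (segment_path e t)))
        \<longlonglongrightarrow> stieltjes (\<lambda>t. f (segment_path e t)) (\<lambda>t. (ps ! 0) (segment_path e t))"
      by (rule stieltjes_tendsto[OF lipschitz_segment_path[OF A(1)] lipschitz_segment_path[OF A(2)] _
            lipschitz_segment_path[OF B(1)] lipschitz_segment_path[OF B(2)]])
         (use *(1) w in \<open>auto simp: wstar_conv_def\<close>)
    then show "(\<lambda>n. ?T (fs n) (pss n)) \<longlonglongrightarrow> ?T f ps"
      unfolding segment_current_def by (intro tendsto_mult_left)
  qed
  then show "?T \<in> currents 1"
    using lin mb loc multilinear_metric_functional[OF lin]
    by (auto simp: currents_def finite_mass_def alternating_def)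
qed

section \<open>Approximation by normal currents\<close>

lemma multilinear_uminus: "multilinear k T \<Longrightarrow> multilinear k (\<lambda>f ps. - T f ps)"
  for T :: "'a::metric_space functional"
  unfolding multilinear_def by (fastforce simp: algebra_simps)

lemma currents_uminus:
  fixes T :: "'a::metric_space functional"
  assumes "T \<in> currents k"
  shows "(\<lambda>f ps. - T f ps) \<in> currents k"
proof -
  have lin: "multilinear k (\<lambda>f ps. - T f ps)"
    using assms by (simp add: currents_def multilinear_uminus)
  have "continuous_functional k (\<lambda>f ps. - T f ps)"
    unfolding continuous_functional_def
  proof (intro allI impI, elim conjE)
    fix fs :: "nat \<Rightarrow> 'a \<Rightarrow> real" and pss f ps
    assume "\<forall>n. (fs n, pss n) \<in> dforms k" "(f, ps) \<in> dforms k" "wstar_conv fs f"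
      "bdd_above (range (\<lambda>n. sup_norm (fs n)))" "\<forall>i<k. wstar_conv (\<lambda>n. pss n ! i) (ps ! i)"
    moreover have "continuous_functional k T" using assms by (simp add: currents_def)
    ultimately have "(\<lambda>n. T (fs n) (pss n)) \<longlonglongrightarrow> T f ps"
      unfolding continuous_functional_def by blast
    then show "(\<lambda>n. - T (fs n) (pss n)) \<longlonglongrightarrow> - T f ps" by (rule tendsto_minus)
  qed
  then show ?thesis
    using assms lin multilinear_metric_functional[OF lin]
    by (simp add: currents_def finite_mass_def mass_bound_def alternating_def local_functional_def)
qed

text \<open>A two-term superposition indexed by \<open>bool\<close>, with \<open>T\<close> negated
  in the second term.\<close>

lemma currents_diff:
  fixes S T :: "'a::metric_space functional"
  assumes S: "S \<in> currents k" and T: "T \<in> currents k"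
  shows "(\<lambda>f ps. S f ps - T f ps) \<in> currents k"
proof -
  let ?R = "\<lambda>b f ps. if b then S f ps else - T f ps"
  have R: "?R b \<in> currents k" for b using S currents_uminus[OF T] by (cases b) auto
  then have "\<exists>\<mu>. mass_bound k (?R b) \<mu>" for b by (simp add: currents_def finite_mass_def)
  then have "\<forall>b. \<exists>\<mu>. mass_bound k (?R b) \<mu>" by blast
  from choice[OF this] obtain M where M: "mass_bound k (?R b) (M b)" for b by blast
  have "(\<lambda>f ps. \<integral>b. ?R b f ps \<partial>count_space UNIV) \<in> currents k"
    by (rule currents_superpose(1)[OF _ R M]) (auto intro!: integrable_count_space)
  then show ?thesis by (simp add: lebesgue_integral_count_space_finite UNIV_bool)
qed

text \<open>The forms of degree 0 have an empty list, so the axioms see only values at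
  \<open>[]\<close>; the formula for a boundary will be established only there.\<close>

lemma currents_0_cong:
  assumes T: "T \<in> currents 0" and eq: "\<And>f. f \<in> Lipb \<Longrightarrow> S f [] = T f []"
  shows "S \<in> currents 0"
proof -
  have lin: "multilinear 0 S"
    using T unfolding currents_def multilinear_def by (fastforce simp: dforms_0 eq Lipb_lincomb)
  obtain \<mu> where "mass_bound 0 T \<mu>" using T by (auto simp: currents_def finite_mass_def)
  then have "mass_bound 0 S \<mu>" by (auto simp: mass_bound_def dforms_0 eq)
  then have "finite_mass 0 S" by (auto simp: finite_mass_def)
  moreover have "continuous_functional 0 S"
    using T by (auto simp: currents_def continuous_functional_def dforms_0 eq)
  ultimately show ?thesis
    using lin multilinear_metric_functional[OF lin]
    by (simp add: currents_def alternating_def local_functional_def)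
qed

lemma finite_sum_current:
  fixes R :: "'i \<Rightarrow> 'a::metric_space functional"
  assumes E: "finite E" and R: "\<And>i. i \<in> E \<Longrightarrow> R i \<in> currents k"
    and M: "\<And>i. i \<in> E \<Longrightarrow> mass_bound k (R i) (M i)"
  shows "(\<lambda>f ps. \<Sum>i\<in>E. R i f ps) \<in> currents k"
    "mass_bound k (\<lambda>f ps. \<Sum>i\<in>E. R i f ps) (superpose_measure E M)"
    "measure (superpose_measure E M) UNIV = (\<Sum>i\<in>E. measure (M i) UNIV)"
  using currents_superpose(1-3)[OF countable_finite[OF E] R M integrable_count_space[OF E]] E
  by (simp_all add: lebesgue_integral_count_space_finite)

text \<open>The sum separates into point masses at the \<open>x i\<close> and at the
  \<open>y i\<close>, each a finite sum of currents.\<close>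

lemma boundary_molecule_current:
  fixes x y :: "'i \<Rightarrow> 'a::metric_space"
  assumes E: "finite E" and S: "\<And>f. f \<in> Lipb \<Longrightarrow> S f [] = (\<Sum>i\<in>E. w i * (f (x i) - f (y i)))"
  shows "S \<in> currents 0"
proof (rule currents_0_cong)
  show "(\<lambda>f ps. (\<Sum>i\<in>E. w i * f (x i)) - (\<Sum>i\<in>E. w i * f (y i))) \<in> currents 0"
    by (intro currents_diff finite_sum_current(1)[OF E point_current])
qed (simp add: S algebra_simps sum_subtractf)

lemma current_linear_functional:
  assumes "T \<in> currents 1"
  shows "linear_functional_on Lip (\<lambda>p. T (\<lambda>_. 1) [p])"
  unfolding linear_functional_on_def
proof (intro ballI allI)
  fix p q :: "'a \<Rightarrow> real" and a b assume pq: "p \<in> Lip" "q \<in> Lip"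
  have T: "multilinear 1 T" and d: "(\<lambda>_. 1, [p]) \<in> dforms 1"
    using assms pq by (auto simp: currents_def dforms_1)
  show "T (\<lambda>_. 1) [\<lambda>x. a * p x + b * q x] = a * T (\<lambda>_. 1) [p] + b * T (\<lambda>_. 1) [q]"
    using multilinearD(2)[OF T d _ pq, of 0] by simp
qed

lemma current_boundary_bound:
  fixes T :: "'a::metric_space functional"
  assumes "mass_bound 1 T \<mu>" "p \<in> Lip"
  shows "\<bar>T (\<lambda>_. 1) [p]\<bar> \<le> measure \<mu> UNIV * lip_const p"
  using mass_boundD(1)[OF assms(1), of "\<lambda>_. 1" "[p]"] assms(2)
    finite_radon_measureD[OF mass_bound_radon[OF assms(1)]]
  by (simp add: dforms_1 mult.commute)

text \<open>Otherwise there are 1-Lipschitz functions tending uniformly to 0 on which the absolute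
  value stays above \<open>e\<close>; they converge weak* to 0, against the continuity of
  \<open>T\<close>.\<close>

lemma current_small_on_small:
  fixes T :: "'a::metric_space functional"
  assumes T: "T \<in> currents 1" and e: "0 < e"
  obtains \<eta> where "0 < \<eta>" "\<And>p. 1-lipschitz_on UNIV p \<Longrightarrow> (\<And>x. \<bar>p x\<bar> \<le> \<eta>) \<Longrightarrow> \<bar>T (\<lambda>_. 1) [p]\<bar> \<le> e"
proof -
  have "\<exists>\<eta>>0. \<forall>p. 1-lipschitz_on UNIV p \<and> (\<forall>x. \<bar>p x\<bar> \<le> \<eta>) \<longrightarrow> \<bar>T (\<lambda>_. 1) [p]\<bar> \<le> e"
  proof (rule ccontr)
    assume neg: "\<not> ?thesis"
    have "\<exists>p. 1-lipschitz_on UNIV p \<and> (\<forall>x. \<bar>p x\<bar> \<le> 1 / Suc n) \<and> e < \<bar>T (\<lambda>_. 1) [p]\<bar>" for n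
    proof -
      have "0 < 1 / real (Suc n)" by simp
      with neg show ?thesis by (meson not_le)
    qed
    then obtain p where p: "\<And>n. 1-lipschitz_on UNIV (p n)" "\<And>n x. \<bar>p n x\<bar> \<le> 1 / Suc n"
      "\<And>n. e < \<bar>T (\<lambda>_. 1) [p n]\<bar>" by metis
    have Lip: "p n \<in> Lip" for n using p(1) by (rule LipI)
    have "(\<lambda>n. p n x) \<longlonglongrightarrow> 0" for x
      by (rule Lim_null_comparison[OF _ LIMSEQ_Suc[OF lim_1_over_n]]) (use p(2) in auto)
    moreover have "bdd_above (range (\<lambda>n. lip_const (p n)))"
      using lip_const_le[OF p(1)] by (auto intro!: bdd_aboveI)
    ultimately have w: "wstar_conv p (\<lambda>_. 0)" using Lip by (simp add: wstar_conv_def)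
    have "continuous_functional 1 T" using T by (simp add: currents_def)
    then have "(\<lambda>n. T (\<lambda>_. 1) [p n]) \<longlonglongrightarrow> T (\<lambda>_. 1) [\<lambda>_. 0]"
      unfolding continuous_functional_def
      by (elim allE[of _ "\<lambda>_ _. 1"] allE[of _ "\<lambda>n. [p n]"] allE[of _ "\<lambda>_. 1"] allE[of _ "[\<lambda>_. 0]"] mp)
         (use w Lip in \<open>auto simp: dforms_1 wstar_conv_def\<close>)
    moreover have "T (\<lambda>_. 1) [\<lambda>_. 0] = 0"
      using linear_functional_scale[OF current_linear_functional[OF T] Lip_const[of 0], of 0] by simp
    ultimately have "(\<lambda>n. \<bar>T (\<lambda>_. 1) [p n]\<bar>) \<longlonglongrightarrow> 0" by (simp add: tendsto_rabs_zero_iff)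
    then have "\<forall>\<^sub>F n in sequentially. \<bar>T (\<lambda>_. 1) [p n]\<bar> < e" using e by (rule order_tendstoD(2))
    then show False using p(3) by (auto dest!: eventually_happens simp: less_not_sym)
  qed
  then show ?thesis using that by blast
qed

text \<open>By inner regularity the mass lives, up to \<open>\<epsilon>\<close>, on a compact set \<open>K\<close>. A \<open>1\<close>-Lipschitz \<open>p\<close> vanishing
  on a fine net of \<open>K\<close> is uniformly small on \<open>K\<close>; its truncation is controlled by continuity of \<open>T\<close>, and the
  remainder vanishes near \<open>K\<close>, where locality applies.\<close>

lemma current_tight:
  fixes T :: "'a::metric_space functional"
  assumes T: "T \<in> currents 1"
  shows "tight_functional (\<lambda>p. T (\<lambda>_. 1) [p])"
  unfolding tight_functional_def
proof (intro allI impI)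
  let ?u = "\<lambda>p. T (\<lambda>_. 1) [p]"
  fix e :: real assume e: "0 < e"
  have lin: "linear_functional_on Lip ?u" by (rule current_linear_functional[OF T])
  have ml: "multilinear 1 T" and loc: "local_functional 1 T" using T by (auto simp: currents_def)
  obtain \<mu> where \<mu>: "mass_bound 1 T \<mu>" using T by (auto simp: currents_def finite_mass_def)
  note R = mass_bound_radon[OF \<mu>]
  note D = finite_radon_measureD[OF R]
  interpret finite_measure \<mu> by (rule D)
  obtain K0 where K0: "compact K0" "measure \<mu> (UNIV - K0) \<le> e / 4"
    using radon_compact_approx[OF R, of UNIV "e / 4"] e by auto
  \<comment> \<open>Kept nonempty, so that \<open>infdist\<close> to \<open>K\<close> is a genuine
    distance.\<close>
  define K where "K = insert undefined K0"
  have K: "compact K" "K \<noteq> {}" using K0 by (auto simp: K_def)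
  have KB: "UNIV - K \<in> sets \<mu>" using borel_compact[OF K(1)] D(1) by auto
  have "measure \<mu> (UNIV - K) \<le> measure \<mu> (UNIV - K0)"
    using borel_compact[OF K0(1)] D(1) by (intro finite_measure_mono) (auto simp: K_def)
  then have mK: "measure \<mu> (UNIV - K) \<le> e / 4" using K0(2) by linarith
  obtain \<eta> where \<eta>: "0 < \<eta>" "\<And>p. 1-lipschitz_on UNIV p \<Longrightarrow> (\<And>x. \<bar>p x\<bar> \<le> \<eta>) \<Longrightarrow> \<bar>?u p\<bar> \<le> e / 2"
    using current_small_on_small[OF T, of "e / 2"] e by auto
  \<comment> \<open>A 1-Lipschitz function bounded by \<delta> on \<open>K\<close> is bounded by
    \<open>2 * \<delta>\<close> on the \<delta>-neighbourhood of \<open>K\<close>. With this choice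
    that height is \<eta>, so truncating there gives a function on which continuity yields the
    bound.\<close>
  define \<delta> where "\<delta> = \<eta> / 2"
  have \<delta>: "0 < \<delta>" using \<eta>(1) by (simp add: \<delta>_def)
  obtain F where F: "finite F" "K \<subseteq> (\<Union>x\<in>F. ball x \<delta>)"
    using K(1) \<delta> unfolding compact_eq_totally_bounded by blast
  have main: "\<bar>?u q\<bar> \<le> e" if q: "1-lipschitz_on UNIV q" and z: "\<And>x. x \<in> F \<Longrightarrow> q x = 0" for q
  proof -
    have q': "\<bar>q x - q y\<bar> \<le> dist x y" for x y using lipschitz_onD[OF q, of x y] by (simp add: dist_real_def)
    have qK: "\<bar>q x\<bar> \<le> \<delta>" if x: "x \<in> K" for x
    proof -
      obtain y where y: "y \<in> F" "dist y x < \<delta>" using F(2) x by auto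
      then show ?thesis using q'[of x y] z[OF y(1)] by (simp add: dist_commute)
    qed
    define r where "r x = max (- 2 * \<delta>) (min (2 * \<delta>) (q x))" for x
    have r1: "1-lipschitz_on UNIV r"
    proof (rule lipschitz_onI)
      fix x y show "dist (r x) (r y) \<le> 1 * dist x y"
        using q'[of x y] unfolding r_def dist_real_def by (auto simp: max_def min_def)
    qed simp
    have qL: "q \<in> Lip" "lip_const q \<le> 1" and rL: "r \<in> Lip" "lip_const r \<le> 1"
      using q r1 by (auto intro: LipI lip_const_le)
    have "\<bar>r x\<bar> \<le> \<eta>" for x using \<delta> by (auto simp: r_def \<delta>_def)
    then have ur: "\<bar>?u r\<bar> \<le> e / 2" by (rule \<eta>(2)[OF r1])
    define s where "s = (\<lambda>x. 1 * q x + (-1) * r x)"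
    have sL: "s \<in> Lip" unfolding s_def by (rule Lip_lincomb(1)[OF qL(1) rL(1)])
    have s2: "lip_const s \<le> 2" using Lip_lincomb(2)[OF qL(1) rL(1), of 1 "-1"] qL rL by (simp add: s_def)
    have us: "?u s = ?u q - ?u r"
      unfolding s_def using linear_functional_onD[OF lin qL(1) rL(1), of 1 "-1"] by simp
    define \<phi> where "\<phi> = (\<lambda>x. max 0 (1 - infdist x K / \<delta>))"
    have \<phi>: "\<phi> \<in> Lipb" unfolding \<phi>_def by (rule Lipb_cutoff[OF \<delta>])
    have \<psi>: "(\<lambda>x. 1 * 1 + (-1) * \<phi> x) \<in> Lipb" by (rule Lipb_lincomb[OF Lipb_const \<phi>])
    have d1: "(\<phi>, [s]) \<in> dforms 1" and d2: "(\<lambda>x. 1 * 1 + (-1) * \<phi> x, [s]) \<in> dforms 1"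
      and d3: "(\<lambda>_. 1, [s]) \<in> dforms 1"
      using \<phi> \<psi> sL by (auto simp: dforms_1)
    \<comment> \<open>Where the cutoff is nonzero, |q| is at most \<open>2 * \<delta>\<close> and
      the truncation changes nothing; locality then applies with the constant 0.\<close>
    have "s x = 0" if "\<phi> x \<noteq> 0" for x
    proof -
      have "infdist x K < \<delta>" using that \<delta> by (auto simp: \<phi>_def max_def field_simps split: if_splits)
      then obtain y where y: "y \<in> K" "dist x y < \<delta>"
        using K(2) unfolding infdist_notempty[OF K(2)]
        by (subst (asm) cINF_less_iff) (auto intro!: bdd_belowI[of _ 0])
      then have "\<bar>q x\<bar> \<le> 2 * \<delta>" using q'[of x y] qK[OF y(1)] by linarith
      then show ?thesis by (auto simp: s_def r_def)
    qed
    then have T1: "T \<phi> [s] = 0" using loc d1 unfolding local_functional_def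
      by (auto elim!: ballE[of _ _ "(\<phi>, [s])"])
    \<comment> \<open>The complementary cutoff lives off \<open>K\<close>, and \<open>s\<close> has
      Lipschitz constant at most 2: hence the choice of \<open>e / 4\<close> for the mass outside
      \<open>K\<close>.\<close>
    have "\<bar>1 * 1 + (-1) * \<phi> x\<bar> \<le> indicator (UNIV - K) x" for x
      using \<delta> infdist_nonneg[of x K] by (auto simp: \<phi>_def indicator_def)
    then have "(\<integral>x. \<bar>1 * 1 + (-1) * \<phi> x\<bar> \<partial>\<mu>) \<le> (\<integral>x. indicator (UNIV - K) x \<partial>\<mu>)"
      using KB by (intro integral_mono Lipb_integrable[OF D(2,1) \<psi>] integrable_real_indicator)
        (auto simp: less_top[symmetric])
    also have "\<dots> \<le> e / 4" using KB D(3) mK by simp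
    finally have "lip_const s * (\<integral>x. \<bar>1 * 1 + (-1) * \<phi> x\<bar> \<partial>\<mu>) \<le> 2 * (e / 4)"
      by (intro mult_mono s2) auto
    then have T2: "\<bar>T (\<lambda>x. 1 * 1 + (-1) * \<phi> x) [s]\<bar> \<le> e / 2"
      using mass_boundD(1)[OF \<mu> d2] by simp
    have "T (\<lambda>x. 1 * 1 + (-1) * \<phi> x) [s] = 1 * ?u s + (-1) * T \<phi> [s]"
      by (rule multilinearD(1)[OF ml d3 \<phi>])
    then have "\<bar>?u s\<bar> \<le> e / 2" using T1 T2 by simp
    then show ?thesis using us ur by linarith
  qed
  have "\<bar>?u p\<bar> \<le> e * lip_const p" if p: "p \<in> Lip" and z: "\<forall>x\<in>F. p x = 0" for p
  \<comment> \<open>Rescaling to a 1-Lipschitz function divides by \<open>lip_const p\<close>; when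
    this is 0 the mass bound already gives 0.\<close>
  proof (cases "lip_const p = 0")
    case True
    then show ?thesis using current_boundary_bound[OF \<mu> p] by simp
  next
    case False
    then have L: "0 < lip_const p" using lip_const_nonneg[OF p] by simp
    have "1-lipschitz_on UNIV (\<lambda>x. (1 / lip_const p) * p x)"
      using lipschitz_on_cmult_real[OF lipschitz_lip_const[OF p], of "1 / lip_const p"] L by simp
    then have "\<bar>?u (\<lambda>x. (1 / lip_const p) * p x)\<bar> \<le> e" by (rule main) (use z in auto)
    then show ?thesis
      unfolding linear_functional_scale[OF lin p] using L by (simp add: abs_mult field_simps)
  qed
  then show "\<exists>F. finite F \<and> (\<forall>p\<in>Lip. (\<forall>x\<in>F. p x = 0) \<longrightarrow> \<bar>?u p\<bar> \<le> e * lip_const p)"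
    using F(1) by blast
qed

theorem theorem1p6:
  fixes T :: "'a::banach functional"
  assumes "(\<forall>A :: 'a set. ulam_cardinality A) \<or> separable_space (euclidean :: 'a topology)"
    and "T \<in> currents 1"
    and "derivations_finitely_generated (mass 1 T)"
  shows "\<exists>N :: nat \<Rightarrow> 'a functional.
           (\<forall>n. N n \<in> normal_currents 1) \<and>
           (\<lambda>n. current_norm 1 (\<lambda>f ps. T f ps - N n f ps)) \<longlonglongrightarrow> 0"
proof -
  note T = assms(2)
  obtain \<mu> where \<mu>: "mass_bound 1 T \<mu>" using T by (auto simp: currents_def finite_mass_def)
  \<comment> \<open>The added 1 makes \<open>c\<close> positive even if \<mu> is the zero
    measure.\<close>
  define c where "c = measure \<mu> UNIV + 1"
  have c: "0 < c" by (simp add: c_def add_nonneg_pos)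
  have bnd: "\<bar>T (\<lambda>_. 1) [p]\<bar> \<le> c * lip_const p" if "p \<in> Lip" for p
    using current_boundary_bound[OF \<mu> that] lip_const_nonneg[OF that] by (simp add: c_def algebra_simps)
  obtain E a where E: "\<And>n :: nat. finite (E n)" "\<And>n. (\<Sum>i\<in>E n. \<bar>a n i\<bar>) \<le> c / 2 ^ n"
    and u: "\<And>p. p \<in> Lip \<Longrightarrow> (\<lambda>n. \<Sum>i\<in>E n. a n i * diff_quotient i p) sums T (\<lambda>_. 1) [p]"
    using tight_functional_decomposition[OF current_linear_functional[OF T] c _ current_tight[OF T]] bnd by blast
  define R where "R n f ps = (\<Sum>i\<in>E n. segment_current (a n i) i f ps)" for n f ps
  define M where "M n = superpose_measure (E n) (\<lambda>i. path_measure (a n i) (segment_path i))" for n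
  have len: "measure (path_measure b (segment_path i)) UNIV = \<bar>b\<bar>" for b and i :: "'a \<times> 'a"
    by (rule path_measure(2)[OF lipschitz_on_continuous_on[OF segment_path_lipschitz]])
  have R: "R n \<in> currents 1" "mass_bound 1 (R n) (M n)" and M: "measure (M n) UNIV \<le> c / 2 ^ n" for n
    using finite_sum_current[OF E(1)[of n] segment_current, of "a n" "\<lambda>i. i"] E(2)[of n]
      len
    unfolding R_def[abs_def] M_def by simp_all
  have sumM: "summable (\<lambda>k. c / 2 ^ k)"
    using summable_mult[OF summable_geometric[of "1/2::real"], of c] by (simp add: power_divide)
  \<comment> \<open>The tail of the series of polyhedral currents, reindexed to start at 0; it is
    the part of \<open>T\<close> that will be discarded.\<close>
  define Q where "Q n f ps = (\<integral>k. R (k + n) f ps \<partial>count_space UNIV)" for n f ps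
  have int: "integrable (count_space UNIV) (\<lambda>k. measure (M (k + n)) UNIV)" for n
    unfolding integrable_count_space_nat_iff
    by (rule summable_comparison_test'[OF summable_ignore_initial_segment[OF sumM, of n], of 0]) (simp add: M)
  note Qs = currents_superpose[OF countableI_type R(1) R(2) int]
  have Q: "Q n \<in> currents 1" "mass_bound 1 (Q n) (superpose_measure UNIV (\<lambda>k. M (k + n)))"
    "measure (superpose_measure UNIV (\<lambda>k. M (k + n))) UNIV = (\<integral>k. measure (M (k + n)) UNIV \<partial>count_space UNIV)" for n
    using Qs(1-3)[of n] unfolding Q_def[abs_def] by simp_all
  have tail: "(\<Sum>k. c / 2 ^ (k + n)) = 2 * c * (1/2) ^ n" for n
  proof -
    have "(\<lambda>k. (c * (1/2) ^ n) * (1/2) ^ k) sums ((c * (1/2) ^ n) * (1 / (1 - 1/2)))"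
      by (intro sums_mult geometric_sums) auto
    then show ?thesis by (simp add: sums_iff power_add power_one_over field_simps)
  qed
  have norm: "current_norm 1 (Q n) \<le> 2 * c * (1/2) ^ n" for n
  proof -
    have "multilinear 1 (Q n)" using Q(1) by (simp add: currents_def)
    from current_norm_le[OF this Q(2)]
    have "current_norm 1 (Q n) \<le> (\<Sum>k. measure (M (k + n)) UNIV)"
      unfolding Q(3) integral_count_space_nat[OF int] .
    also have "\<dots> \<le> (\<Sum>k. c / 2 ^ (k + n))"
      using M int[of n] summable_ignore_initial_segment[OF sumM, of n]
      by (intro suminf_le) (auto simp: integrable_count_space_nat_iff)
    finally show ?thesis unfolding tail .
  qed
  define N where "N n f ps = T f ps - Q n f ps" for n f ps
  have N: "N n \<in> currents 1" for n unfolding N_def[abs_def] by (rule currents_diff[OF T Q(1)])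
  have "boundary (N n) \<in> currents 0" for n
  proof (rule boundary_molecule_current)
    show "finite (Sigma {..<n} E)" using E(1) by simp
    fix f :: "'a \<Rightarrow> real" assume f: "f \<in> Lipb"
    then have fL: "f \<in> Lip" by (rule Lipb_Lip)
    have R1: "R k (\<lambda>_. 1) [f] = (\<Sum>i\<in>E k. a k i * diff_quotient i f)" for k
      by (simp add: R_def segment_current_one)
    \<comment> \<open>The boundaries of the tail sum both to the boundary of \<open>Q n\<close> and
      to that of \<open>T\<close> minus its first \<open>n\<close> terms, so only a finite sum of
      difference quotients is left for \<open>N n\<close>.\<close>
    have "(\<lambda>k. R (k + n) (\<lambda>_. 1) [f]) sums Q n (\<lambda>_. 1) [f]"
      unfolding Q_def by (rule sums_integral_count_space_nat[OF Qs(4)]) (simp add: dforms_1 fL)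
    moreover have "(\<lambda>k. R (k + n) (\<lambda>_. 1) [f]) sums (T (\<lambda>_. 1) [f] - (\<Sum>k<n. R k (\<lambda>_. 1) [f]))"
      using sums_split_initial_segment[OF u[OF fL], of n] unfolding R1 .
    ultimately have "N n (\<lambda>_. 1) [f] = (\<Sum>k<n. \<Sum>i\<in>E k. a k i * diff_quotient i f)"
      using sums_unique2 by (fastforce simp: N_def R1)
    also have "\<dots> = (\<Sum>(k, i)\<in>Sigma {..<n} E. a k i * diff_quotient i f)"
      using E(1) by (intro sum.Sigma) auto
    also have "\<dots> = (\<Sum>j\<in>Sigma {..<n} E. a (fst j) (snd j) / dist (fst (snd j)) (snd (snd j)) *
        (f (fst (snd j)) - f (snd (snd j))))"
      by (intro sum.cong) (auto simp: diff_quotient_def)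
    finally show "boundary (N n) f [] = \<dots>" by (simp add: boundary_def)
  qed
  then have "N n \<in> normal_currents 1" for n using N by (simp add: normal_currents_def)
  moreover have "(\<lambda>n. current_norm 1 (\<lambda>f ps. T f ps - N n f ps)) \<longlonglongrightarrow> 0"
  proof (rule Lim_null_comparison)
    have "0 \<le> current_norm 1 (Q n)" for n by (simp add: current_norm_def)
    \<comment> \<open>Subtracting \<open>N n\<close> from \<open>T\<close> gives back
      \<open>Q n\<close>, whose norm is bounded by the geometric tail.\<close>
    then show "\<forall>\<^sub>F n in sequentially. norm (current_norm 1 (\<lambda>f ps. T f ps - N n f ps)) \<le> 2 * c * (1/2) ^ n"
      using norm by (simp add: N_def)
    show "(\<lambda>n. 2 * c * (1/2) ^ n) \<longlonglongrightarrow> 0"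
      by (intro tendsto_mult_right_zero LIMSEQ_realpow_zero) auto
  qed
  ultimately show ?thesis by blast
qed

end
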